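(* Let $p\in[1,\infty)$. The function $d_{\mathrm{TpOT},p}$ defines a pseudometric on the space $\mathcal{P}$ of measure topological networks.
   Context: Diagonal conventions. Let $\Lambda=\{(a,b)\in\mathbb{R}^2: b>a>0\}$ and $\overline{\Lambda}=\Lambda\sqcup\{\partial_\Lambda\}$ (disjoint union topology), where $\partial_\Lambda$ is a virtual point representing the diagonal. For $\lambda=(a,b)$ put $\mathrm{Proj}(\lambda)=((a+b)/2,(a+b)/2)$. For $\lambda,\lambda'\in\Lambda$, $\|\lambda-\lambda'\|_p$ is the $\ell^p$ norm on $\mathbb{R}^2$; $\|\lambda-\partial_\Lambda\|_p=\|\partial_\Lambda-\lambda\|_p:=\|\lambda-\mathrm{Proj}(\lambda)\|_p$ and $\|\partial_\Lambda-\partial_\Lambda\|_p:=0$. Measure persistence diagram: a Radon measure $\sigma$ on $\Lambda$ with $\int_\Lambda\|\lambda-\mathrm{Proj}(\lambda)\|_q^q\,d\sigma(\lambda)<\infty$ for every $q\ge 1$. Measure topological network: a triple $P=((X,k,\mu),(Y,\iota,\nu),\omega)$ where $X$ is a Polish space with a fully supported Borel probability measure $\mu$; $k:X\times X\to\mathbb{R}$ is symmetric, measurable and bounded; $Y$ is a locally compact Polish space with a fully supported Radon measure $\nu$; $\iota:Y\to\Lambda$ is continuous and $\iota_\#\nu$ is a measure persistence diagram; $\omega:X\times Y\to\mathbb{R}$ is non-negative, measurable and bounded. $\mathcal{P}$ is the class of all of these. Let $\overline{Y}=Y\sqcup\{\partial_Y\}$ (disjoint union topology, $\partial_Y$ an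 abstract point), and extend $\omega$ and $\iota$ by $\omega(x,\partial_Y)=0$ and $\iota(\partial_Y)=\partial_\Lambda$. Couplings: $\Pi(\mu,\mu')$ is the set of Borel probability measures on $X\times X'$ with marginals $\mu,\mu'$. $\Pi_{\mathrm{adm}}(\nu,\nu')$ is the set of Radon measures $\pi$ on $\overline{Y}\times\overline{Y'}$ that have marginals $\nu$ and $\nu'$, meaning $\pi(A\times\overline{Y'})=\nu(A)$ and $\pi(\overline{Y}\times B)=\nu'(B)$ for all Borel $A\subset Y$, $B\subset Y'$, and that satisfy $\pi(\{(\partial_Y,\partial_{Y'})\})=0$. Distance: for $P=((X,k,\mu),(Y,\iota,\nu),\omega)$ and $P'=((X',k',\mu'),(Y',\iota',\nu'),\omega')$, $$d_{\mathrm{TpOT},p}(P,P')=\inf_{\pi^v\in\Pi(\mu,\mu'),\ \pi^e\in\Pi_{\mathrm{adm}}(\nu,\nu')}\Big(\int_{\overline{Y}\times\overline{Y'}}\|\iota(y)-\iota'(y')\|_p^p\,d\pi^e(y,y')+\int_{(X\times X')^2}|k(x_1,x_2)-k'(x_1',x_2')|^p\,d\pi^v(x_1,x_1')\,d\pi^v(x_2,x_2')+\int_{X\times X'\times\overline{Y}\times\overline{Y'}}|\omega(x,y)-\omega'(x',y')|^p\,d\pi^v(x,x')\,d\pi^e(y,y')\Big)^{1/p}.$$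
   Formalization: "Pseudometric" is meant in the extended sense: the distance may be infinite (e.g. counting measure on a sequence of cycles approaching the diagonal with ω = 1, against an empty Y'), so zero self-distance, symmetry and the triangle inequality are proved in [0,∞]. *)

theory Defs
  imports "HOL-Probability.Probability"
begin

subsection \<open>Borel and Radon measures on topological spaces\<close>

definition borel_of :: "'a topology \<Rightarrow> 'a measure" where
  "borel_of X = sigma (topspace X) {U. openin X U}"

definition polish_topology :: "'a topology \<Rightarrow> bool" where
  "polish_topology X \<longleftrightarrow> completely_metrizable_space X \<and> separable_space X"

definition borel_prob_measure :: "'a topology \<Rightarrow> 'a measure \<Rightarrow> bool" where
  "borel_prob_measure X \<mu> \<longleftrightarrow> sets \<mu> = sets (borel_of X) \<and> prob_space \<mu>"

definition radon_measure :: "'a topology \<Rightarrow> 'a measure \<Rightarrow> bool" where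
  "radon_measure X \<nu> \<longleftrightarrow>
     sets \<nu> = sets (borel_of X) \<and>
     (\<forall>x\<in>topspace X. \<exists>U. openin X U \<and> x \<in> U \<and> emeasure \<nu> U < \<infinity>) \<and>
     (\<forall>A\<in>sets \<nu>. emeasure \<nu> A = (SUP K\<in>{K. compactin X K \<and> K \<subseteq> A}. emeasure \<nu> K))"

definition fully_supported :: "'a topology \<Rightarrow> 'a measure \<Rightarrow> bool" where
  "fully_supported X \<mu> \<longleftrightarrow> (\<forall>U. openin X U \<and> U \<noteq> {} \<longrightarrow> 0 < emeasure \<mu> U)"


subsection \<open>Adjoining an isolated point\<close>

text \<open>
  The disjoint union of \<open>Y\<close> with a one-point space: \<open>Some y\<close> is the point \<open>y\<close> of \<open>Y\<close> and
  \<open>None\<close> is the additional point.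
\<close>

definition add_point :: "'a topology \<Rightarrow> 'a option topology" where
  "add_point Y =
     topology (\<lambda>U. U \<subseteq> insert None (Some ` topspace Y) \<and> openin Y {y. Some y \<in> U})"

lemma openin_add_point:
  "openin (add_point Y) U \<longleftrightarrow>
     U \<subseteq> insert None (Some ` topspace Y) \<and> openin Y {y. Some y \<in> U}"
proof -
  have "istopology (\<lambda>U. U \<subseteq> insert None (Some ` topspace Y) \<and> openin Y {y. Some y \<in> U})"
    unfolding istopology_def
  proof (intro conjI allI impI, goal_cases)
    case (2 S T)
    have "{y. Some y \<in> S \<inter> T} = {y. Some y \<in> S} \<inter> {y. Some y \<in> T}" by auto
    with 2 show ?case by (simp add: openin_Int)
  next
    case (4 \<K>)
    have "{y. Some y \<in> \<Union>\<K>} = (\<Union>K\<in>\<K>. {y. Some y \<in> K})" by auto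
    with 4 show ?case by auto
  qed auto
  then show ?thesis by (simp add: add_point_def topology_inverse')
qed

lemma topspace_add_point: "topspace (add_point Y) = insert None (Some ` topspace Y)"
proof -
  have "{y. Some y \<in> insert None (Some ` topspace Y)} = topspace Y" by auto
  then have "openin (add_point Y) (insert None (Some ` topspace Y))"
    by (simp add: openin_add_point)
  then show ?thesis
    by (metis openin_add_point openin_subset openin_topspace subset_antisym)
qed


subsection \<open>Persistence diagrams\<close>

definition Lambda :: "(real \<times> real) set" where
  "Lambda = {(a, b). b > a \<and> a > 0}"

definition diag_proj :: "real \<times> real \<Rightarrow> real \<times> real" where
  "diag_proj v = ((fst v + snd v) / 2, (fst v + snd v) / 2)"

definition lp_norm :: "real \<Rightarrow> real \<times> real \<Rightarrow> real" where
  "lp_norm p v = (\<bar>fst v\<bar> powr p + \<bar>snd v\<bar> powr p) powr (1 / p)"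

text \<open>
  The notation \<open>\<parallel>v - w\<parallel>\<^sub>p\<close> on \<open>Lambda\<close> with the diagonal point adjoined; \<open>None\<close> is the
  diagonal.
\<close>

fun lp_diff :: "real \<Rightarrow> (real \<times> real) option \<Rightarrow> (real \<times> real) option \<Rightarrow> real" where
  "lp_diff p (Some v) (Some w) = lp_norm p (v - w)"
| "lp_diff p (Some v) None = lp_norm p (v - diag_proj v)"
| "lp_diff p None (Some v) = lp_norm p (v - diag_proj v)"
| "lp_diff p None None = 0"

definition measure_persistence_diagram :: "(real \<times> real) measure \<Rightarrow> bool" where
  "measure_persistence_diagram \<sigma> \<longleftrightarrow>
     radon_measure (top_of_set Lambda) \<sigma> \<and>
     (\<forall>q\<ge>1. (\<integral>\<^sup>+ v. ennreal (lp_norm q (v - diag_proj v) powr q) \<partial>\<sigma>) < \<infinity>)"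


subsection \<open>Measure topological networks\<close>

text \<open>
  The underlying spaces are carriers of topologies rather than types, so that \<open>Y\<close> may be empty.
\<close>

record ('x, 'y) network =
  node_space :: "'x topology"
  node_kernel :: "'x \<Rightarrow> 'x \<Rightarrow> real"
  node_measure :: "'x measure"
  cycle_space :: "'y topology"
  cycle_map :: "'y \<Rightarrow> real \<times> real"
  cycle_measure :: "'y measure"
  incidence :: "'x \<Rightarrow> 'y \<Rightarrow> real"

definition measure_topological_networks :: "('x, 'y) network set" where
  "measure_topological_networks = {P.
     let X = node_space P; k = node_kernel P; \<mu> = node_measure P;
         Y = cycle_space P; \<iota> = cycle_map P; \<nu> = cycle_measure P;
         \<omega> = incidence P
     in
       polish_topology X \<and> borel_prob_measure X \<mu> \<and> fully_supported X \<mu> \<and>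
       (\<forall>x\<in>topspace X. \<forall>x'\<in>topspace X. k x x' = k x' x) \<and>
       case_prod k \<in> borel_measurable (borel_of (prod_topology X X)) \<and>
       bounded (case_prod k ` (topspace X \<times> topspace X)) \<and>
       polish_topology Y \<and> locally_compact_space Y \<and>
       radon_measure Y \<nu> \<and> fully_supported Y \<nu> \<and>
       continuous_map Y (top_of_set Lambda) \<iota> \<and>
       measure_persistence_diagram (distr \<nu> (borel_of (top_of_set Lambda)) \<iota>) \<and>
       (\<forall>x\<in>topspace X. \<forall>y\<in>topspace Y. 0 \<le> \<omega> x y) \<and>
       case_prod \<omega> \<in> borel_measurable (borel_of (prod_topology X Y)) \<and>
       bounded (case_prod \<omega> ` (topspace X \<times> topspace Y))}"

fun extend_incidence :: "('x \<Rightarrow> 'y \<Rightarrow> real) \<Rightarrow> 'x \<Rightarrow> 'y option \<Rightarrow> real" where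
  "extend_incidence \<omega> x (Some y) = \<omega> x y"
| "extend_incidence \<omega> x None = 0"


subsection \<open>Couplings and the distance\<close>

definition couplings ::
    "'x topology \<Rightarrow> 'x measure \<Rightarrow> 'z topology \<Rightarrow> 'z measure \<Rightarrow> ('x \<times> 'z) measure set" where
  "couplings X \<mu> X' \<mu>' = {\<pi>.
     borel_prob_measure (prod_topology X X') \<pi> \<and>
     (\<forall>A\<in>sets (borel_of X). emeasure \<pi> (A \<times> topspace X') = emeasure \<mu> A) \<and>
     (\<forall>B\<in>sets (borel_of X'). emeasure \<pi> (topspace X \<times> B) = emeasure \<mu>' B)}"

definition adm_couplings ::
    "'y topology \<Rightarrow> 'y measure \<Rightarrow> 'z topology \<Rightarrow> 'z measure
      \<Rightarrow> ('y option \<times> 'z option) measure set" where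
  "adm_couplings Y \<nu> Y' \<nu>' = {\<pi>.
     radon_measure (prod_topology (add_point Y) (add_point Y')) \<pi> \<and>
     (\<forall>A\<in>sets (borel_of Y). emeasure \<pi> (Some ` A \<times> topspace (add_point Y')) = emeasure \<nu> A) \<and>
     (\<forall>B\<in>sets (borel_of Y'). emeasure \<pi> (topspace (add_point Y) \<times> Some ` B) = emeasure \<nu>' B) \<and>
     emeasure \<pi> {(None, None)} = 0}"

definition tpot_cost ::
    "real \<Rightarrow> ('x, 'y) network \<Rightarrow> ('x2, 'y2) network
      \<Rightarrow> ('x \<times> 'x2) measure \<Rightarrow> ('y option \<times> 'y2 option) measure \<Rightarrow> ennreal" where
  "tpot_cost p P P' \<pi>v \<pi>e =
     (\<integral>\<^sup>+ (y, y'). ennreal (lp_diff p (map_option (cycle_map P) y)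
                                   (map_option (cycle_map P') y') powr p) \<partial>\<pi>e)
   + (\<integral>\<^sup>+ ((x1, x1'), (x2, x2')).
        ennreal (\<bar>node_kernel P x1 x2 - node_kernel P' x1' x2'\<bar> powr p) \<partial>(\<pi>v \<Otimes>\<^sub>M \<pi>v))
   + (\<integral>\<^sup>+ ((x, x'), (y, y')).
        ennreal (\<bar>extend_incidence (incidence P) x y
                  - extend_incidence (incidence P') x' y'\<bar> powr p) \<partial>(\<pi>v \<Otimes>\<^sub>M \<pi>e))"

definition ennreal_root :: "real \<Rightarrow> ennreal \<Rightarrow> ennreal" where
  "ennreal_root p c = (if c = \<infinity> then \<infinity> else ennreal (enn2real c powr (1 / p)))"

text \<open>
  The distance is extended-valued. Since \<open>\<omega>\<close> is merely bounded and \<open>\<nu>\<close> may have infinite mass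
  near the diagonal, every admissible pair of couplings can have infinite cost.
\<close>

definition d_TpOT :: "real \<Rightarrow> ('x, 'y) network \<Rightarrow> ('x2, 'y2) network \<Rightarrow> ennreal" where
  "d_TpOT p P P' =
     (INF (\<pi>v, \<pi>e) \<in> couplings (node_space P) (node_measure P) (node_space P') (node_measure P')
          \<times> adm_couplings (cycle_space P) (cycle_measure P) (cycle_space P') (cycle_measure P').
        ennreal_root p (tpot_cost p P P' \<pi>v \<pi>e))"

end

theory Submission
  imports Defs
begin

text \<open>
  Reflexivity comes from the diagonal couplings and symmetry from swapping coordinates. The content is
  the triangle inequality, which needs couplings of \<open>P1\<close> with \<open>P3\<close> composed from given couplings of
  \<open>P1\<close> with \<open>P2\<close> and of \<open>P2\<close> with \<open>P3\<close>.

  For the node measures this is the gluing lemma. It rests on a disintegration of one coupling over the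
  common marginal. Kernels are first built for measures with a real second coordinate, from
  Radon-Nikodym derivatives of distribution functions, and then carried to a Polish space along a
  measurable injection into the real line that has a measurable left inverse.

  For the cycle measures the extra points cannot be glued: the masses that the two couplings put over
  the middle diagonal point need not agree, and they may be infinite. Only the parts over honest middle
  points are glued. Mass that \<open>P1\<close> sends to the diagonal is sent to the diagonal of \<open>P3\<close>, and mass of
  \<open>P3\<close> that comes from the diagonal of \<open>P2\<close> comes from the diagonal of \<open>P1\<close>. This yields a measure on
  triples in which a point of \<open>P1\<close> and a point of \<open>P3\<close> are never joined through the diagonal. That is the
  one configuration in which the triangle inequality for \<open>lp_diff\<close> can fail. On all other triples it holds,
  because \<open>\<parallel>v - Proj v\<parallel>\<^sub>p\<close> is the distance from \<open>v\<close> to the diagonal line. The pair of diagonal points may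
  then carry infinite mass, but it costs nothing, so it is discarded at the end. The composed measure is
  Radon because its marginals are locally finite and every locally finite Borel measure on the spaces
  at hand is inner regular.

  What remains is Minkowski's inequality for a sum of three integrals over different measures. It is used
  in a form that is linear in the costs: for all \<open>a, b > 0\<close> the composed cost is at most
  \<open>((a + b) / a) powr (p - 1) * C12 + ((a + b) / b) powr (p - 1) * C23\<close>. Such a bound holds pointwise by
  convexity, passes to iterated integrals by linearity and monotonicity, and letting \<open>a\<close> and \<open>b\<close> decrease to the
  \<open>p\<close>-th roots of \<open>C12\<close> and \<open>C23\<close> gives the triangle inequality. The two lemmas
  \<open>couplings_compose\<close> and \<open>adm_couplings_compose\<close> are stated so that they transport exactly such bounds.
\<close>

section \<open>Borel sets of topologies\<close>

lemma space_borel_of [simp]: "space (borel_of X) = topspace X"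
  by (simp add: borel_of_def space_measure_of_conv)

lemma sets_borel_of: "sets (borel_of X) = sigma_sets (topspace X) {U. openin X U}"
  unfolding borel_of_def by (rule sets_measure_of) (auto dest: openin_subset)

lemma openin_sets_borel_of: "openin X U \<Longrightarrow> U \<in> sets (borel_of X)"
  by (simp add: sets_borel_of)

lemma closedin_sets_borel_of:
  assumes "closedin X C" shows "C \<in> sets (borel_of X)"
proof -
  have "C = space (borel_of X) - (topspace X - C)"
    using closedin_subset[OF assms] by auto
  then show ?thesis
    using assms by (metis closedin_def openin_sets_borel_of sets.compl_sets)
qed

lemma compactin_sets_borel_of: "Hausdorff_space X \<Longrightarrow> compactin X K \<Longrightarrow> K \<in> sets (borel_of X)"
  by (simp add: closedin_sets_borel_of compactin_imp_closedin)

lemma measurable_borel_ofI: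
  assumes "f \<in> space M \<rightarrow> topspace X"
    and "\<And>U. openin X U \<Longrightarrow> f -` U \<inter> space M \<in> sets M"
  shows "f \<in> M \<rightarrow>\<^sub>M borel_of X"
  unfolding borel_of_def by (rule measurable_measure_of) (use assms in \<open>auto dest: openin_subset\<close>)

lemma continuous_map_measurable:
  assumes "continuous_map X Y f" shows "f \<in> borel_of X \<rightarrow>\<^sub>M borel_of Y"
proof (rule measurable_borel_ofI)
  show "f \<in> space (borel_of X) \<rightarrow> topspace Y"
    using assms by (simp add: continuous_map_def)
  fix U assume "openin Y U"
  then have "openin X {x \<in> topspace X. f x \<in> U}"
    using assms by (simp add: continuous_map_def)
  also have "{x \<in> topspace X. f x \<in> U} = f -` U \<inter> space (borel_of X)" by auto
  finally show "f -` U \<inter> space (borel_of X) \<in> sets (borel_of X)"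
    by (rule openin_sets_borel_of)
qed

lemma sets_subset_if_measurable_ident:
  assumes "(\<lambda>x. x) \<in> M \<rightarrow>\<^sub>M N" "space M = space N"
  shows "sets N \<subseteq> sets M"
proof
  fix A assume A: "A \<in> sets N"
  from measurable_sets[OF assms(1) this] show "A \<in> sets M"
    using sets.sets_into_space[OF A] assms(2) by (simp add: Int_absorb2)
qed

text \<open>
  Second countability makes an open set of the product a countable union of open rectangles. This is what
  lets the Borel measures of \<open>couplings\<close> and \<open>adm_couplings\<close> be treated with the product sigma-algebra.
\<close>
lemma sets_borel_of_prod_topology:
  assumes "second_countable X" "second_countable Y"
  shows "sets (borel_of (prod_topology X Y)) = sets (borel_of X \<Otimes>\<^sub>M borel_of Y)" (is "?L = ?R")
proof
  obtain A where A: "countable A" "\<And>V. V \<in> A \<Longrightarrow> openin X V"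
     "\<And>U x. openin X U \<Longrightarrow> x \<in> U \<Longrightarrow> \<exists>V\<in>A. x \<in> V \<and> V \<subseteq> U"
    using assms(1) unfolding second_countable_def by metis
  obtain B where B: "countable B" "\<And>V. V \<in> B \<Longrightarrow> openin Y V"
     "\<And>U x. openin Y U \<Longrightarrow> x \<in> U \<Longrightarrow> \<exists>V\<in>B. x \<in> V \<and> V \<subseteq> U"
    using assms(2) unfolding second_countable_def by metis
  have "U \<in> ?R" if U: "openin (prod_topology X Y) U" for U
  proof -
    let ?I = "{(V, W). V \<in> A \<and> W \<in> B \<and> V \<times> W \<subseteq> U}"
    have "z \<in> (\<Union>(V, W)\<in>?I. V \<times> W)" if "z \<in> U" for z
    proof -
      have "\<forall>x y. (x, y) \<in> U \<longrightarrow> (\<exists>V W. openin X V \<and> openin Y W \<and> x \<in> V \<and> y \<in> W \<and> V \<times> W \<subseteq> U)"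
        using U by (simp add: openin_prod_topology_alt)
      moreover have "(fst z, snd z) \<in> U" using that by simp
      ultimately obtain V W where "openin X V" "openin Y W" "fst z \<in> V" "snd z \<in> W" "V \<times> W \<subseteq> U"
        by meson
      then obtain V' W' where "V' \<in> A" "fst z \<in> V'" "V' \<subseteq> V" "W' \<in> B" "snd z \<in> W'" "W' \<subseteq> W"
        using A(3) B(3) by metis
      then have "(V', W') \<in> ?I" "z \<in> V' \<times> W'"
        using \<open>V \<times> W \<subseteq> U\<close> by (auto simp: mem_Times_iff)
      then show ?thesis by blast
    qed
    then have eq: "(\<Union>(V, W)\<in>?I. V \<times> W) = U" by auto
    have "countable ?I"
      by (rule countable_subset[of _ "A \<times> B"]) (use A(1) B(1) in auto)
    moreover have "V \<times> W \<in> ?R" if "(V, W) \<in> ?I" for V W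
      using that A(2) B(2) by (auto intro!: pair_measureI openin_sets_borel_of)
    ultimately have "(\<Union>(V, W)\<in>?I. V \<times> W) \<in> ?R"
      by (intro sets.countable_UN'') auto
    then show ?thesis unfolding eq .
  qed
  then have "sigma_sets (space (borel_of X \<Otimes>\<^sub>M borel_of Y)) {U. openin (prod_topology X Y) U} \<subseteq> ?R"
    by (intro sets.sigma_sets_subset) auto
  then show "?L \<subseteq> ?R"
    by (simp add: sets_borel_of space_pair_measure)
next
  have "fst \<in> borel_of (prod_topology X Y) \<rightarrow>\<^sub>M borel_of X"
       "snd \<in> borel_of (prod_topology X Y) \<rightarrow>\<^sub>M borel_of Y"
    by (auto intro!: continuous_map_measurable continuous_map_fst continuous_map_snd)
  then have "(\<lambda>z. (fst z, snd z)) \<in> borel_of (prod_topology X Y) \<rightarrow>\<^sub>M borel_of X \<Otimes>\<^sub>M borel_of Y"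
    by (rule measurable_Pair)
  then show "?R \<subseteq> ?L"
    by (intro sets_subset_if_measurable_ident) (simp_all add: space_pair_measure)
qed

lemma polish_imp_second_countable:
  assumes "polish_topology X" shows "second_countable X"
proof -
  obtain M d where Md: "Metric_space M d" "X = Metric_space.mtopology M d"
    using assms unfolding polish_topology_def completely_metrizable_space_def by blast
  interpret Metric_space M d by fact
  obtain C where C: "countable C" "C \<subseteq> M" "mtopology closure_of C = M"
    using assms unfolding polish_topology_def separable_space_def Md(2) by auto
  let ?B = "(\<lambda>(c, n). mball c (inverse (Suc n))) ` (C \<times> (UNIV :: nat set))"
  have "\<exists>V\<in>?B. x \<in> V \<and> V \<subseteq> U" if U: "openin mtopology U" "x \<in> U" for U x
  proof -
    obtain r where r: "r > 0" "mball x r \<subseteq> U" and "x \<in> M"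
      using U unfolding openin_mtopology by blast
    obtain n where n: "inverse (Suc n) < r / 2"
      using r by (metis half_gt_zero reals_Archimedean)
    have "x \<in> mtopology closure_of C" using C \<open>x \<in> M\<close> by simp
    then obtain c where c: "c \<in> C" "c \<in> mball x (inverse (Suc n))"
      unfolding metric_closure_of by (auto dest!: spec[of _ "inverse (real (Suc n))"])
    have "mball c (inverse (Suc n)) \<subseteq> mball x r"
    proof
      fix y assume "y \<in> mball c (inverse (Suc n))"
      then show "y \<in> mball x r"
        using c n triangle[of x c y] by (auto simp del: of_nat_Suc)
    qed
    moreover have "x \<in> mball c (inverse (Suc n))"
      using c by (auto simp: commute)
    ultimately show ?thesis using r c by auto
  qed
  then show ?thesis
    unfolding second_countable_def Md(2)
    by (intro exI[of _ ?B]) (use C in auto)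
qed

lemma polish_imp_Hausdorff: "polish_topology X \<Longrightarrow> Hausdorff_space X"
  unfolding polish_topology_def
  by (intro metrizable_imp_Hausdorff_space completely_metrizable_imp_metrizable_space) auto

section \<open>The Borel structure of a space with an isolated point adjoined\<close>

declare topspace_add_point [simp]

lemma openin_Some_image: "openin Y U \<Longrightarrow> openin (add_point Y) (Some ` U)"
  using openin_subset[of Y U] by (simp add: openin_add_point image_iff subset_insertI2 image_mono)

lemma openin_None: "openin (add_point Y) {None}"
  by (simp add: openin_add_point)

lemma measurable_Some: "Some \<in> borel_of Y \<rightarrow>\<^sub>M borel_of (add_point Y)"
proof (rule measurable_borel_ofI)
  fix U assume "openin (add_point Y) U"
  then have "openin Y {y. Some y \<in> U}" by (simp add: openin_add_point)
  moreover have "Some -` U \<inter> space (borel_of Y) = {y. Some y \<in> U}"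
    using openin_subset[OF calculation] by auto
  ultimately show "Some -` U \<inter> space (borel_of Y) \<in> sets (borel_of Y)"
    by (simp add: openin_sets_borel_of)
qed (simp add: topspace_add_point)

lemma None_in_sets: "{None} \<in> sets (borel_of (add_point Y))"
  by (intro openin_sets_borel_of openin_None)

lemma Some_image_in_sets:
  assumes "A \<in> sets (borel_of Y)" shows "Some ` A \<in> sets (borel_of (add_point Y))"
proof -
  have "A \<in> sigma_sets (topspace Y) {U. openin Y U}"
    using assms by (simp add: sets_borel_of)
  then show ?thesis
  proof induction
    case (Compl a)
    have "a \<subseteq> topspace Y"
      using Compl(1) by (auto dest!: sigma_sets_into_sp[rotated] dest: openin_subset)
    then have "Some ` (topspace Y - a) = space (borel_of (add_point Y)) - {None} - Some ` a" by auto
    then show ?case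
      using Compl None_in_sets by (metis sets.Diff sets.top)
  next
    case (Union a)
    then show ?case by (simp add: image_UN)
  qed (auto intro!: openin_sets_borel_of openin_Some_image)
qed

lemma measurable_add_pointI:
  assumes "(\<lambda>y. f (Some y)) \<in> borel_of Y \<rightarrow>\<^sub>M N" "f None \<in> space N"
  shows "f \<in> borel_of (add_point Y) \<rightarrow>\<^sub>M N"
proof (rule measurableI)
  fix x assume "x \<in> space (borel_of (add_point Y))"
  then show "f x \<in> space N"
    using assms(2) measurable_space[OF assms(1)] by auto
next
  fix A assume A: "A \<in> sets N"
  have "f -` A \<inter> space (borel_of (add_point Y)) =
      Some ` ((\<lambda>y. f (Some y)) -` A \<inter> space (borel_of Y)) \<union> (if f None \<in> A then {None} else {})"
    by auto
  then show "f -` A \<inter> space (borel_of (add_point Y)) \<in> sets (borel_of (add_point Y))"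
    using sets.Un[OF Some_image_in_sets[OF measurable_sets[OF assms(1) A]] None_in_sets]
      Some_image_in_sets[OF measurable_sets[OF assms(1) A]] by (simp only: if_split) simp
qed

lemma second_countable_add_point:
  assumes "second_countable Y" shows "second_countable (add_point Y)"
proof -
  obtain B where B: "countable B" "\<And>V. V \<in> B \<Longrightarrow> openin Y V"
     "\<And>U x. openin Y U \<Longrightarrow> x \<in> U \<Longrightarrow> \<exists>V\<in>B. x \<in> V \<and> V \<subseteq> U"
    using assms unfolding second_countable_def by metis
  let ?B = "insert {None} ((`) Some ` B)"
  have "\<exists>V\<in>?B. x \<in> V \<and> V \<subseteq> U" if U: "openin (add_point Y) U" "x \<in> U" for U x
  proof (cases x)
    case (Some y)
    then obtain V where "V \<in> B" "y \<in> V" "V \<subseteq> {y. Some y \<in> U}"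
      using B(3)[of "{y. Some y \<in> U}" y] U by (auto simp: openin_add_point)
    then show ?thesis using Some by auto
  qed (use that in auto)
  then show ?thesis
    unfolding second_countable_def
    by (intro exI[of _ ?B]) (simp add: B(1,2) openin_Some_image openin_None)
qed

lemma Hausdorff_space_add_point:
  assumes "Hausdorff_space Y" shows "Hausdorff_space (add_point Y)"
  unfolding Hausdorff_space_def
proof (intro allI impI, elim conjE)
  fix x y assume xy: "x \<in> topspace (add_point Y)" "y \<in> topspace (add_point Y)" "x \<noteq> y"
  let ?T = "Some ` topspace Y"
  have T: "openin (add_point Y) ?T" by (simp add: openin_Some_image)
  consider a where "x = None" "y = Some a" "a \<in> topspace Y" | a where "y = None" "x = Some a" "a \<in> topspace Y"
    | a b where "x = Some a" "y = Some b" "a \<in> topspace Y" "b \<in> topspace Y" "a \<noteq> b"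
    using xy by (auto simp: topspace_add_point)
  then show "\<exists>U V. openin (add_point Y) U \<and> openin (add_point Y) V \<and> x \<in> U \<and> y \<in> V \<and> disjnt U V"
  proof cases
    case 1 then show ?thesis
      by (intro exI[of _ "{None}"] exI[of _ ?T]) (auto simp: disjnt_def openin_None T)
  next
    case 2 then show ?thesis
      by (intro exI[of _ ?T] exI[of _ "{None}"]) (auto simp: disjnt_def openin_None T)
  next
    case (3 a b)
    then obtain U V where "openin Y U" "openin Y V" "a \<in> U" "b \<in> V" "disjnt U V"
      using assms unfolding Hausdorff_space_def by blast
    with 3 show ?thesis
      by (intro exI[of _ "Some ` U"] exI[of _ "Some ` V"]) (auto simp: disjnt_def openin_Some_image)
  qed
qed

text \<open>
  With a point \<open>y0\<close> of \<open>Y\<close> at hand, the partial inverse of \<open>Some\<close> extends to a measurable map, and \<open>f\<close> is a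
  measurable case distinction. If \<open>Y\<close> is empty, there is no such point, but \<open>None\<close> is then the only value.
\<close>
lemma measurable_pair_add_pointI:
  assumes S: "(\<lambda>(x, y). f (x, Some y)) \<in> M \<Otimes>\<^sub>M borel_of Y \<rightarrow>\<^sub>M N"
    and N: "(\<lambda>x. f (x, None)) \<in> M \<rightarrow>\<^sub>M N"
  shows "f \<in> M \<Otimes>\<^sub>M borel_of (add_point Y) \<rightarrow>\<^sub>M N"
proof (cases "topspace Y = {}")
  case True
  have "(\<lambda>z. f (fst z, None)) \<in> M \<Otimes>\<^sub>M borel_of (add_point Y) \<rightarrow>\<^sub>M N"
    by (rule measurable_compose[OF measurable_fst N])
  then show ?thesis
    by (rule measurable_cong[THEN iffD1, rotated]) (use True in \<open>auto simp: space_pair_measure\<close>)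
next
  case False
  then obtain y0 where y0: "y0 \<in> topspace Y" by blast
  define t where "t y = (case y of None \<Rightarrow> y0 | Some y \<Rightarrow> y)" for y
  have t[measurable]: "t \<in> borel_of (add_point Y) \<rightarrow>\<^sub>M borel_of Y"
    by (rule measurable_add_pointI) (auto simp: t_def y0)
  have [measurable]: "{None} \<in> sets (borel_of (add_point Y))" by (rule None_in_sets)
  have "(\<lambda>z. (fst z, t (snd z))) \<in> M \<Otimes>\<^sub>M borel_of (add_point Y) \<rightarrow>\<^sub>M M \<Otimes>\<^sub>M borel_of Y"
    by measurable
  from measurable_compose[OF this S]
  have 1: "(\<lambda>z. f (fst z, Some (t (snd z)))) \<in> M \<Otimes>\<^sub>M borel_of (add_point Y) \<rightarrow>\<^sub>M N"
    by simp
  have 2: "(\<lambda>z. f (fst z, None)) \<in> M \<Otimes>\<^sub>M borel_of (add_point Y) \<rightarrow>\<^sub>M N"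
    by (rule measurable_compose[OF measurable_fst N])
  have "{z \<in> space (M \<Otimes>\<^sub>M borel_of (add_point Y)). snd z \<in> {None}} \<in> sets (M \<Otimes>\<^sub>M borel_of (add_point Y))"
    by measurable
  then have "(\<lambda>z. if snd z \<in> {None} then f (fst z, None) else f (fst z, Some (t (snd z))))
      \<in> M \<Otimes>\<^sub>M borel_of (add_point Y) \<rightarrow>\<^sub>M N"
    by (rule measurable_If[OF 2 1])
  then show ?thesis
    by (rule measurable_cong[THEN iffD1, rotated]) (auto simp: space_pair_measure t_def)
qed

section \<open>Coding a Polish space in the real line\<close>

text \<open>
  A substitute for \<open>M\<close> being a standard Borel space: the left inverse \<open>g\<close> suffices to push kernels on the
  real line forward to \<open>M\<close>, so nothing has to be known about the range of \<open>f\<close>. Confining \<open>f\<close> to the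
  unit interval fixes the tails of the distribution functions that occur in the disintegration.
\<close>
definition real_coded :: "'a measure \<Rightarrow> bool" where
  "real_coded M \<longleftrightarrow> (\<exists>f g. f \<in> borel_measurable M \<and> g \<in> borel \<rightarrow>\<^sub>M M \<and>
     (\<forall>x\<in>space M. g (f x) = x \<and> 0 \<le> (f x :: real) \<and> f x < 1))"

text \<open>
  A sequence of bits is written with the digits 0 and 1 in base four. As the tail after any position is at
  most a third of a unit of that position, no carry occurs and the digits can be read off with \<open>floor\<close>.
\<close>
definition base4_code :: "(nat \<Rightarrow> bool) \<Rightarrow> real" where
  "base4_code b = (\<Sum>n. of_bool (b n) * (1 / 4) ^ Suc n)"

definition base4_digit :: "nat \<Rightarrow> real \<Rightarrow> bool" where
  "base4_digit n r \<longleftrightarrow> \<lfloor>4 ^ Suc n * r\<rfloor> mod 4 = 1"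

lemma summable_base4_code: "summable (\<lambda>n. of_bool (b n) * (1 / 4 :: real) ^ Suc n)"
proof (rule summable_comparison_test')
  show "summable (\<lambda>n. (1 / 4 :: real) ^ Suc n)"
    by (simp only: summable_Suc_iff) (rule summable_geometric, simp)
qed (auto simp: of_bool_def)

lemma base4_code_bounds: "0 \<le> base4_code b" "base4_code b < 1"
proof -
  show "0 \<le> base4_code b"
    unfolding base4_code_def by (intro suminf_nonneg summable_base4_code) auto
  have "base4_code b \<le> (\<Sum>n. (1 / 4) ^ Suc n)"
    unfolding base4_code_def
    by (intro suminf_le summable_base4_code) (auto simp: of_bool_def summable_geometric)
  also have "\<dots> = 1 / 3"
    using sums_mult[OF geometric_sums[of "1/4::real"], of "1/4"] by (simp add: sums_iff)
  finally show "base4_code b < 1" by simp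
qed

lemma base4_code_Suc: "4 * base4_code b = of_bool (b 0) + base4_code (\<lambda>n. b (Suc n))"
proof -
  have "base4_code b = of_bool (b 0) * (1 / 4) + (\<Sum>n. of_bool (b (Suc n)) * (1 / 4) ^ Suc (Suc n))"
    unfolding base4_code_def using suminf_split_head[OF summable_base4_code[of b]] by simp
  also have "(\<Sum>n. of_bool (b (Suc n)) * (1 / 4) ^ Suc (Suc n)) = (1 / 4) * base4_code (\<lambda>n. b (Suc n))"
    unfolding base4_code_def
    by (subst suminf_mult[OF summable_base4_code, symmetric]) (simp add: mult_ac)
  finally show ?thesis by simp
qed

lemma base4_digit_code: "base4_digit n (base4_code b) = b n"
proof (induction n arbitrary: b)
  case 0
  have "\<lfloor>4 * base4_code b\<rfloor> = of_bool (b 0)"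
    using base4_code_bounds[of "\<lambda>n. b (Suc n)"] by (simp add: base4_code_Suc floor_eq_iff)
  then show ?case by (simp add: base4_digit_def)
next
  case (Suc n)
  have "4 ^ Suc (Suc n) * base4_code b = 4 ^ Suc n * (4 * base4_code b)" by simp
  also have "\<dots> = 4 ^ Suc n * base4_code (\<lambda>n. b (Suc n)) + of_int (4 ^ Suc n * of_bool (b 0))"
    by (simp add: base4_code_Suc distrib_left)
  finally have "\<lfloor>4 ^ Suc (Suc n) * base4_code b\<rfloor> = \<lfloor>4 ^ Suc n * base4_code (\<lambda>n. b (Suc n))\<rfloor> + 4 * (4 ^ n * of_bool (b 0))"
    by (simp only: floor_add_int power_Suc mult.assoc)
  then show ?case
    using Suc[of "\<lambda>n. b (Suc n)"] by (simp only: base4_digit_def mod_mult_self2)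
qed

text \<open>
  Let \<open>s\<close> enumerate a dense set. A point \<open>x\<close> is coded by the answers to the questions whether
  \<open>d (s i) x < 1 / 2 ^ k\<close>. Decoding takes for each \<open>k\<close> the least \<open>i\<close> whose answer is positive and passes to the limit of the
  resulting points, which exists by completeness when consecutive points are close.
\<close>
lemma real_coded_polish:
  assumes "polish_topology X" "topspace X \<noteq> {}"
  shows "real_coded (borel_of X)"
proof -
  obtain M d where Md: "Metric_space M d" "Metric_space.mcomplete M d" "X = Metric_space.mtopology M d"
    using assms(1) unfolding polish_topology_def completely_metrizable_space_def by blast
  interpret Metric_space M d by fact
  obtain C where C: "countable C" "C \<subseteq> M" "mtopology closure_of C = M"
    using assms unfolding polish_topology_def separable_space_def Md(3) by auto
  have "C \<noteq> {}" using C assms(2) by (auto simp: Md(3))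
  define s where "s = from_nat_into C"
  have sM [simp]: "s i \<in> M" for i
    using from_nat_into[OF \<open>C \<noteq> {}\<close>] C(2) unfolding s_def by blast
  have dense: "\<exists>i. d (s i) x < r" if "x \<in> M" "r > 0" for x r
  proof -
    have "x \<in> mtopology closure_of C" using C \<open>x \<in> M\<close> by simp
    then obtain c where c: "c \<in> C" "c \<in> mball x r"
      using \<open>r > 0\<close> unfolding metric_closure_of by auto
    then obtain i where "c = s i"
      using from_nat_into_surj[OF C(1)] unfolding s_def by metis
    then show ?thesis using c by (auto simp: commute)
  qed
  define f where "f x = base4_code (\<lambda>n. case prod_decode n of (k, i) \<Rightarrow> d (s i) x < (1 / 2) ^ k)" for x
  define a where "a r k = (LEAST i. base4_digit (prod_encode (k, i)) r)" for r k
  define u where "u r k = s (a r k)" for r k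
  define good where "good = {r. \<forall>k. d (u r k) (u r (Suc k)) \<le> 2 * (1 / 2) ^ k}"
  define l where "l r = (THE y. limitin mtopology (u r) y sequentially)" for r
  define g where "g r = (if r \<in> good then l r else s 0)" for r
  have uM [simp]: "u r k \<in> M" for r k by (simp add: u_def)

  have step: "d (u r k) (u r (k + m)) \<le> 4 * (1 / 2) ^ k - 4 * (1 / 2) ^ (k + m)" if "r \<in> good" for r k m
  proof (induction m)
    case (Suc m)
    have "d (u r k) (u r (k + Suc m)) \<le> d (u r k) (u r (k + m)) + d (u r (k + m)) (u r (k + Suc m))"
      by (intro triangle) auto
    also have "d (u r (k + m)) (u r (k + Suc m)) \<le> 2 * (1 / 2) ^ (k + m)"
      using that by (simp add: good_def)
    finally show ?case using Suc by simp
  qed simp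
  have step': "d (u r k) (u r n) \<le> 4 * (1 / 2) ^ k" if "r \<in> good" "k \<le> n" for r k n
  proof -
    have "d (u r k) (u r n) \<le> 4 * (1 / 2) ^ k - 4 * (1 / 2) ^ n"
      using step[OF that(1), of k "n - k"] that(2) by simp
    also have "\<dots> \<le> 4 * (1 / 2) ^ k" by simp
    finally show ?thesis .
  qed
  \<comment> \<open>Consecutive distances are summable, so a good sequence is Cauchy.\<close>
  have lim: "limitin mtopology (u r) (l r) sequentially" if r: "r \<in> good" for r
  proof -
    have "MCauchy (u r)"
      unfolding MCauchy_def
    proof (intro conjI allI impI)
      fix e :: real assume "e > 0"
      then obtain N where N: "(1 / 2 :: real) ^ N < e / 8"
        using real_arch_pow_inv[of "e / 8" "1 / 2"] by auto
      show "\<exists>N. \<forall>n n'. N \<le> n \<longrightarrow> N \<le> n' \<longrightarrow> d (u r n) (u r n') < e"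
      proof (intro exI allI impI)
        fix n n' assume "N \<le> n" "N \<le> n'"
        then have "d (u r N) (u r n) \<le> 4 * (1 / 2) ^ N" "d (u r N) (u r n') \<le> 4 * (1 / 2) ^ N"
          using step'[OF r] by auto
        then show "d (u r n) (u r n') < e"
          using N triangle''[of "u r n'" "u r N" "u r n"] by (simp add: commute)
      qed
    qed auto
    then obtain y where "limitin mtopology (u r) y sequentially"
      using Md(2) unfolding mcomplete_def by blast
    then show ?thesis
      unfolding l_def by (rule theI) (metis limitin_metric_unique trivial_limit_sequentially \<open>limitin mtopology (u r) y sequentially\<close>)
  qed
  have lM: "l r \<in> M" if "r \<in> good" for r
    using lim[OF that] by (simp add: limitin_metric)
  have lbound: "d (u r k) (l r) \<le> 4 * (1 / 2) ^ k" if r: "r \<in> good" for r k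
  proof (rule field_le_epsilon)
    fix e :: real assume "e > 0"
    then have "\<forall>\<^sub>F n in sequentially. u r n \<in> M \<and> d (u r n) (l r) < e"
      using lim[OF r] by (simp add: limitin_metric)
    then obtain N where "\<forall>n\<ge>N. d (u r n) (l r) < e"
      by (auto simp: eventually_sequentially)
    then have "d (u r (max k N)) (l r) < e" by simp
    moreover have "d (u r k) (u r (max k N)) \<le> 4 * (1 / 2) ^ k" using step'[OF r] by simp
    ultimately show "d (u r k) (l r) \<le> 4 * (1 / 2) ^ k + e"
      using triangle[of "u r k" "u r (max k N)" "l r"] lM[OF r] by simp
  qed
  have gM: "g r \<in> M" for r by (simp add: g_def lM)

  have meas_a [measurable]: "(\<lambda>r. a r k) \<in> borel \<rightarrow>\<^sub>M count_space UNIV" for k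
    unfolding a_def base4_digit_def by measurable
  have meas_d1: "(\<lambda>r. d (u r k) c) \<in> borel_measurable borel" for k c
    unfolding u_def by (rule measurable_compose[OF meas_a]) simp
  have meas_d2: "(\<lambda>r. d (u r k) (u r j)) \<in> borel_measurable borel" for k j
    unfolding u_def by (rule measurable_compose_countable[OF _ meas_a, of "\<lambda>i r. d (s i) (s (a r j))"])
      (rule measurable_compose[OF meas_a], simp)
  note [measurable] = meas_d1 meas_d2
  have [measurable]: "good \<in> sets borel"
    unfolding good_def by measurable
  \<comment> \<open>The limit lies in a closed ball iff every approximant lies in the ball enlarged by its error bound.\<close>
  have cball: "g -` mcball c \<rho> \<in> sets borel" if "c \<in> M" for c \<rho>
  proof -
    have "l r \<in> mcball c \<rho> \<longleftrightarrow> (\<forall>k. d (u r k) c \<le> \<rho> + 4 * (1 / 2) ^ k)" if r: "r \<in> good" for r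
    proof
      assume "l r \<in> mcball c \<rho>"
      then show "\<forall>k. d (u r k) c \<le> \<rho> + 4 * (1 / 2) ^ k"
        using lbound[OF r] triangle[of "u r _" "l r" c] lM[OF r] \<open>c \<in> M\<close>
        by (auto simp: commute) (smt (verit) commute uM)
    next
      assume *: "\<forall>k. d (u r k) c \<le> \<rho> + 4 * (1 / 2) ^ k"
      have "d c (l r) \<le> \<rho>"
      proof (rule field_le_epsilon)
        fix e :: real assume "e > 0"
        then obtain k where k: "(1 / 2 :: real) ^ k < e / 8"
          using real_arch_pow_inv[of "e / 8" "1 / 2"] by auto
        have "d c (l r) \<le> d (u r k) c + d (u r k) (l r)"
          using triangle''[of c "u r k" "l r"] lM[OF r] \<open>c \<in> M\<close> by (metis commute triangle uM)
        then show "d c (l r) \<le> \<rho> + e"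
          using *[rule_format, of k] lbound[OF r, of k] k by simp
      qed
      then show "l r \<in> mcball c \<rho>" using lM[OF r] \<open>c \<in> M\<close> by simp
    qed
    then have "g -` mcball c \<rho> = (good \<inter> {r. \<forall>k. d (u r k) c \<le> \<rho> + 4 * (1 / 2) ^ k})
       \<union> (if s 0 \<in> mcball c \<rho> then - good else {})"
      by (auto simp: g_def simp del: in_mcball split: if_splits)
    also have "\<dots> \<in> sets borel"
    proof (rule sets.Un)
      show "good \<inter> {r. \<forall>k. d (u r k) c \<le> \<rho> + 4 * (1 / 2) ^ k} \<in> sets borel" by measurable
    qed (use \<open>good \<in> sets borel\<close> in \<open>simp add: borel_comp\<close>)
    finally show ?thesis .
  qed
  have "g \<in> borel \<rightarrow>\<^sub>M borel_of X"
  proof (rule measurable_borel_ofI)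
    fix U assume "openin X U"
    then have U: "openin mtopology U" by (simp add: Md(3))
    let ?I = "{(i, n). mcball (s i) (inverse (Suc n)) \<subseteq> U}"
    have "x \<in> (\<Union>(i, n)\<in>?I. mcball (s i) (inverse (Suc n)))" if "x \<in> U" for x
    proof -
      obtain r where r: "r > 0" "mball x r \<subseteq> U" and "x \<in> M"
        using U \<open>x \<in> U\<close> unfolding openin_mtopology by blast
      obtain n where n: "inverse (Suc n) < r / 2"
        using r by (metis half_gt_zero reals_Archimedean)
      obtain i where i: "d (s i) x < inverse (Suc n)"
        using dense[OF \<open>x \<in> M\<close>, of "inverse (Suc n)"] by auto
      have "mcball (s i) (inverse (Suc n)) \<subseteq> mball x r"
      proof
        fix y assume "y \<in> mcball (s i) (inverse (Suc n))"
        then show "y \<in> mball x r"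
          using i n triangle[of x "s i" y] \<open>x \<in> M\<close> by (auto simp: commute simp del: of_nat_Suc)
      qed
      then have "(i, n) \<in> ?I" using r by auto
      moreover have "x \<in> mcball (s i) (inverse (Suc n))" using i \<open>x \<in> M\<close> by simp
      ultimately show ?thesis by blast
    qed
    then have "g -` U = (\<Union>(i, n)\<in>?I. g -` mcball (s i) (inverse (Suc n)))" by blast
    also have "\<dots> \<in> sets borel"
      by (intro sets.countable_UN'') (auto intro: cball)
    finally show "g -` U \<inter> space borel \<in> sets borel" by simp
  qed (auto simp: gM Md(3))
  moreover have "f \<in> borel_measurable (borel_of X)"
  proof -
    have "{x \<in> space (borel_of X). d (s i) x < (1 / 2) ^ k} \<in> sets (borel_of X)" for i k
    proof -
      have "{x \<in> space (borel_of X). d (s i) x < (1 / 2) ^ k} = mball (s i) ((1 / 2) ^ k)"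
        by (auto simp: Md(3))
      then show ?thesis by (simp add: openin_sets_borel_of Md(3))
    qed
    then have [measurable]: "Measurable.pred (borel_of X) (\<lambda>x. d (s i) x < (1 / 2) ^ k)" for i k
      by (simp add: pred_def)
    show ?thesis
      unfolding f_def base4_code_def case_prod_beta by measurable
  qed
  moreover have "g (f x) = x" if "x \<in> M" for x
  proof -
    have a: "d (u (f x) k) x < (1 / 2) ^ k" for k
    proof -
      have "base4_digit (prod_encode (k, i)) (f x) \<longleftrightarrow> d (s i) x < (1 / 2) ^ k" for i
        by (simp add: f_def base4_digit_code)
      then show ?thesis
        using LeastI_ex[where P = "\<lambda>i. d (s i) x < (1 / 2) ^ k"] dense[OF that, of "(1 / 2) ^ k"]
        by (simp add: u_def a_def)
    qed
    have good: "f x \<in> good"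
      unfolding good_def
    proof safe
      fix k
      have "d (u (f x) k) (u (f x) (Suc k)) \<le> d (u (f x) k) x + d (u (f x) (Suc k)) x"
        using triangle[of "u (f x) k" x "u (f x) (Suc k)"] that by (simp add: commute)
      also have "\<dots> \<le> (1 / 2) ^ k + (1 / 2) ^ Suc k" using a[of k] a[of "Suc k"] by simp
      also have "\<dots> \<le> 2 * (1 / 2) ^ k" by simp
      finally show "d (u (f x) k) (u (f x) (Suc k)) \<le> 2 * (1 / 2) ^ k" .
    qed
    have "limitin mtopology (u (f x)) x sequentially"
      unfolding limitin_metric
    proof (intro conjI allI impI that)
      fix e :: real assume "e > 0"
      then obtain N where N: "(1 / 2 :: real) ^ N < e"
        using real_arch_pow_inv[of e "1 / 2"] by auto
      have "u (f x) n \<in> M \<and> d (u (f x) n) x < e" if "n \<ge> N" for n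
      proof -
        have "(1 / 2 :: real) ^ n \<le> (1 / 2) ^ N" using that by (intro power_decreasing) auto
        with a[of n] N show ?thesis by (metis order.strict_trans order.strict_trans2 uM)
      qed
      then show "\<forall>\<^sub>F n in sequentially. u (f x) n \<in> M \<and> d (u (f x) n) x < e"
        by (auto simp: eventually_sequentially)
    qed
    then have "l (f x) = x"
      using lim[OF good] limitin_metric_unique trivial_limit_sequentially by metis
    then show ?thesis using good by (simp add: g_def)
  qed
  ultimately show ?thesis
    unfolding real_coded_def
    by (intro exI[of _ f] exI[of _ g]) (auto simp: Md(3) f_def base4_code_bounds)
qed

lemma real_coded_add_point:
  assumes "polish_topology Y"
  shows "real_coded (borel_of (add_point Y))"
proof (cases "topspace Y = {}")
  case True
  have "(\<lambda>_. None) \<in> borel \<rightarrow>\<^sub>M borel_of (add_point Y)" by simp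
  with True show ?thesis
    unfolding real_coded_def by (intro exI[of _ "\<lambda>_. 0"] exI[of _ "\<lambda>_. None"]) auto
next
  case False
  obtain f g where [measurable]: "f \<in> borel_measurable (borel_of Y)" "g \<in> borel \<rightarrow>\<^sub>M borel_of Y"
    and fg: "\<And>x. x \<in> topspace Y \<Longrightarrow> g (f x) = x \<and> 0 \<le> (f x :: real) \<and> f x < 1"
    using real_coded_polish[OF assms False] unfolding real_coded_def by auto
  define f' where "f' y = (case y of None \<Rightarrow> 1 / 2 | Some y \<Rightarrow> f y / 2)" for y
  define g' where "g' r = (if r < 1 / 2 then Some (g (2 * r)) else None)" for r
  have "f' \<in> borel_measurable (borel_of (add_point Y))"
    by (rule measurable_add_pointI) (auto simp: f'_def)
  moreover have "g' \<in> borel \<rightarrow>\<^sub>M borel_of (add_point Y)"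
    unfolding g'_def
    by (intro measurable_If measurable_compose[OF _ measurable_Some]) auto
  moreover have "g' (f' y) = y \<and> 0 \<le> f' y \<and> f' y < 1" if "y \<in> topspace (add_point Y)" for y
    using that fg by (cases y) (auto simp: f'_def g'_def)
  ultimately show ?thesis
    unfolding real_coded_def by (intro exI[of _ f'] exI[of _ g']) auto
qed

section \<open>Disintegration over a sigma-finite marginal\<close>

text \<open>
  The set where the inequality fails is exhausted by its intersections with sets of finite measure on which \<open>g\<close>
  is bounded, since \<open>g\<close> is finite there. On these the two integrals can be subtracted.
\<close>
lemma (in sigma_finite_measure) AE_le_if_set_nn_integral_le:
  assumes [measurable]: "f \<in> borel_measurable M" "g \<in> borel_measurable M"
    and le: "\<And>B. B \<in> sets M \<Longrightarrow> (\<integral>\<^sup>+y\<in>B. f y \<partial>M) \<le> (\<integral>\<^sup>+y\<in>B. g y \<partial>M)"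
  shows "AE y in M. f y \<le> g y"
proof -
  obtain A :: "nat \<Rightarrow> 'a set" where A: "range A \<subseteq> sets M" "(\<Union>i. A i) = space M" "\<And>i. emeasure M (A i) \<noteq> \<infinity>"
    using sigma_finite by metis
  have [measurable]: "A i \<in> sets M" for i using A(1) by auto
  have "AE y in M. \<not> (g y \<le> of_nat n \<and> y \<in> A i \<and> g y < f y)" for n i :: nat
  proof -
    let ?B = "{y \<in> space M. g y \<le> of_nat n \<and> y \<in> A i \<and> g y < f y}"
    have [measurable]: "?B \<in> sets M" by measurable
    have "(\<integral>\<^sup>+y\<in>?B. g y \<partial>M) \<le> (\<integral>\<^sup>+y. of_nat n * indicator (A i) y \<partial>M)"
      by (intro nn_integral_mono) (auto split: split_indicator)
    also have "\<dots> < \<infinity>"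
      using A(3)[of i] by (simp add: nn_integral_cmult_indicator ennreal_mult_less_top top.not_eq_extremum less_top of_nat_less_top)
    finally have fin: "(\<integral>\<^sup>+y\<in>?B. g y \<partial>M) \<noteq> \<infinity>" by simp
    have "(\<integral>\<^sup>+y. (f y * indicator ?B y - g y * indicator ?B y) \<partial>M)
        = (\<integral>\<^sup>+y\<in>?B. f y \<partial>M) - (\<integral>\<^sup>+y\<in>?B. g y \<partial>M)"
    proof (intro nn_integral_diff fin AE_I2)
      show "g y * indicator ?B y \<le> f y * indicator ?B y" for y
        by (cases "y \<in> ?B") (simp_all add: less_imp_le)
    qed auto
    also have "\<dots> = 0"
    proof (rule diff_eq_0_ennreal)
      show "(\<integral>\<^sup>+y\<in>?B. f y \<partial>M) \<le> (\<integral>\<^sup>+y\<in>?B. g y \<partial>M)" by (rule le) fact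
      then show "(\<integral>\<^sup>+y\<in>?B. f y \<partial>M) < \<top>"
        by (rule le_less_trans) (use fin in \<open>simp add: less_top\<close>)
    qed
    finally have "AE y in M. f y * indicator ?B y - g y * indicator ?B y = 0"
      by (subst (asm) nn_integral_0_iff_AE) auto
    then show ?thesis
    proof eventually_elim
      case (elim y)
      show ?case
      proof
        assume *: "g y \<le> of_nat n \<and> y \<in> A i \<and> g y < f y"
        then have "y \<in> ?B" using A by auto
        with elim have "f y - g y = 0" by simp
        then show False using * by (simp add: diff_eq_0_iff_ennreal) (metis leD)
      qed
    qed
  qed
  then have "AE y in M. \<forall>n i. \<not> (g y \<le> of_nat n \<and> y \<in> A i \<and> g y < f y)"
    unfolding AE_all_countable by blast
  then show ?thesis
  proof (rule AE_mp, intro AE_I2 impI)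
    fix y assume y: "y \<in> space M" and *: "\<forall>n i. \<not> (g y \<le> of_nat n \<and> y \<in> A i \<and> g y < f y)"
    obtain i where "y \<in> A i" using y A(2) by auto
    show "f y \<le> g y"
    proof (cases "g y = \<infinity>")
      case False
      then obtain n where "g y \<le> of_nat n"
        by (metis ennreal_Ex_less_of_nat infinity_ennreal_def less_imp_le top.not_eq_extremum)
      then show ?thesis using * \<open>y \<in> A i\<close> by (auto simp: not_less)
    qed simp
  qed
qed

text \<open>
  For each threshold \<open>x\<close> let \<open>h x\<close> be the density of \<open>B \<mapsto> \<beta> (B \<times> {..x})\<close> with respect to \<open>\<nu>\<close>. For fixed \<open>y\<close> the
  function \<open>x \<mapsto> h x y\<close> should be the distribution function of the conditional law at \<open>y\<close>, but it has the required
  properties only almost everywhere, with an exceptional set for each \<open>x\<close>. Taking the infimum over rational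
  thresholds beyond \<open>x\<close> makes it monotone and right continuous for every \<open>y\<close>, and truncating
  it outside the unit interval, where the law lives, makes its limits correct. So no exceptional set has to be
  removed in the construction. Almost everywhere monotonicity is used only for identifying the integrals.
\<close>
lemma disintegration_real:
  fixes \<beta> :: "('b \<times> real) measure"
  assumes "sigma_finite_measure \<nu>"
    and sets_\<beta>: "sets \<beta> = sets (\<nu> \<Otimes>\<^sub>M borel)"
    and marg: "\<And>B. B \<in> sets \<nu> \<Longrightarrow> emeasure \<beta> (B \<times> UNIV) = emeasure \<nu> B"
    and supp: "emeasure \<beta> (space \<nu> \<times> {..<0}) = 0" "emeasure \<beta> (space \<nu> \<times> {1..}) = 0"
  obtains \<kappa> where "\<kappa> \<in> \<nu> \<rightarrow>\<^sub>M prob_algebra borel"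
    and "\<And>B C. B \<in> sets \<nu> \<Longrightarrow> C \<in> sets borel \<Longrightarrow> emeasure \<beta> (B \<times> C) = (\<integral>\<^sup>+y\<in>B. emeasure (\<kappa> y) C \<partial>\<nu>)"
proof -
  interpret sigma_finite_measure \<nu> by fact
  note [measurable_cong] = sets_\<beta>
  have space_\<beta>: "space \<beta> = space \<nu> \<times> UNIV"
    using sets_eq_imp_space_eq[OF sets_\<beta>] by (simp add: space_pair_measure)
  have rect [measurable]: "B \<times> C \<in> sets \<beta>" if "B \<in> sets \<nu>" "C \<in> sets borel" for B C
    using that by (simp add: sets_\<beta>)
  have [measurable]: "fst \<in> \<beta> \<rightarrow>\<^sub>M \<nu>" "snd \<in> \<beta> \<rightarrow>\<^sub>M borel" by measurable
  define N where "N C = distr (density \<beta> (indicator (space \<nu> \<times> C))) \<nu> fst" for C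
  have sets_N: "sets (N C) = sets \<nu>" for C by (simp add: N_def)
  have N: "emeasure (N C) B = emeasure \<beta> (B \<times> C)" if B: "B \<in> sets \<nu>" and C: "C \<in> sets borel" for B C
  proof -
    have "emeasure (N C) B = emeasure (density \<beta> (indicator (space \<nu> \<times> C))) (fst -` B \<inter> space \<beta>)"
      unfolding N_def using B by (subst emeasure_distr) auto
    also have "\<dots> = (\<integral>\<^sup>+z. indicator (space \<nu> \<times> C) z * indicator (fst -` B \<inter> space \<beta>) z \<partial>\<beta>)"
      using B C by (intro emeasure_density) auto
    also have "\<dots> = (\<integral>\<^sup>+z. indicator (B \<times> C) z \<partial>\<beta>)"
      using sets.sets_into_space[OF B]
      by (intro nn_integral_cong) (auto simp: space_\<beta> split: split_indicator)
    also have "\<dots> = emeasure \<beta> (B \<times> C)" using B C by simp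
    finally show ?thesis .
  qed
  have N_le: "emeasure (N C) B \<le> emeasure \<nu> B" if "B \<in> sets \<nu>" "C \<in> sets borel" for B C
    unfolding N[OF that] marg[OF that(1), symmetric] using that by (intro emeasure_mono) auto
  have ac: "absolutely_continuous \<nu> (N C)" if "C \<in> sets borel" for C
    unfolding absolutely_continuous_def using N_le[OF _ that] by (auto simp: null_sets_def sets_N) (metis le_zero_eq)
  define h where "h x = RN_deriv \<nu> (N {..x})" for x :: real
  have [measurable]: "h x \<in> borel_measurable \<nu>" for x by (simp add: h_def)
  have h: "(\<integral>\<^sup>+y\<in>B. h x y \<partial>\<nu>) = emeasure \<beta> (B \<times> {..x})" if "B \<in> sets \<nu>" for x B
  proof -
    have "(\<integral>\<^sup>+y\<in>B. h x y \<partial>\<nu>) = emeasure (density \<nu> (h x)) B"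
      using that by (simp add: emeasure_density)
    also have "\<dots> = emeasure (N {..x}) B"
      unfolding h_def by (subst density_RN_deriv) (auto simp: ac sets_N)
    finally show ?thesis using N[OF that] by simp
  qed
  have h_le1: "AE y in \<nu>. h x y \<le> 1" for x
  proof (rule AE_le_if_set_nn_integral_le)
    fix B assume B: "B \<in> sets \<nu>"
    then show "(\<integral>\<^sup>+y\<in>B. h x y \<partial>\<nu>) \<le> (\<integral>\<^sup>+y\<in>B. 1 \<partial>\<nu>)"
      using h[OF B] N[OF B] N_le[OF B, of "{..x}"] by simp
  qed auto
  have h_mono: "AE y in \<nu>. h x y \<le> h q y" if "x \<le> q" for x q
  proof (rule AE_le_if_set_nn_integral_le)
    fix B assume B: "B \<in> sets \<nu>"
    then show "(\<integral>\<^sup>+y\<in>B. h x y \<partial>\<nu>) \<le> (\<integral>\<^sup>+y\<in>B. h q y \<partial>\<nu>)"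
      unfolding h[OF B] using that by (intro emeasure_mono) auto
  qed auto
  define h' where "h' q y = enn2real (min 1 (h q y))" for q y
  have h'01: "0 \<le> h' q y" "h' q y \<le> 1" for q y
    by (auto simp: h'_def intro!: enn2real_leI)
  have [measurable]: "h' q \<in> borel_measurable \<nu>" for q
    unfolding h'_def by measurable
  have ennreal_h': "ennreal (h' q y) = min 1 (h q y)" for q y
    unfolding h'_def by (rule ennreal_enn2real) (simp add: min_less_iff_disj)
  define Q where "Q x = {q \<in> \<rat>. (x::real) < q}" for x
  have Q_ne: "Q x \<noteq> {}" for x
    using Rats_dense_in_real[of x "x + 1"] by (auto simp: Q_def)
  have Q_cnt: "countable (Q x)" for x
    unfolding Q_def by (rule countable_subset[OF _ countable_rat]) auto
  have bdd: "bdd_below ((\<lambda>q. h' q y) ` Q x)" for x y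
    by (rule bdd_belowI[of _ 0]) (auto simp: h'01)
  define I where "I y x = (INF q\<in>Q x. h' q y)" for y x
  have I01: "0 \<le> I y x" "I y x \<le> 1" for x y
  proof -
    show "0 \<le> I y x" unfolding I_def by (rule cINF_greatest[OF Q_ne]) (simp add: h'01)
    obtain q where "q \<in> Q x" using Q_ne by auto
    then show "I y x \<le> 1" unfolding I_def using cINF_lower2[OF bdd] h'01 by blast
  qed
  have [measurable]: "(\<lambda>y. I y x) \<in> borel_measurable \<nu>" for x
    unfolding I_def by (rule borel_measurable_cINF[OF Q_cnt]) (auto simp: bdd)
  have I_mono: "I y x \<le> I y x'" if "x \<le> x'" for x x' y
    unfolding I_def by (rule cINF_superset_mono[OF Q_ne bdd]) (use that in \<open>auto simp: Q_def\<close>)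
  define F where "F y x = (if x < 0 then 0 else if 1 \<le> x then 1 else I y x)" for y and x :: real
  have [measurable]: "(\<lambda>y. F y x) \<in> borel_measurable \<nu>" for x
    unfolding F_def by (cases "x < 0"; cases "1 \<le> x") simp_all
  have F_mono: "F y x \<le> F y x'" if "x \<le> x'" for x x' y
    using that I_mono[OF that] I01 by (auto simp: F_def)
  have F_cont: "continuous (at_right a) (F y)" for y a
  proof -
    consider "a < 0" | "1 \<le> a" | "0 \<le> a" "a < 1" by linarith
    then have "(F y \<longlongrightarrow> F y a) (at_right a)"
    proof cases
      case 1
      then have "\<forall>\<^sub>F x in at_right a. F y a = F y x"
        by (auto simp: F_def eventually_at_right[of a 0] intro!: exI[of _ 0])
      then show ?thesis by (rule Lim_transform_eventually[OF tendsto_const])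
    next
      case 2
      then have "\<forall>\<^sub>F x in at_right a. F y a = F y x"
        by (auto simp: F_def eventually_at_right[of a "a + 1"] intro!: exI[of _ "a + 1"])
      then show ?thesis by (rule Lim_transform_eventually[OF tendsto_const])
    next
      case 3
      show ?thesis
      proof (rule order_tendstoI)
        fix c assume "c < F y a"
        then have "c < F y x" if "a < x" for x using F_mono[of a x y] that by simp
        then show "\<forall>\<^sub>F x in at_right a. c < F y x"
          by (auto simp: eventually_at_right[of a "a + 1"] intro!: exI[of _ "a + 1"])
      next
        fix c assume "F y a < c"
        then have "I y a < c" using 3 by (simp add: F_def)
        then obtain q where q: "q \<in> Q a" "h' q y < c"
          unfolding I_def using cINF_less_iff[OF Q_ne bdd] by auto
        have "F y x < c" if "a < x" "x < min q 1" for x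
        proof -
          have "q \<in> Q x" using q that by (auto simp: Q_def)
          then have "I y x \<le> h' q y" unfolding I_def by (rule cINF_lower[OF bdd])
          then show ?thesis using q that 3 by (simp add: F_def)
        qed
        moreover have "a < min q 1" using q 3 by (simp add: Q_def)
        ultimately show "\<forall>\<^sub>F x in at_right a. F y x < c"
          by (auto simp: eventually_at_right[of a "a + 1"] intro!: exI[of _ "min q 1"])
      qed
    qed
    then show ?thesis by (simp add: continuous_within)
  qed
  have F_bot: "(F y \<longlongrightarrow> 0) at_bot" for y
  proof (rule Lim_transform_eventually[OF tendsto_const])
    show "\<forall>\<^sub>F x in at_bot. 0 = F y x"
      unfolding F_def by (rule eventually_mono[OF eventually_gt_at_bot[THEN eventually_mono]]) auto
  qed
  have F_top: "(F y \<longlongrightarrow> 1) at_top" for y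
  proof (rule Lim_transform_eventually[OF tendsto_const])
    show "\<forall>\<^sub>F x in at_top. 1 = F y x"
      unfolding F_def using eventually_ge_at_top[of 1] by eventually_elim auto
  qed
  define \<kappa> where "\<kappa> y = interval_measure (F y)" for y
  have rd: "real_distribution (\<kappa> y)" for y
    unfolding \<kappa>_def by (rule real_distribution_interval_measure[OF F_mono F_cont F_bot F_top])
  then have prob: "prob_space (\<kappa> y)" for y by (simp add: real_distribution_def)
  have sets_\<kappa>: "sets (\<kappa> y) = sets borel" for y by (simp add: \<kappa>_def)
  have \<kappa>_Iic: "emeasure (\<kappa> y) {..x} = F y x" for x y
  proof -
    interpret prob_space "\<kappa> y" by (rule prob)
    have "measure (\<kappa> y) {..x} = F y x"
      unfolding \<kappa>_def by (intro measure_interval_measure_Iic F_mono F_cont F_bot)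
    then show ?thesis by (simp add: emeasure_eq_measure)
  qed
  have \<kappa>: "\<kappa> \<in> \<nu> \<rightarrow>\<^sub>M prob_algebra borel"
  proof (rule measurable_prob_algebra_generated[where \<Omega>=UNIV and G="range atMost"])
    show "sets borel = sigma_sets UNIV (range (atMost :: real \<Rightarrow> _))"
      by (subst borel_eq_atMost) (auto intro!: sets_measure_of)
    show "Int_stable (range (atMost :: real \<Rightarrow> _))"
      by (auto simp: Int_stable_def)
  qed (auto simp: prob sets_\<kappa> \<kappa>_Iic)
  note \<kappa>' [measurable] = measurable_prob_algebraD[OF \<kappa>]
  have main: "emeasure \<beta> (B \<times> {..x}) = (\<integral>\<^sup>+y\<in>B. F y x \<partial>\<nu>)" if B: "B \<in> sets \<nu>" "emeasure \<nu> B < \<infinity>" for B x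
  proof -
    have [measurable]: "B \<in> sets \<nu>" by fact
    consider "x < 0" | "1 \<le> x" | "0 \<le> x" "x < 1" by linarith
    then show ?thesis
    proof cases
      case 1
      have "emeasure \<beta> (B \<times> {..x}) \<le> emeasure \<beta> (space \<nu> \<times> {..<0})"
        using B 1 sets.sets_into_space[OF B(1)] by (intro emeasure_mono) auto
      then show ?thesis using 1 supp by (simp add: F_def)
    next
      case 2
      have "emeasure \<beta> (B \<times> {x<..}) \<le> emeasure \<beta> (space \<nu> \<times> {1..})"
        using B 2 sets.sets_into_space[OF B(1)] by (intro emeasure_mono) auto
      then have 0: "emeasure \<beta> (B \<times> {x<..}) = 0" using supp by simp
      have "emeasure \<beta> (B \<times> {..x}) + emeasure \<beta> (B \<times> {x<..}) = emeasure \<beta> (B \<times> {..x} \<union> B \<times> {x<..})"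
        using B by (intro plus_emeasure) auto
      also have "B \<times> {..x} \<union> B \<times> {x<..} = B \<times> UNIV" by auto
      finally show ?thesis using 0 2 B by (simp add: F_def marg)
    next
      case 3
      \<comment> \<open>Almost everywhere \<open>h x\<close> is a lower bound of the countably many values of which \<open>I\<close> is the infimum.\<close>
      have lower: "emeasure \<beta> (B \<times> {..x}) \<le> (\<integral>\<^sup>+y\<in>B. I y x \<partial>\<nu>)"
      proof -
        have "AE y in \<nu>. \<forall>q\<in>Q x. h x y \<le> h q y"
          by (subst AE_ball_countable[OF Q_cnt]) (auto simp: Q_def intro: h_mono)
        with h_le1[of x] have "AE y in \<nu>. h x y \<le> I y x"
        proof eventually_elim
          case (elim y)
          have "enn2real (h x y) \<le> I y x"
            unfolding I_def
          proof (rule cINF_greatest[OF Q_ne])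
            fix q assume "q \<in> Q x"
            then have "h x y \<le> min 1 (h q y)" using elim by simp
            then show "enn2real (h x y) \<le> h' q y"
              unfolding h'_def by (rule enn2real_mono) (simp add: min_less_iff_disj)
          qed
          moreover have "h x y < \<infinity>" using elim(1) by (auto intro: le_less_trans)
          ultimately show ?case
            by (metis ennreal_enn2real ennreal_leI infinity_ennreal_def)
        qed
        then show ?thesis
          unfolding h[OF B(1), symmetric]
          by (intro nn_integral_mono_AE) (auto elim!: eventually_mono intro: mult_right_mono)
      qed
      \<comment> \<open>Any rational threshold beyond \<open>x\<close> gives an upper bound, and these thresholds decrease to \<open>x\<close>.\<close>
      have upper: "(\<integral>\<^sup>+y\<in>B. I y x \<partial>\<nu>) \<le> emeasure \<beta> (B \<times> {..x + inverse (real (Suc n))})" for n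
      proof -
        obtain q where q: "q \<in> \<rat>" "x < q" "q < x + inverse (real (Suc n))"
          using Rats_dense_in_real[of x "x + inverse (real (Suc n))"] by auto
        have "ennreal (I y x) \<le> h q y" for y
        proof -
          have "I y x \<le> h' q y" unfolding I_def using q by (intro cINF_lower[OF bdd]) (simp add: Q_def)
          then have "ennreal (I y x) \<le> min 1 (h q y)" unfolding ennreal_h'[symmetric] by (rule ennreal_leI)
          then show ?thesis by simp
        qed
        then have "(\<integral>\<^sup>+y\<in>B. I y x \<partial>\<nu>) \<le> (\<integral>\<^sup>+y\<in>B. h q y \<partial>\<nu>)"
          by (intro nn_integral_mono mult_right_mono) auto
        also have "\<dots> \<le> emeasure \<beta> (B \<times> {..x + inverse (real (Suc n))})"
          unfolding h[OF B(1)] using q B by (intro emeasure_mono) auto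
        finally show ?thesis .
      qed
      have "(\<lambda>n. emeasure \<beta> (B \<times> {..x + inverse (real (Suc n))}))
          \<longlonglongrightarrow> emeasure \<beta> (\<Inter>n. B \<times> {..x + inverse (real (Suc n))})"
      proof (rule Lim_emeasure_decseq)
        show "decseq (\<lambda>n. B \<times> {..x + inverse (real (Suc n))})"
        proof (rule decseq_SucI)
          fix n
          have "inverse (real (Suc (Suc n))) \<le> inverse (real (Suc n))"
            by (intro le_imp_inverse_le) auto
          then show "B \<times> {..x + inverse (real (Suc (Suc n)))} \<subseteq> B \<times> {..x + inverse (real (Suc n))}"
            by (intro Sigma_mono) (auto intro: order_trans simp del: of_nat_Suc)
        qed
        fix i
        have "emeasure \<beta> (B \<times> {..x + inverse (real (Suc i))}) \<le> emeasure \<nu> B"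
          unfolding marg[OF B(1), symmetric] using B by (intro emeasure_mono) auto
        then show "emeasure \<beta> (B \<times> {..x + inverse (real (Suc i))}) \<noteq> \<infinity>"
          using B(2) by auto
      qed (use B in auto)
      also have "(\<Inter>n. B \<times> {..x + inverse (real (Suc n))}) = B \<times> {..x}"
      proof -
        have "z \<le> x" if "\<forall>n. z \<le> x + inverse (real (Suc n))" for z
        proof (rule field_le_epsilon)
          fix e :: real assume "0 < e"
          then obtain n where "inverse (real (Suc n)) < e" using reals_Archimedean by blast
          then show "z \<le> x + e" using that[rule_format, of n] by linarith
        qed
        then show ?thesis by (auto simp del: of_nat_Suc intro: add_increasing2)
      qed
      finally have "(\<integral>\<^sup>+y\<in>B. I y x \<partial>\<nu>) \<le> emeasure \<beta> (B \<times> {..x})"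
        by (rule LIMSEQ_le_const) (use upper in auto)
      with lower 3 show ?thesis by (simp add: F_def)
    qed
  qed
  have fin: "emeasure \<beta> (B \<times> C) = (\<integral>\<^sup>+y\<in>B. emeasure (\<kappa> y) C \<partial>\<nu>)"
    if B: "B \<in> sets \<nu>" "emeasure \<nu> B < \<infinity>" and C: "C \<in> sets borel" for B C
  proof (cases "space \<nu> = {}")
    case True
    then have "B = {}" using sets.sets_into_space[OF B(1)] by simp
    then show ?thesis by simp
  next
    case False
    have [measurable]: "B \<in> sets \<nu>" by fact
    let ?M1 = "distr (density \<beta> (indicator (B \<times> UNIV))) borel snd"
    let ?M2 = "density \<nu> (indicator B) \<bind> \<kappa>"
    have M1: "emeasure ?M1 C = emeasure \<beta> (B \<times> C)" if C: "C \<in> sets borel" for C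
    proof -
      have "emeasure ?M1 C = emeasure (density \<beta> (indicator (B \<times> UNIV))) (snd -` C \<inter> space \<beta>)"
        using C by (subst emeasure_distr) auto
      also have "\<dots> = (\<integral>\<^sup>+z. indicator (B \<times> UNIV) z * indicator (snd -` C \<inter> space \<beta>) z \<partial>\<beta>)"
        using B C by (intro emeasure_density) auto
      also have "\<dots> = (\<integral>\<^sup>+z. indicator (B \<times> C) z \<partial>\<beta>)"
        using sets.sets_into_space[OF B(1)]
        by (intro nn_integral_cong) (auto simp: space_\<beta> split: split_indicator)
      also have "\<dots> = emeasure \<beta> (B \<times> C)" using B C by simp
      finally show ?thesis .
    qed
    have M2: "emeasure ?M2 C = (\<integral>\<^sup>+y\<in>B. emeasure (\<kappa> y) C \<partial>\<nu>)" if C: "C \<in> sets borel" for C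
    proof -
      have "emeasure ?M2 C = (\<integral>\<^sup>+y. emeasure (\<kappa> y) C \<partial>density \<nu> (indicator B))"
        by (rule emeasure_bind[where N=borel]) (use False C in auto)
      also have "\<dots> = (\<integral>\<^sup>+y. indicator B y * emeasure (\<kappa> y) C \<partial>\<nu>)"
        using C by (subst nn_integral_density) auto
      finally show ?thesis by (simp add: mult.commute)
    qed
    have sM2: "sets ?M2 = sets borel"
      by (rule sets_bind) (use False in \<open>auto simp: sets_\<kappa>\<close>)
    have "?M1 = ?M2"
    proof (rule cdf_unique')
      show "finite_borel_measure ?M1"
      proof (intro finite_borel_measure.intro finite_measureI finite_borel_measure_axioms.intro)
        have "emeasure ?M1 UNIV = emeasure \<nu> B"
          using M1[of UNIV] marg[OF B(1)] by simp
        then show "emeasure ?M1 (space ?M1) \<noteq> \<infinity>" using B(2) by simp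
      qed simp
      show "finite_borel_measure ?M2"
      proof (intro finite_borel_measure.intro finite_measureI finite_borel_measure_axioms.intro)
        have "emeasure ?M2 UNIV = emeasure \<nu> B"
          using M2[of UNIV] prob_space.emeasure_space_1[OF prob] sets_eq_imp_space_eq[OF sets_\<kappa>]
          by simp
        then show "emeasure ?M2 (space ?M2) \<noteq> \<infinity>" using B(2) sets_eq_imp_space_eq[OF sM2] by simp
      qed (rule sM2)
      show "cdf ?M1 = cdf ?M2"
        unfolding cdf_def measure_def using M1 M2 main[OF B] by (simp add: \<kappa>_Iic)
    qed
    then show ?thesis using M1[OF C] M2[OF C] by simp
  qed
  have "emeasure \<beta> (B \<times> C) = (\<integral>\<^sup>+y\<in>B. emeasure (\<kappa> y) C \<partial>\<nu>)"
    if B: "B \<in> sets \<nu>" and C: "C \<in> sets borel" for B C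
  proof -
    obtain A :: "nat \<Rightarrow> 'b set" where A: "range A \<subseteq> sets \<nu>" "(\<Union>i. A i) = space \<nu>" "\<And>i. emeasure \<nu> (A i) \<noteq> \<infinity>" "incseq A"
      using sigma_finite_incseq by metis
    have [measurable]: "A i \<in> sets \<nu>" "B \<in> sets \<nu>" for i using A(1) B by auto
    have inc: "incseq (\<lambda>i. B \<inter> A i)" and un: "(\<Union>i. B \<inter> A i) = B"
      using A(4) A(2) sets.sets_into_space[OF B] by (auto simp: incseq_def)
    have lim: "(SUP i. emeasure K (B \<inter> A i)) = emeasure K B" if "sets K = sets \<nu>" for K
      by (subst SUP_emeasure_incseq) (use that inc un in auto)
    have "emeasure \<beta> (B \<times> C) = (SUP i. emeasure (N C) (B \<inter> A i))"
      using lim[OF sets_N] N[OF B C] by simp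
    also have "\<dots> = (SUP i. emeasure (density \<nu> (\<lambda>y. emeasure (\<kappa> y) C)) (B \<inter> A i))"
    proof (rule SUP_cong[OF refl])
      fix i
      have "emeasure \<nu> (B \<inter> A i) \<le> emeasure \<nu> (A i)" by (rule emeasure_mono) auto
      then have f: "emeasure \<nu> (B \<inter> A i) < \<infinity>" using A(3)[of i] by (simp add: top.not_eq_extremum le_less_trans)
      show "emeasure (N C) (B \<inter> A i) = emeasure (density \<nu> (\<lambda>y. emeasure (\<kappa> y) C)) (B \<inter> A i)"
        using fin[OF _ f C] C by (simp add: N emeasure_density)
    qed
    also have "\<dots> = (\<integral>\<^sup>+y\<in>B. emeasure (\<kappa> y) C \<partial>\<nu>)"
      using C by (subst lim) (auto simp: emeasure_density)
    finally show ?thesis .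
  qed
  then show ?thesis using \<kappa> that by blast
qed

lemma disintegration:
  fixes \<beta> :: "('b \<times> 'c) measure"
  assumes \<nu>: "sigma_finite_measure \<nu>" and coded: "real_coded M"
    and sets_\<beta>: "sets \<beta> = sets (\<nu> \<Otimes>\<^sub>M M)"
    and marg: "\<And>B. B \<in> sets \<nu> \<Longrightarrow> emeasure \<beta> (B \<times> space M) = emeasure \<nu> B"
  obtains \<kappa> where "\<kappa> \<in> \<nu> \<rightarrow>\<^sub>M prob_algebra M"
    and "\<And>B C. B \<in> sets \<nu> \<Longrightarrow> C \<in> sets M \<Longrightarrow> emeasure \<beta> (B \<times> C) = (\<integral>\<^sup>+y\<in>B. emeasure (\<kappa> y) C \<partial>\<nu>)"
proof -
  obtain f g where [measurable]: "f \<in> borel_measurable M" "g \<in> borel \<rightarrow>\<^sub>M M"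
    and fg: "\<And>x. x \<in> space M \<Longrightarrow> g (f x) = x \<and> 0 \<le> (f x :: real) \<and> f x < 1"
    using coded unfolding real_coded_def by auto
  note [measurable_cong] = sets_\<beta>
  have space_\<beta>: "space \<beta> = space \<nu> \<times> space M"
    using sets_eq_imp_space_eq[OF sets_\<beta>] by (simp add: space_pair_measure)
  let ?\<beta> = "distr \<beta> (\<nu> \<Otimes>\<^sub>M borel) (\<lambda>(y, z). (y, f z))"
  have rect: "emeasure ?\<beta> (B \<times> C) = emeasure \<beta> (B \<times> (f -` C \<inter> space M))"
    if "B \<in> sets \<nu>" "C \<in> sets borel" for B C
  proof -
    have "(\<lambda>(y, z). (y, f z)) -` (B \<times> C) \<inter> space \<beta> = B \<times> (f -` C \<inter> space M)"
      using sets.sets_into_space[OF that(1)] by (auto simp: space_\<beta>)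
    then show ?thesis using that by (subst emeasure_distr) auto
  qed
  obtain \<kappa> where \<kappa>: "\<kappa> \<in> \<nu> \<rightarrow>\<^sub>M prob_algebra borel"
    "\<And>B C. B \<in> sets \<nu> \<Longrightarrow> C \<in> sets borel \<Longrightarrow> emeasure ?\<beta> (B \<times> C) = (\<integral>\<^sup>+y\<in>B. emeasure (\<kappa> y) C \<partial>\<nu>)"
  proof (rule disintegration_real[OF \<nu>, of ?\<beta>])
    show "emeasure ?\<beta> (B \<times> UNIV) = emeasure \<nu> B" if "B \<in> sets \<nu>" for B
      using rect[OF that, of UNIV] marg[OF that] by simp
    have "f -` {..<0} \<inter> space M = {}" "f -` {1..} \<inter> space M = {}" using fg by fastforce+
    then show "emeasure ?\<beta> (space \<nu> \<times> {..<0}) = 0" "emeasure ?\<beta> (space \<nu> \<times> {1..}) = 0"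
      by (simp_all add: rect)
  qed auto
  have "(\<lambda>y. distr (\<kappa> y) M g) \<in> \<nu> \<rightarrow>\<^sub>M prob_algebra M"
    using \<kappa>(1) by measurable
  moreover have "emeasure \<beta> (B \<times> C) = (\<integral>\<^sup>+y\<in>B. emeasure (distr (\<kappa> y) M g) C \<partial>\<nu>)"
    if B: "B \<in> sets \<nu>" and C: "C \<in> sets M" for B C
  proof -
    have gC: "g -` C \<in> sets borel" using measurable_sets[of g borel M C] C by simp
    have "f -` (g -` C) \<inter> space M = C" using fg sets.sets_into_space[OF C] by auto
    then have "emeasure \<beta> (B \<times> C) = emeasure ?\<beta> (B \<times> (g -` C))"
      using rect[OF B gC] by simp
    also have "\<dots> = (\<integral>\<^sup>+y\<in>B. emeasure (\<kappa> y) (g -` C) \<partial>\<nu>)" by (rule \<kappa>(2)[OF B gC])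
    also have "\<dots> = (\<integral>\<^sup>+y\<in>B. emeasure (distr (\<kappa> y) M g) C \<partial>\<nu>)"
    proof (intro nn_integral_cong)
      fix y assume "y \<in> space \<nu>"
      then have "sets (\<kappa> y) = sets borel"
        using measurable_space[OF \<kappa>(1)] by (auto simp: space_prob_algebra)
      then have "space (\<kappa> y) = UNIV" "g \<in> \<kappa> y \<rightarrow>\<^sub>M M"
        by (auto dest: sets_eq_imp_space_eq cong: measurable_cong_sets)
      then show "emeasure (\<kappa> y) (g -` C) * indicator B y = emeasure (distr (\<kappa> y) M g) C * indicator B y"
        using C by (simp add: emeasure_distr)
    qed
    finally show ?thesis .
  qed
  ultimately show ?thesis using that by blast
qed

section \<open>Gluing two measures along a common marginal\<close>

text \<open>
  Disintegrate \<open>\<beta>\<close> over \<open>\<nu>\<close> with kernel \<open>\<kappa>\<close>, and draw the third coordinate from \<open>\<kappa> y\<close> after drawing \<open>(x, y)\<close>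
  from \<open>\<alpha>\<close>. The two spaces must be nonempty because \<open>bind\<close> over an empty space is degenerate.
\<close>
lemma gluing:
  fixes \<alpha> :: "('a \<times> 'b) measure" and \<beta> :: "('b \<times> 'c) measure"
  assumes \<nu>: "sigma_finite_measure \<nu>" and coded: "real_coded N"
    and ne: "space L \<noteq> {}" "space \<nu> \<noteq> {}"
    and sets_\<alpha>: "sets \<alpha> = sets (L \<Otimes>\<^sub>M \<nu>)" and sets_\<beta>: "sets \<beta> = sets (\<nu> \<Otimes>\<^sub>M N)"
    and marg_\<alpha>: "\<And>B. B \<in> sets \<nu> \<Longrightarrow> emeasure \<alpha> (space L \<times> B) = emeasure \<nu> B"
    and marg_\<beta>: "\<And>B. B \<in> sets \<nu> \<Longrightarrow> emeasure \<beta> (B \<times> space N) = emeasure \<nu> B"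
  obtains \<gamma> where "sets \<gamma> = sets (L \<Otimes>\<^sub>M (\<nu> \<Otimes>\<^sub>M N))"
    and "distr \<gamma> (L \<Otimes>\<^sub>M \<nu>) (\<lambda>(x, y, z). (x, y)) = \<alpha>"
    and "distr \<gamma> (\<nu> \<Otimes>\<^sub>M N) snd = \<beta>"
proof -
  obtain \<kappa> where \<kappa> [measurable]: "\<kappa> \<in> \<nu> \<rightarrow>\<^sub>M prob_algebra N"
    and \<kappa>_eq: "\<And>B C. B \<in> sets \<nu> \<Longrightarrow> C \<in> sets N \<Longrightarrow> emeasure \<beta> (B \<times> C) = (\<integral>\<^sup>+y\<in>B. emeasure (\<kappa> y) C \<partial>\<nu>)"
    using disintegration[OF \<nu> coded sets_\<beta> marg_\<beta>] by metis
  note [measurable_cong] = sets_\<alpha>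
  have space_\<alpha>: "space \<alpha> = space L \<times> space \<nu>"
    using sets_eq_imp_space_eq[OF sets_\<alpha>] by (simp add: space_pair_measure)
  have sets_\<kappa>: "sets (\<kappa> y) = sets N" and prob_\<kappa>: "prob_space (\<kappa> y)" if "y \<in> space \<nu>" for y
    using measurable_space[OF \<kappa> that] by (auto simp: space_prob_algebra)
  let ?T = "L \<Otimes>\<^sub>M (\<nu> \<Otimes>\<^sub>M N)"
  define K where "K = (\<lambda>(x, y). distr (\<kappa> y) ?T (\<lambda>z. (x, y, z)))"
  have "K \<in> \<alpha> \<rightarrow>\<^sub>M prob_algebra ?T"
    unfolding K_def by measurable
  then have K: "K \<in> \<alpha> \<rightarrow>\<^sub>M subprob_algebra ?T" by (rule measurable_prob_algebraD)
  define \<gamma> where "\<gamma> = \<alpha> \<bind> K"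
  have ne': "space \<alpha> \<noteq> {}" using ne by (simp add: space_\<alpha>)
  have sets_\<gamma> [measurable_cong]: "sets \<gamma> = sets ?T"
    unfolding \<gamma>_def by (rule sets_bind_measurable[OF K ne'])
  have space_\<gamma>: "space \<gamma> = space L \<times> space \<nu> \<times> space N"
    using sets_eq_imp_space_eq[OF sets_\<gamma>] by (simp add: space_pair_measure)
  have K_emeasure: "emeasure (K (x, y)) A = emeasure (\<kappa> y) {z \<in> space N. (x, y, z) \<in> A}"
    if "x \<in> space L" "y \<in> space \<nu>" "A \<in> sets ?T" for x y A
  proof -
    have "(\<lambda>z. (x, y, z)) \<in> \<kappa> y \<rightarrow>\<^sub>M ?T"
      using that sets_\<kappa>[OF that(2)] by (simp cong: measurable_cong_sets)
    then have "emeasure (K (x, y)) A = emeasure (\<kappa> y) ((\<lambda>z. (x, y, z)) -` A \<inter> space (\<kappa> y))"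
      unfolding K_def using that(3) by (simp add: emeasure_distr)
    also have "(\<lambda>z. (x, y, z)) -` A \<inter> space (\<kappa> y) = {z \<in> space N. (x, y, z) \<in> A}"
      using sets_eq_imp_space_eq[OF sets_\<kappa>[OF that(2)]] by auto
    finally show ?thesis .
  qed
  have \<gamma>_emeasure: "emeasure \<gamma> A = (\<integral>\<^sup>+(x, y). emeasure (\<kappa> y) {z \<in> space N. (x, y, z) \<in> A} \<partial>\<alpha>)"
    if A: "A \<in> sets ?T" for A
  proof -
    have "emeasure \<gamma> A = (\<integral>\<^sup>+w. emeasure (K w) A \<partial>\<alpha>)"
      unfolding \<gamma>_def by (rule emeasure_bind[OF ne' K A])
    also have "\<dots> = (\<integral>\<^sup>+(x, y). emeasure (\<kappa> y) {z \<in> space N. (x, y, z) \<in> A} \<partial>\<alpha>)"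
      by (intro nn_integral_cong) (auto simp: space_\<alpha> K_emeasure[OF _ _ A])
    finally show ?thesis .
  qed
  have one: "distr \<gamma> (L \<Otimes>\<^sub>M \<nu>) (\<lambda>(x, y, z). (x, y)) = \<alpha>"
  proof (rule measure_eqI)
    fix A assume "A \<in> sets (distr \<gamma> (L \<Otimes>\<^sub>M \<nu>) (\<lambda>(x, y, z). (x, y)))"
    then have A: "A \<in> sets (L \<Otimes>\<^sub>M \<nu>)" by simp
    let ?A = "(\<lambda>(x, y, z). (x, y)) -` A \<inter> space ?T"
    have A': "?A \<in> sets ?T" using A by measurable
    have "emeasure (distr \<gamma> (L \<Otimes>\<^sub>M \<nu>) (\<lambda>(x, y, z). (x, y))) A = emeasure \<gamma> ?A"
      using A sets_eq_imp_space_eq[OF sets_\<gamma>] by (simp add: emeasure_distr)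
    also have "\<dots> = (\<integral>\<^sup>+w. indicator A w \<partial>\<alpha>)"
      unfolding \<gamma>_emeasure[OF A']
    proof (intro nn_integral_cong)
      fix w assume "w \<in> space \<alpha>"
      then obtain x y where w: "w = (x, y)" "x \<in> space L" "y \<in> space \<nu>" by (auto simp: space_\<alpha>)
      have "{z \<in> space N. (x, y, z) \<in> ?A} = (if (x, y) \<in> A then space (\<kappa> y) else {})"
        using w sets_eq_imp_space_eq[OF sets_\<kappa>[OF w(3)]] by (auto simp: space_pair_measure)
      then show "(case w of (x, y) \<Rightarrow> emeasure (\<kappa> y) {z \<in> space N. (x, y, z) \<in> ?A}) = indicator A w"
        using prob_space.emeasure_space_1[OF prob_\<kappa>[OF w(3)]] w(1) by simp
    qed
    also have "\<dots> = emeasure \<alpha> A" using A sets_\<alpha> by simp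
    finally show "emeasure (distr \<gamma> (L \<Otimes>\<^sub>M \<nu>) (\<lambda>(x, y, z). (x, y))) A = emeasure \<alpha> A" .
  qed (simp add: sets_\<alpha>)
  have \<alpha>_snd: "distr \<alpha> \<nu> snd = \<nu>"
  proof (rule measure_eqI)
    fix B assume "B \<in> sets (distr \<alpha> \<nu> snd)"
    then have B: "B \<in> sets \<nu>" by simp
    have "snd -` B \<inter> space \<alpha> = space L \<times> B"
      using sets.sets_into_space[OF B] by (auto simp: space_\<alpha>)
    then show "emeasure (distr \<alpha> \<nu> snd) B = emeasure \<nu> B"
      using B marg_\<alpha>[OF B] by (simp add: emeasure_distr)
  qed simp
  have rect: "emeasure (distr \<gamma> (\<nu> \<Otimes>\<^sub>M N) snd) (B \<times> C) = emeasure \<beta> (B \<times> C)"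
    if B [measurable]: "B \<in> sets \<nu>" and C [measurable]: "C \<in> sets N" for B C
  proof -
    have A': "space L \<times> B \<times> C \<in> sets ?T" by measurable
    have "snd -` (B \<times> C) \<inter> space \<gamma> = space L \<times> B \<times> C"
      using sets.sets_into_space[OF B] sets.sets_into_space[OF C] by (auto simp: space_\<gamma>)
    moreover have "snd \<in> \<gamma> \<rightarrow>\<^sub>M \<nu> \<Otimes>\<^sub>M N"
      unfolding measurable_cong_sets[OF sets_\<gamma> refl] by (rule measurable_snd)
    moreover have "B \<times> C \<in> sets (\<nu> \<Otimes>\<^sub>M N)" by (rule pair_measureI[OF B C])
    ultimately have "emeasure (distr \<gamma> (\<nu> \<Otimes>\<^sub>M N) snd) (B \<times> C) = emeasure \<gamma> (space L \<times> B \<times> C)"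
      by (simp add: emeasure_distr)
    also have "\<dots> = (\<integral>\<^sup>+w. emeasure (\<kappa> (snd w)) C * indicator B (snd w) \<partial>\<alpha>)"
      unfolding \<gamma>_emeasure[OF A']
    proof (intro nn_integral_cong)
      fix w assume "w \<in> space \<alpha>"
      then obtain x y where w: "w = (x, y)" "x \<in> space L" "y \<in> space \<nu>" by (auto simp: space_\<alpha>)
      have "{z \<in> space N. (x, y, z) \<in> space L \<times> B \<times> C} = (if y \<in> B then C else {})"
        using w sets.sets_into_space[OF C] by auto
      then show "(case w of (x, y) \<Rightarrow> emeasure (\<kappa> y) {z \<in> space N. (x, y, z) \<in> space L \<times> B \<times> C})
          = emeasure (\<kappa> (snd w)) C * indicator B (snd w)"
        using w(1) by simp
    qed
    also have "\<dots> = (\<integral>\<^sup>+y\<in>B. emeasure (\<kappa> y) C \<partial>distr \<alpha> \<nu> snd)"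
      using measurable_prob_algebraD[OF \<kappa>] by (subst nn_integral_distr) auto
    also have "\<dots> = emeasure \<beta> (B \<times> C)"
      unfolding \<alpha>_snd by (rule \<kappa>_eq[OF B C, symmetric])
    finally show ?thesis .
  qed
  have two: "distr \<gamma> (\<nu> \<Otimes>\<^sub>M N) snd = \<beta>"
  proof -
    obtain A :: "nat \<Rightarrow> 'b set" where A: "range A \<subseteq> sets \<nu>" "(\<Union>i. A i) = space \<nu>" "\<And>i. emeasure \<nu> (A i) \<noteq> \<infinity>"
      using sigma_finite_measure.sigma_finite[OF \<nu>] by metis
    show ?thesis
    proof (rule measure_eqI_generator_eq[OF Int_stable_pair_measure_generator, where A="\<lambda>i. A i \<times> space N"])
      show "{a \<times> b |a b. a \<in> sets \<nu> \<and> b \<in> sets N} \<subseteq> Pow (space \<nu> \<times> space N)"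
        using sets.space_closed[of \<nu>] sets.space_closed[of N] by auto
      show "sets (distr \<gamma> (\<nu> \<Otimes>\<^sub>M N) snd) = sigma_sets (space \<nu> \<times> space N) {a \<times> b |a b. a \<in> sets \<nu> \<and> b \<in> sets N}"
           "sets \<beta> = sigma_sets (space \<nu> \<times> space N) {a \<times> b |a b. a \<in> sets \<nu> \<and> b \<in> sets N}"
        by (simp_all add: sets_pair_measure sets_\<beta>)
      show "emeasure (distr \<gamma> (\<nu> \<Otimes>\<^sub>M N) snd) X = emeasure \<beta> X"
        if "X \<in> {a \<times> b |a b. a \<in> sets \<nu> \<and> b \<in> sets N}" for X
        using that rect by auto
      show "emeasure (distr \<gamma> (\<nu> \<Otimes>\<^sub>M N) snd) (A i \<times> space N) \<noteq> \<infinity>" for i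
      proof -
        have "A i \<in> sets \<nu>" using A(1) by auto
        then show ?thesis using A(3)[of i] marg_\<beta>[of "A i"] rect[of "A i" "space N"] by simp
      qed
    qed (use A in auto)
  qed
  show ?thesis by (rule that[OF sets_\<gamma> one two])
qed

text \<open>
  The form in which gluing is used. The sigma-algebra of the marginal is replaced by an equal one, so that \<open>\<nu>\<close> does not
  occur in the measurability conditions.
\<close>
lemma gluing_integrals:
  fixes \<alpha> :: "('a \<times> 'b) measure" and \<beta> :: "('b \<times> 'c) measure"
  assumes \<nu>: "sigma_finite_measure \<nu>" "sets \<nu> = sets M" and coded: "real_coded N"
    and ne: "space L \<noteq> {}" "space M \<noteq> {}"
    and sets: "sets \<alpha> = sets (L \<Otimes>\<^sub>M M)" "sets \<beta> = sets (M \<Otimes>\<^sub>M N)"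
    and marg: "\<And>B. B \<in> sets M \<Longrightarrow> emeasure \<alpha> (space L \<times> B) = emeasure \<nu> B"
      "\<And>B. B \<in> sets M \<Longrightarrow> emeasure \<beta> (B \<times> space N) = emeasure \<nu> B"
  obtains \<gamma> where "sets \<gamma> = sets (L \<Otimes>\<^sub>M (M \<Otimes>\<^sub>M N))"
    and "\<And>c. c \<in> borel_measurable (L \<Otimes>\<^sub>M M) \<Longrightarrow> (\<integral>\<^sup>+w. c w \<partial>\<alpha>) = (\<integral>\<^sup>+(x, y, z). c (x, y) \<partial>\<gamma>)"
    and "\<And>c. c \<in> borel_measurable (M \<Otimes>\<^sub>M N) \<Longrightarrow> (\<integral>\<^sup>+w. c w \<partial>\<beta>) = (\<integral>\<^sup>+(x, y, z). c (y, z) \<partial>\<gamma>)"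
proof -
  have pair: "sets (L \<Otimes>\<^sub>M \<nu>) = sets (L \<Otimes>\<^sub>M M)" "sets (\<nu> \<Otimes>\<^sub>M N) = sets (M \<Otimes>\<^sub>M N)"
    by (intro sets_pair_measure_cong refl \<nu>(2))+
  have "space \<nu> \<noteq> {}" using ne sets_eq_imp_space_eq[OF \<nu>(2)] by simp
  then obtain \<gamma> where \<gamma>: "sets \<gamma> = sets (L \<Otimes>\<^sub>M (\<nu> \<Otimes>\<^sub>M N))"
    "distr \<gamma> (L \<Otimes>\<^sub>M \<nu>) (\<lambda>(x, y, z). (x, y)) = \<alpha>" "distr \<gamma> (\<nu> \<Otimes>\<^sub>M N) snd = \<beta>"
    using gluing[OF \<nu>(1) coded ne(1), of \<alpha> \<beta>] sets pair marg \<nu>(2) by metis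
  have p: "(\<lambda>(x, y, z). (x, y)) \<in> \<gamma> \<rightarrow>\<^sub>M L \<Otimes>\<^sub>M \<nu>" "snd \<in> \<gamma> \<rightarrow>\<^sub>M \<nu> \<Otimes>\<^sub>M N"
    unfolding measurable_cong_sets[OF \<gamma>(1) refl] by measurable
  show ?thesis
  proof (rule that)
    show "sets \<gamma> = sets (L \<Otimes>\<^sub>M (M \<Otimes>\<^sub>M N))"
      unfolding \<gamma>(1) by (intro sets_pair_measure_cong refl pair(2))
    show "(\<integral>\<^sup>+w. c w \<partial>\<alpha>) = (\<integral>\<^sup>+(x, y, z). c (x, y) \<partial>\<gamma>)" if "c \<in> borel_measurable (L \<Otimes>\<^sub>M M)" for c
      unfolding \<gamma>(2)[symmetric]
      by (subst nn_integral_distr[OF p(1)])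
         (use that in \<open>simp_all only: measurable_distr_eq1 measurable_cong_sets[OF pair(1) refl] split_beta' fst_conv snd_conv\<close>)
    show "(\<integral>\<^sup>+w. c w \<partial>\<beta>) = (\<integral>\<^sup>+(x, y, z). c (y, z) \<partial>\<gamma>)" if "c \<in> borel_measurable (M \<Otimes>\<^sub>M N)" for c
      unfolding \<gamma>(3)[symmetric]
      by (subst nn_integral_distr[OF p(2)])
         (use that in \<open>simp_all only: measurable_distr_eq1 measurable_cong_sets[OF pair(2) refl] split_beta' prod.collapse\<close>)
  qed
qed

section \<open>Automatic regularity of locally finite measures\<close>

text \<open>
  A network is like a base of the topology, except that its members need not be open. A countable network of
  compact sets makes open sets and closed sets countable unions of compact sets. It is
  inherited by products and by adjoining an isolated point: take products, respectively images and the new point.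
\<close>
definition countable_compact_network :: "'a topology \<Rightarrow> bool" where
  "countable_compact_network X \<longleftrightarrow> (\<exists>\<K>. countable \<K> \<and> (\<forall>K\<in>\<K>. compactin X K) \<and>
     (\<forall>U x. openin X U \<longrightarrow> x \<in> U \<longrightarrow> (\<exists>K\<in>\<K>. x \<in> K \<and> K \<subseteq> U)))"

lemma countable_compact_network_locally_compact:
  assumes "second_countable X" "Hausdorff_space X" "locally_compact_space X"
  shows "countable_compact_network X"
proof -
  obtain B where B: "countable B" "\<And>V. V \<in> B \<Longrightarrow> openin X V"
     "\<And>U x. openin X U \<Longrightarrow> x \<in> U \<Longrightarrow> \<exists>V\<in>B. x \<in> V \<and> V \<subseteq> U"
    using assms(1) unfolding second_countable_def by metis
  let ?K = "{K \<in> (closure_of) X ` B. compactin X K}"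
  have nb: "neighbourhood_base_of (\<lambda>C. compactin X C \<and> closedin X C) X"
    using assms(2,3) by (simp add: locally_compact_space_neighbourhood_base_closedin)
  have "\<exists>K\<in>?K. x \<in> K \<and> K \<subseteq> U" if U: "openin X U" "x \<in> U" for U x
  proof -
    obtain V C where VC: "openin X V" "compactin X C" "closedin X C" "x \<in> V" "V \<subseteq> C" "C \<subseteq> U"
      using nb U unfolding neighbourhood_base_of by metis
    obtain W where W: "W \<in> B" "x \<in> W" "W \<subseteq> V" using B(3) VC by metis
    have sub: "X closure_of W \<subseteq> C"
      using VC W by (intro closure_of_minimal) auto
    then have "compactin X (X closure_of W)"
      using VC(2) by (meson closed_compactin closedin_closure_of)
    moreover have "x \<in> X closure_of W"
      using W B(2) by (meson closure_of_subset openin_subset subsetD)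
    ultimately show ?thesis using W VC sub by blast
  qed
  moreover have "countable ?K" using B(1) by (intro countable_subset[OF Collect_restrict]) auto
  ultimately show ?thesis
    unfolding countable_compact_network_def by (intro exI[of _ ?K]) auto
qed

lemma countable_compact_network_add_point:
  assumes "countable_compact_network Y"
  shows "countable_compact_network (add_point Y)"
proof -
  obtain \<K> where \<K>: "countable \<K>" "\<And>K. K \<in> \<K> \<Longrightarrow> compactin Y K"
     "\<And>U x. openin Y U \<Longrightarrow> x \<in> U \<Longrightarrow> \<exists>K\<in>\<K>. x \<in> K \<and> K \<subseteq> U"
    using assms unfolding countable_compact_network_def by metis
  let ?K = "insert {None} ((`) Some ` \<K>)"
  have "continuous_map Y (add_point Y) Some"
    unfolding continuous_map_def
    by (auto simp: openin_add_point Collect_conj_eq openin_Int)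
  then have "compactin (add_point Y) (Some ` K)" if "K \<in> \<K>" for K
    using \<K>(2)[OF that] image_compactin by blast
  moreover have "\<exists>K\<in>?K. x \<in> K \<and> K \<subseteq> U" if U: "openin (add_point Y) U" "x \<in> U" for U x
  proof (cases x)
    case (Some y)
    then obtain V where "V \<in> \<K>" "y \<in> V" "V \<subseteq> {y. Some y \<in> U}"
      using \<K>(3)[of "{y. Some y \<in> U}" y] U by (auto simp: openin_add_point)
    then show ?thesis using Some by auto
  qed (use that in auto)
  ultimately show ?thesis
    unfolding countable_compact_network_def
    by (intro exI[of _ ?K]) (simp add: \<K>(1))
qed

lemma countable_compact_network_prod:
  assumes "countable_compact_network X" "countable_compact_network Y"
  shows "countable_compact_network (prod_topology X Y)"
proof -
  obtain A where A: "countable A" "\<And>K. K \<in> A \<Longrightarrow> compactin X K"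
     "\<And>U x. openin X U \<Longrightarrow> x \<in> U \<Longrightarrow> \<exists>K\<in>A. x \<in> K \<and> K \<subseteq> U"
    using assms(1) unfolding countable_compact_network_def by metis
  obtain B where B: "countable B" "\<And>K. K \<in> B \<Longrightarrow> compactin Y K"
     "\<And>U x. openin Y U \<Longrightarrow> x \<in> U \<Longrightarrow> \<exists>K\<in>B. x \<in> K \<and> K \<subseteq> U"
    using assms(2) unfolding countable_compact_network_def by metis
  let ?K = "(\<lambda>(K, L). K \<times> L) ` (A \<times> B)"
  have "\<exists>K\<in>?K. z \<in> K \<and> K \<subseteq> U" if U: "openin (prod_topology X Y) U" "z \<in> U" for U z
  proof -
    have "\<forall>x y. (x, y) \<in> U \<longrightarrow> (\<exists>V W. openin X V \<and> openin Y W \<and> x \<in> V \<and> y \<in> W \<and> V \<times> W \<subseteq> U)"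
      using U by (simp add: openin_prod_topology_alt)
    moreover have "(fst z, snd z) \<in> U" using that by simp
    ultimately obtain V W where VW: "openin X V" "openin Y W" "fst z \<in> V" "snd z \<in> W" "V \<times> W \<subseteq> U"
      by meson
    obtain K where K: "K \<in> A" "fst z \<in> K" "K \<subseteq> V" using A(3) VW by metis
    obtain L where L: "L \<in> B" "snd z \<in> L" "L \<subseteq> W" using B(3) VW by metis
    have "K \<times> L \<in> ?K" using K L by auto
    moreover have "z \<in> K \<times> L" "K \<times> L \<subseteq> U" using K L VW by (auto simp: mem_Times_iff)
    ultimately show ?thesis by blast
  qed
  then show ?thesis
    unfolding countable_compact_network_def
    by (intro exI[of _ ?K]) (use A B in \<open>auto simp: compactin_Times\<close>)
qed

lemma compact_exhaustion:
  assumes "countable_compact_network X"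
  obtains L where "\<And>n::nat. compactin X (L n)" "incseq L" "(\<Union>n. L n) = topspace X"
proof -
  obtain \<K> where \<K>: "countable \<K>" "\<And>K. K \<in> \<K> \<Longrightarrow> compactin X K"
     "\<And>U x. openin X U \<Longrightarrow> x \<in> U \<Longrightarrow> \<exists>K\<in>\<K>. x \<in> K \<and> K \<subseteq> U"
    using assms unfolding countable_compact_network_def by metis
  define e where "e = from_nat_into (insert {} \<K>)"
  have range_e: "range e = insert {} \<K>"
    unfolding e_def using \<K>(1) by (intro range_from_nat_into) auto
  then have comp: "compactin X (e i)" for i
    using \<K>(2) by (metis compactin_empty insert_iff rangeI)
  define L where "L n = (\<Union>i<n. e i)" for n
  have "compactin X (L n)" for n
    unfolding L_def using comp by (intro compactin_Union) auto
  moreover have "incseq L"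
    unfolding L_def incseq_def by (auto intro: less_le_trans)
  moreover have "(\<Union>n. L n) = topspace X"
  proof
    show "(\<Union>n. L n) \<subseteq> topspace X"
      using \<open>\<And>n. compactin X (L n)\<close> compactin_subset_topspace by blast
    show "topspace X \<subseteq> (\<Union>n. L n)"
    proof
      fix x assume "x \<in> topspace X"
      then obtain K where "K \<in> \<K>" "x \<in> K" using \<K>(3)[OF openin_topspace] by blast
      then obtain i where "x \<in> e i" using range_e by (metis insertI2 rangeE)
      then have "x \<in> L (Suc i)" by (auto simp: L_def)
      then show "x \<in> (\<Union>n. L n)" by blast
    qed
  qed
  ultimately show ?thesis by (rule that)
qed

lemma emeasure_compact_finite:
  assumes sets: "sets M = sets (borel_of X)"
    and loc: "\<And>x. x \<in> topspace X \<Longrightarrow> \<exists>U. openin X U \<and> x \<in> U \<and> emeasure M U < \<infinity>"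
    and "compactin X K"
  shows "emeasure M K < \<infinity>"
proof -
  let ?U = "{U. openin X U \<and> emeasure M U < \<infinity>}"
  have "K \<subseteq> \<Union>?U" using loc compactin_subset_topspace[OF assms(3)] by blast
  then obtain F where F: "finite F" "F \<subseteq> ?U" "K \<subseteq> \<Union>F"
    using assms(3) unfolding compactin_def by (metis (no_types, lifting) mem_Collect_eq)
  have "emeasure M K \<le> emeasure M (\<Union>U\<in>F. U)"
    using F by (intro emeasure_mono) (auto simp: sets intro!: sets.finite_Union openin_sets_borel_of)
  also have "\<dots> \<le> (\<Sum>U\<in>F. emeasure M U)"
    using F by (intro emeasure_subadditive_finite) (auto simp: sets intro: openin_sets_borel_of)
  also have "\<dots> < \<infinity>" using F by (auto simp: subset_iff less_top)
  finally show ?thesis .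
qed

text \<open>
  The sets that can be approximated from inside by compact sets are closed under countable unions and countable
  intersections. They contain the open and the closed sets, as these are countable unions of compact sets. Hence
  the sets for which both they and their complements can be approximated form a sigma-algebra that contains
  the open sets.
\<close>
lemma (in finite_measure) inner_regular_compact:
  assumes X: "Hausdorff_space X" "countable_compact_network X"
    and sets: "sets M = sets (borel_of X)" and "A \<in> sets M" "0 < (e::real)"
  shows "\<exists>K. compactin X K \<and> K \<subseteq> A \<and> measure M (A - K) < e"
proof -
  define approx where
    "approx A \<longleftrightarrow> A \<in> sets M \<and> (\<forall>e>0. \<exists>K. compactin X K \<and> K \<subseteq> A \<and> measure M (A - K) < e)" for A
  have space: "space M = topspace X" using sets_eq_imp_space_eq[OF sets] by simp
  have compact_sets: "K \<in> sets M" if "compactin X K" for K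
    using that X(1) by (simp add: sets compactin_sets_borel_of)
  have compact: "approx K" if "compactin X K" for K
    using that compact_sets[OF that] by (auto simp: approx_def intro!: exI[of _ K])
  have geom: "(\<lambda>n. e * (1 / 2) ^ Suc (Suc n)) sums (e / 2)" for e :: real
    using sums_mult[OF geometric_sums[of "1/2::real"], of "e / 4"] by simp
  have small: "measure M S < e" if "0 < e" "S \<in> sets M" "S \<subseteq> (\<Union>n. D n)" "\<And>n::nat. D n \<in> sets M"
    "\<And>n. measure M (D n) < e * (1 / 2) ^ Suc (Suc n)" for D S and e :: real
  proof -
    have "emeasure M S \<le> emeasure M (\<Union>n. D n)" using that by (intro emeasure_mono) auto
    also have "\<dots> \<le> (\<Sum>n. emeasure M (D n))" using that by (intro emeasure_subadditive_countably) auto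
    also have "\<dots> \<le> (\<Sum>n. ennreal (e * (1 / 2) ^ Suc (Suc n)))"
      by (intro suminf_le) (use that in \<open>auto simp: emeasure_eq_measure intro!: ennreal_leI less_imp_le\<close>)
    also have "\<dots> = ennreal (e / 2)"
      using geom[of e] \<open>0 < e\<close> by (subst suminf_ennreal2) (auto simp: sums_iff)
    finally show ?thesis using \<open>0 < e\<close> by (simp add: emeasure_eq_measure ennreal_le_iff)
  qed
  have union: "approx (\<Union>n::nat. A n)" if A: "\<And>n. approx (A n)" for A
    unfolding approx_def
  proof (intro conjI allI impI)
    have As: "A n \<in> sets M" for n using A by (simp add: approx_def)
    then show "(\<Union>n. A n) \<in> sets M" by auto
    fix e :: real assume "0 < e"
    then have "0 < (e / 2) * (1 / 2) ^ Suc (Suc n)" for n by simp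
    then have "\<forall>n. \<exists>K. compactin X K \<and> K \<subseteq> A n \<and> measure M (A n - K) < (e / 2) * (1 / 2) ^ Suc (Suc n)"
      using A unfolding approx_def by blast
    then obtain K where K: "\<And>n. compactin X (K n)" "\<And>n. K n \<subseteq> A n"
      "\<And>n. measure M (A n - K n) < (e / 2) * (1 / 2) ^ Suc (Suc n)" by metis
    have Ks: "K n \<in> sets M" for n using K(1) by (rule compact_sets)
    \<comment> \<open>A countable union of compact sets need not be compact: half of the error is kept for cutting it off.\<close>
    have 1: "measure M ((\<Union>n. A n) - (\<Union>n. K n)) < e / 2"
      by (rule small[of "e / 2" _ "\<lambda>n. A n - K n"]) (use \<open>0 < e\<close> As Ks K(3) in auto)
    have "(\<lambda>N. measure M (\<Union>n<N. K n)) \<longlonglongrightarrow> measure M (\<Union>N. \<Union>n<N. K n)"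
      by (rule finite_Lim_measure_incseq) (use Ks in \<open>auto simp: incseq_def intro: less_le_trans\<close>)
    also have "(\<Union>N. \<Union>n<N. K n) = (\<Union>n. K n)" by blast
    finally have "\<forall>\<^sub>F N in sequentially. measure M (\<Union>n. K n) - e / 2 < measure M (\<Union>n<N. K n)"
      by (rule order_tendstoD) (use \<open>0 < e\<close> in simp)
    then obtain N where N: "measure M (\<Union>n. K n) - e / 2 < measure M (\<Union>n<N. K n)"
      by (auto simp: eventually_sequentially)
    have "measure M ((\<Union>n. A n) - (\<Union>n<N. K n)) = measure M (\<Union>n. A n) - measure M (\<Union>n<N. K n)"
      using K(2) As Ks by (intro finite_measure_Diff) auto
    moreover have "measure M ((\<Union>n. A n) - (\<Union>n. K n)) = measure M (\<Union>n. A n) - measure M (\<Union>n. K n)"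
      using K(2) As Ks by (intro finite_measure_Diff) auto
    ultimately have "measure M ((\<Union>n. A n) - (\<Union>n<N. K n)) < e" using 1 N by simp
    moreover have "compactin X (\<Union>n<N. K n)" using K(1) by (intro compactin_Union) auto
    ultimately show "\<exists>K. compactin X K \<and> K \<subseteq> (\<Union>n. A n) \<and> measure M ((\<Union>n. A n) - K) < e"
      using K(2) by blast
  qed
  have inter: "approx (\<Inter>n::nat. A n)" if A: "\<And>n. approx (A n)" for A
    unfolding approx_def
  proof (intro conjI allI impI)
    have As: "A n \<in> sets M" for n using A by (simp add: approx_def)
    then show "(\<Inter>n. A n) \<in> sets M" by auto
    fix e :: real assume "0 < e"
    then have "0 < e * (1 / 2) ^ Suc (Suc n)" for n by simp
    then have "\<forall>n. \<exists>K. compactin X K \<and> K \<subseteq> A n \<and> measure M (A n - K) < e * (1 / 2) ^ Suc (Suc n)"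
      using A unfolding approx_def by blast
    then obtain K where K: "\<And>n. compactin X (K n)" "\<And>n. K n \<subseteq> A n"
      "\<And>n. measure M (A n - K n) < e * (1 / 2) ^ Suc (Suc n)" by metis
    have Ks: "K n \<in> sets M" for n using K(1) by (rule compact_sets)
    have "measure M ((\<Inter>n. A n) - (\<Inter>n. K n)) < e"
      by (rule small[of e _ "\<lambda>n. A n - K n"]) (use \<open>0 < e\<close> As Ks K(3) in auto)
    moreover have "compactin X (\<Inter>n. K n)"
    proof (rule closed_compactin[OF K(1)[of 0]])
      show "closedin X (\<Inter>n. K n)"
        using K(1) X(1) by (intro closedin_Inter) (auto intro: compactin_imp_closedin)
    qed auto
    ultimately show "\<exists>K. compactin X K \<and> K \<subseteq> (\<Inter>n. A n) \<and> measure M ((\<Inter>n. A n) - K) < e"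
      using K(2) by blast
  qed
  obtain \<K> where \<K>: "countable \<K>" "\<And>K. K \<in> \<K> \<Longrightarrow> compactin X K"
     "\<And>U x. openin X U \<Longrightarrow> x \<in> U \<Longrightarrow> \<exists>K\<in>\<K>. x \<in> K \<and> K \<subseteq> U"
    using X(2) unfolding countable_compact_network_def by metis
  obtain L where L: "\<And>n::nat. compactin X (L n)" "(\<Union>n. L n) = topspace X"
    using compact_exhaustion[OF X(2)] by metis
  have open_approx: "approx U" if U: "openin X U" for U
  proof -
    let ?e = "from_nat_into (insert {} {K \<in> \<K>. K \<subseteq> U})"
    have "range ?e = insert {} {K \<in> \<K>. K \<subseteq> U}"
      using \<K>(1) by (intro range_from_nat_into) auto
    then have "(\<Union>n. ?e n) = \<Union>{K \<in> \<K>. K \<subseteq> U}" by simp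
    also have "\<dots> = U" using \<K>(3)[OF U] by blast
    finally have eq: "(\<Union>n. ?e n) = U" .
    have "compactin X (?e n)" for n
      using from_nat_into[of "insert {} {K \<in> \<K>. K \<subseteq> U}" n] \<K>(2) by auto
    then have "approx (\<Union>n. ?e n)" by (intro union compact)
    then show ?thesis unfolding eq .
  qed
  have closed_approx: "approx C" if C: "closedin X C" for C
  proof -
    have "approx (L n \<inter> C)" for n
      by (intro compact compact_Int_closedin L(1) C)
    then have "approx (\<Union>n. L n \<inter> C)" by (rule union)
    also have "(\<Union>n. L n \<inter> C) = C" using L(2) closedin_subset[OF C] by auto
    finally show ?thesis .
  qed
  have "A \<in> sigma_sets (topspace X) {U. openin X U}"
    using \<open>A \<in> sets M\<close> by (simp add: sets sets_borel_of)
  then have "approx A \<and> approx (topspace X - A)"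
  proof induction
    case (Basic U)
    then show ?case using open_approx closed_approx by blast
  next
    case Empty
    then show ?case using open_approx by simp
  next
    case (Compl A)
    have "A \<subseteq> topspace X"
      using Compl(2) sets.sets_into_space[of A M] unfolding approx_def space by blast
    then show ?case using Compl by (simp add: double_diff)
  next
    case (Union A)
    have eq: "topspace X - (\<Union>n. A n) = (\<Inter>n. topspace X - A n)" by auto
    have "approx (\<Union>n. A n)" by (rule union) (use Union in blast)
    moreover have "approx (\<Inter>n. topspace X - A n)" by (rule inter) (use Union in blast)
    ultimately show ?case unfolding eq by blast
  qed
  then show ?thesis using \<open>0 < e\<close> unfolding approx_def by blast
qed

text \<open>
  The space is an increasing union of compact sets of finite measure, and inner regularity of the restrictions to
  these sets is inherited by the whole measure.
\<close>
lemma radon_measureI: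
  assumes X: "Hausdorff_space X" "countable_compact_network X"
    and sets: "sets M = sets (borel_of X)"
    and loc: "\<And>x. x \<in> topspace X \<Longrightarrow> \<exists>U. openin X U \<and> x \<in> U \<and> emeasure M U < \<infinity>"
  shows "radon_measure X M"
  unfolding radon_measure_def
proof (intro conjI ballI sets loc)
  fix A assume A: "A \<in> sets M"
  let ?S = "SUP K\<in>{K. compactin X K \<and> K \<subseteq> A}. emeasure M K"
  have compact_sets: "K \<in> sets M" if "compactin X K" for K
    using that X(1) by (simp add: sets compactin_sets_borel_of)
  obtain L where L: "\<And>n::nat. compactin X (L n)" "incseq L" "(\<Union>n. L n) = topspace X"
    using compact_exhaustion[OF X(2)] by metis
  have Ls [measurable]: "L n \<in> sets M" for n using L(1) by (rule compact_sets)
  have "emeasure M A = (SUP n. emeasure M (A \<inter> L n))"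
  proof -
    have "(\<Union>n. A \<inter> L n) = A"
      using sets.sets_into_space[OF A] sets_eq_imp_space_eq[OF sets] L(3) by auto
    moreover have "(SUP n. emeasure M (A \<inter> L n)) = emeasure M (\<Union>n. A \<inter> L n)"
      by (rule SUP_emeasure_incseq) (use A Ls L(2) in \<open>auto simp: incseq_def\<close>)
    ultimately show ?thesis by simp
  qed
  also have "\<dots> \<le> ?S"
  proof (rule SUP_least)
    fix n
    let ?D = "density M (indicator (L n))"
    have D: "emeasure ?D B = emeasure M (L n \<inter> B)" if "B \<in> sets M" for B
      using that by (simp add: emeasure_density indicator_inter_arith[symmetric])
    interpret D: finite_measure ?D
    proof (rule finite_measureI)
      have "emeasure ?D (space ?D) \<le> emeasure M (L n)"
        by (subst D) (auto intro: emeasure_mono)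
      then show "emeasure ?D (space ?D) \<noteq> \<infinity>"
        using emeasure_compact_finite[OF sets loc L(1)[of n]] le_less_trans
        by (metis infinity_ennreal_def less_irrefl)
    qed
    show "emeasure M (A \<inter> L n) \<le> ?S"
    proof (rule ennreal_le_epsilon)
      fix e :: real assume "0 < e"
      have "\<exists>K. compactin X K \<and> K \<subseteq> A \<inter> L n \<and> measure ?D (A \<inter> L n - K) < e"
      proof (rule D.inner_regular_compact[OF X])
        show "sets ?D = sets (borel_of X)" by (simp add: sets)
        show "A \<inter> L n \<in> sets ?D" using A by simp
      qed fact
      then obtain K where K: "compactin X K" "K \<subseteq> A \<inter> L n" "measure ?D (A \<inter> L n - K) < e" by blast
      have Ks [measurable]: "K \<in> sets M" using K(1) by (rule compact_sets)
      have "emeasure M (A \<inter> L n - K) = emeasure ?D (A \<inter> L n - K)"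
        using A by (subst D) (auto intro: arg_cong2[where f=emeasure])
      also have "\<dots> \<le> ennreal e" using K(3) by (simp add: D.emeasure_eq_measure ennreal_leI less_imp_le)
      finally have 1: "emeasure M (A \<inter> L n - K) \<le> ennreal e" .
      have "emeasure M (A \<inter> L n) = emeasure M (K \<union> (A \<inter> L n - K))"
        using K(2) by (intro arg_cong2[where f=emeasure]) auto
      also have "\<dots> \<le> emeasure M K + emeasure M (A \<inter> L n - K)"
        using A by (intro emeasure_subadditive) auto
      also have "\<dots> \<le> ?S + ennreal e"
        using K 1 by (intro add_mono SUP_upper) auto
      finally show "emeasure M (A \<inter> L n) \<le> ?S + ennreal e" .
    qed
  qed
  finally have "emeasure M A \<le> ?S" .
  moreover have "?S \<le> emeasure M A"
    using A by (intro SUP_least emeasure_mono) auto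
  ultimately show "emeasure M A = ?S" by (rule antisym)
qed

lemma radon_measure_sigma_finite:
  assumes "Hausdorff_space X" "countable_compact_network X" "radon_measure X M"
  shows "sigma_finite_measure M"
proof -
  have sets: "sets M = sets (borel_of X)"
    and loc: "\<And>x. x \<in> topspace X \<Longrightarrow> \<exists>U. openin X U \<and> x \<in> U \<and> emeasure M U < \<infinity>"
    using assms(3) unfolding radon_measure_def by auto
  obtain L where L: "\<And>n::nat. compactin X (L n)" "(\<Union>n. L n) = topspace X"
    using compact_exhaustion[OF assms(2)] by metis
  show ?thesis
  proof
    have "emeasure M (L n) \<noteq> \<infinity>" for n
      using emeasure_compact_finite[OF sets loc L(1)] by (simp add: less_top)
    moreover have "range L \<subseteq> sets M"
      using compactin_sets_borel_of[OF assms(1) L(1)] by (auto simp: sets)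
    ultimately show "\<exists>A. countable A \<and> A \<subseteq> sets M \<and> \<Union>A = space M \<and> (\<forall>a\<in>A. emeasure M a \<noteq> \<infinity>)"
      using L(2) sets_eq_imp_space_eq[OF sets] by (intro exI[of _ "range L"]) auto
  qed
qed

text \<open>
  Being Radon comes for free. Local finiteness at a point with a coordinate in \<open>Y\<close> or \<open>Y'\<close> follows from the
  marginals, which are locally finite, and the pair of extra points is an isolated point of mass zero.
\<close>
lemma adm_couplingsI:
  assumes Y: "polish_topology Y" "locally_compact_space Y" "radon_measure Y \<nu>"
    and Y': "polish_topology Y'" "locally_compact_space Y'" "radon_measure Y' \<nu>'"
    and sets: "sets \<pi> = sets (borel_of (add_point Y) \<Otimes>\<^sub>M borel_of (add_point Y'))"
    and m1: "\<And>A. A \<in> sets (borel_of Y) \<Longrightarrow> emeasure \<pi> (Some ` A \<times> topspace (add_point Y')) = emeasure \<nu> A"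
    and m2: "\<And>B. B \<in> sets (borel_of Y') \<Longrightarrow> emeasure \<pi> (topspace (add_point Y) \<times> Some ` B) = emeasure \<nu>' B"
    and 0: "emeasure \<pi> {(None, None)} = 0"
  shows "\<pi> \<in> adm_couplings Y \<nu> Y' \<nu>'"
proof -
  let ?X = "prod_topology (add_point Y) (add_point Y')"
  note top = polish_imp_second_countable[OF Y(1)] polish_imp_second_countable[OF Y'(1)]
    polish_imp_Hausdorff[OF Y(1)] polish_imp_Hausdorff[OF Y'(1)]
  have "radon_measure ?X \<pi>"
  proof (rule radon_measureI)
    show "Hausdorff_space ?X"
      by (simp add: Hausdorff_space_prod_topology Hausdorff_space_add_point top)
    show "countable_compact_network ?X"
      by (intro countable_compact_network_prod countable_compact_network_add_point
            countable_compact_network_locally_compact top Y Y')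
    show "sets \<pi> = sets (borel_of ?X)"
      by (simp add: sets sets_borel_of_prod_topology second_countable_add_point top)
    fix z assume "z \<in> topspace ?X"
    then consider "z = (None, None)"
      | y where "fst z = Some y" "y \<in> topspace Y" "snd z \<in> topspace (add_point Y')"
      | y where "snd z = Some y" "y \<in> topspace Y'" "fst z \<in> topspace (add_point Y)"
      by (cases z) auto
    then show "\<exists>U. openin ?X U \<and> z \<in> U \<and> emeasure \<pi> U < \<infinity>"
    proof cases
      case 1
      then show ?thesis
        using 0 openin_prod_Times_iff[of "add_point Y" "add_point Y'" "{None}" "{None}"]
        by (intro exI[of _ "{None} \<times> {None}"]) (simp add: openin_None)
    next
      case (2 y)
      then obtain U where "openin Y U" "y \<in> U" "emeasure \<nu> U < \<infinity>"
        using Y(3) unfolding radon_measure_def by blast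
      with 2 show ?thesis
        by (intro exI[of _ "Some ` U \<times> topspace (add_point Y')"])
           (auto simp: openin_prod_Times_iff openin_Some_image m1 openin_sets_borel_of mem_Times_iff simp del: topspace_add_point)
    next
      case (3 y)
      then obtain U where "openin Y' U" "y \<in> U" "emeasure \<nu>' U < \<infinity>"
        using Y'(3) unfolding radon_measure_def by blast
      with 3 show ?thesis
        by (intro exI[of _ "topspace (add_point Y) \<times> Some ` U"])
           (auto simp: openin_prod_Times_iff openin_Some_image m2 openin_sets_borel_of mem_Times_iff simp del: topspace_add_point)
    qed
  qed
  then show ?thesis
    unfolding adm_couplings_def using m1 m2 0 by blast
qed

section \<open>Sums of measures\<close>

text \<open>
  For sigma-algebras that differ the sum takes the measurable sets of the first measure. It is used only
  when they coincide.
\<close>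
definition add_measure :: "'a measure \<Rightarrow> 'a measure \<Rightarrow> 'a measure" where
  "add_measure M N = measure_of (space M) (sets M) (\<lambda>A. emeasure M A + emeasure N A)"

lemma sets_add_measure [simp, measurable_cong]: "sets (add_measure M N) = sets M"
  by (simp add: add_measure_def)

lemma space_add_measure [simp]: "space (add_measure M N) = space M"
  by (rule sets_eq_imp_space_eq) simp

lemma emeasure_add_measure:
  assumes "sets N = sets M" "A \<in> sets M"
  shows "emeasure (add_measure M N) A = emeasure M A + emeasure N A"
proof (rule emeasure_measure_of[OF add_measure_def])
  show "countably_additive (sets (add_measure M N)) (\<lambda>A. emeasure M A + emeasure N A)"
    unfolding countably_additive_def
  proof (intro allI impI)
    fix A :: "nat \<Rightarrow> _" assume *: "range A \<subseteq> sets (add_measure M N)" "disjoint_family A"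
    then have "(\<Sum>i. emeasure M (A i) + emeasure N (A i)) = (\<Sum>i. emeasure M (A i)) + (\<Sum>i. emeasure N (A i))"
      by (intro suminf_add[symmetric]) auto
    also have "\<dots> = emeasure M (\<Union>i. A i) + emeasure N (\<Union>i. A i)"
      using * assms(1) by (simp add: suminf_emeasure)
    finally show "(\<Sum>i. emeasure M (A i) + emeasure N (A i)) = emeasure M (\<Union>i. A i) + emeasure N (\<Union>i. A i)" .
  qed
qed (use assms sets.space_closed in \<open>auto simp: positive_def\<close>)

lemma nn_integral_add_measure:
  assumes sets: "sets N = sets M" and f: "f \<in> borel_measurable M"
  shows "(\<integral>\<^sup>+x. f x \<partial>add_measure M N) = (\<integral>\<^sup>+x. f x \<partial>M) + (\<integral>\<^sup>+x. f x \<partial>N)"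
  using f
proof (induction rule: borel_measurable_induct)
  case (cong f g)
  have "space N = space M" by (rule sets_eq_imp_space_eq[OF sets])
  then have "integral\<^sup>N (add_measure M N) f = integral\<^sup>N (add_measure M N) g"
    "integral\<^sup>N M f = integral\<^sup>N M g" "integral\<^sup>N N f = integral\<^sup>N N g"
    using cong(3) by (auto intro!: nn_integral_cong)
  with cong(4) show ?case by simp
next
  case (set A)
  then show ?case by (simp add: emeasure_add_measure sets)
next
  case (mult u c)
  have "u \<in> borel_measurable N" "u \<in> borel_measurable (add_measure M N)"
    using mult(2) measurable_cong_sets[OF sets refl] measurable_cong_sets[OF sets_add_measure refl] by blast+
  with mult show ?case by (simp add: nn_integral_cmult distrib_left)
next
  case (add u v)
  have "u \<in> borel_measurable N" "u \<in> borel_measurable (add_measure M N)"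
    "v \<in> borel_measurable N" "v \<in> borel_measurable (add_measure M N)"
    using add(1,3) measurable_cong_sets[OF sets refl] measurable_cong_sets[OF sets_add_measure refl] by blast+
  with add show ?case by (simp add: nn_integral_add ac_simps)
next
  case (seq U)
  have U: "U i \<in> borel_measurable N" "U i \<in> borel_measurable (add_measure M N)" for i
    using seq(1) measurable_cong_sets[OF sets refl] measurable_cong_sets[OF sets_add_measure refl] by blast+
  have inc: "incseq (\<lambda>i. integral\<^sup>N K (U i))" for K
    using seq(3) by (auto simp: incseq_def le_fun_def intro!: nn_integral_mono)
  have f: "(SUP i. U i) = (\<lambda>x. SUP i. U i x)" by (auto simp: fun_eq_iff image_comp)
  have conv: "integral\<^sup>N K (SUP i. U i) = (SUP i. integral\<^sup>N K (U i))" if "\<And>i. U i \<in> borel_measurable K" for K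
    unfolding f by (rule nn_integral_monotone_convergence_SUP[OF seq(3) that])
  show ?case
    unfolding conv[OF seq(1)] conv[OF U(1)] conv[OF U(2)] using seq.IH by (simp add: ennreal_SUP_add[OF inc inc])
qed

section \<open>Composition of couplings\<close>

text \<open>
  The composed coupling \<open>\<pi>\<close> is characterised by what is needed of it: a pointwise bound of a cost on
  \<open>X1 \<times> X3\<close> by costs on the given pairs turns into the same bound for integrals. The coefficients and the costs stay
  arbitrary, as the lemma is applied both to cost functions and to costs already integrated once.
\<close>
lemma couplings_compose:
  assumes X1: "polish_topology X1" and X2: "polish_topology X2" and X3: "polish_topology X3"
    and \<mu>2: "borel_prob_measure X2 \<mu>2" and ne: "topspace X1 \<noteq> {}" "topspace X3 \<noteq> {}"
    and \<alpha>: "\<alpha> \<in> couplings X1 \<mu>1 X2 \<mu>2" and \<beta>: "\<beta> \<in> couplings X2 \<mu>2 X3 \<mu>3"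
  obtains \<pi> where "\<pi> \<in> couplings X1 \<mu>1 X3 \<mu>3"
    and "\<And>c12 c23 c13 A B. c12 \<in> borel_measurable (borel_of X1 \<Otimes>\<^sub>M borel_of X2) \<Longrightarrow>
      c23 \<in> borel_measurable (borel_of X2 \<Otimes>\<^sub>M borel_of X3) \<Longrightarrow>
      c13 \<in> borel_measurable (borel_of X1 \<Otimes>\<^sub>M borel_of X3) \<Longrightarrow>
      (\<And>x y z. x \<in> topspace X1 \<Longrightarrow> y \<in> topspace X2 \<Longrightarrow> z \<in> topspace X3 \<Longrightarrow>
         c13 (x, z) \<le> A * c12 (x, y) + B * c23 (y, z)) \<Longrightarrow>
      (\<integral>\<^sup>+w. c13 w \<partial>\<pi>) \<le> A * (\<integral>\<^sup>+w. c12 w \<partial>\<alpha>) + B * (\<integral>\<^sup>+w. c23 w \<partial>\<beta>)"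
proof -
  note sc = X1[THEN polish_imp_second_countable] X2[THEN polish_imp_second_countable] X3[THEN polish_imp_second_countable]
  let ?B1 = "borel_of X1" and ?B2 = "borel_of X2" and ?B3 = "borel_of X3"
  have sets_\<mu>2: "sets \<mu>2 = sets ?B2" and "prob_space \<mu>2"
    using \<mu>2 by (auto simp: borel_prob_measure_def)
  interpret \<mu>2: prob_space \<mu>2 by fact
  have space_\<mu>2: "space \<mu>2 = topspace X2" using sets_eq_imp_space_eq[OF sets_\<mu>2] by simp
  have \<alpha>_sets: "sets \<alpha> = sets (?B1 \<Otimes>\<^sub>M ?B2)" and \<beta>_sets: "sets \<beta> = sets (?B2 \<Otimes>\<^sub>M ?B3)"
    and "prob_space \<alpha>"
    using \<alpha> \<beta> by (auto simp: couplings_def borel_prob_measure_def sets_borel_of_prod_topology sc)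
  interpret \<alpha>: prob_space \<alpha> by fact
  obtain \<gamma> where \<gamma>_sets [measurable_cong]: "sets \<gamma> = sets (?B1 \<Otimes>\<^sub>M (?B2 \<Otimes>\<^sub>M ?B3))"
    and int12: "\<And>c. c \<in> borel_measurable (?B1 \<Otimes>\<^sub>M ?B2) \<Longrightarrow> (\<integral>\<^sup>+w. c w \<partial>\<alpha>) = (\<integral>\<^sup>+(x, y, z). c (x, y) \<partial>\<gamma>)"
    and int23: "\<And>c. c \<in> borel_measurable (?B2 \<Otimes>\<^sub>M ?B3) \<Longrightarrow> (\<integral>\<^sup>+w. c w \<partial>\<beta>) = (\<integral>\<^sup>+(x, y, z). c (y, z) \<partial>\<gamma>)"
  proof (rule gluing_integrals[OF _ sets_\<mu>2 real_coded_polish[OF X3 ne(2)] _ _ \<alpha>_sets \<beta>_sets])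
    show "sigma_finite_measure \<mu>2" by unfold_locales
    show "space ?B1 \<noteq> {}" "space ?B2 \<noteq> {}" using ne \<mu>2.not_empty by (simp_all add: space_\<mu>2)
    show "emeasure \<alpha> (space ?B1 \<times> B) = emeasure \<mu>2 B" "emeasure \<beta> (B \<times> space ?B3) = emeasure \<mu>2 B"
      if "B \<in> sets ?B2" for B
      using \<alpha> \<beta> that by (simp_all add: couplings_def)
  qed blast
  have space_\<gamma>: "space \<gamma> = topspace X1 \<times> topspace X2 \<times> topspace X3"
    using sets_eq_imp_space_eq[OF \<gamma>_sets] by (simp add: space_pair_measure)
  have p13: "(\<lambda>(x, y, z). (x, z)) \<in> \<gamma> \<rightarrow>\<^sub>M ?B1 \<Otimes>\<^sub>M ?B3" by measurable
  define \<pi> where "\<pi> = distr \<gamma> (?B1 \<Otimes>\<^sub>M ?B3) (\<lambda>(x, y, z). (x, z))"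
  have int13: "(\<integral>\<^sup>+w. c w \<partial>\<pi>) = (\<integral>\<^sup>+(x, y, z). c (x, z) \<partial>\<gamma>)" if "c \<in> borel_measurable (?B1 \<Otimes>\<^sub>M ?B3)" for c
    unfolding \<pi>_def by (subst nn_integral_distr) (use that p13 in \<open>auto simp: split_beta'\<close>)
  have m1: "emeasure \<pi> (A \<times> topspace X3) = emeasure \<mu>1 A" if A [measurable]: "A \<in> sets ?B1" for A
  proof -
    have [measurable]: "topspace X3 \<in> sets ?B3" "topspace X2 \<in> sets ?B2"
      using sets.top[of ?B3] sets.top[of ?B2] by auto
    have "emeasure \<pi> (A \<times> topspace X3) = (\<integral>\<^sup>+w. indicator (A \<times> topspace X3) w \<partial>\<pi>)"
      by (subst nn_integral_indicator) (auto simp: \<pi>_def)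
    also have "\<dots> = (\<integral>\<^sup>+(x, y, z). indicator (A \<times> topspace X3) (x, z) \<partial>\<gamma>)"
      by (rule int13) auto
    also have "\<dots> = (\<integral>\<^sup>+(x, y, z). indicator (A \<times> topspace X2) (x, y) \<partial>\<gamma>)"
      by (intro nn_integral_cong) (auto simp: space_\<gamma> split: split_indicator)
    also have "\<dots> = (\<integral>\<^sup>+w. indicator (A \<times> topspace X2) w \<partial>\<alpha>)"
      by (rule int12[symmetric]) auto
    also have "\<dots> = emeasure \<alpha> (A \<times> topspace X2)"
      by (subst nn_integral_indicator) (auto simp: \<alpha>_sets)
    finally show ?thesis using \<alpha> A by (simp add: couplings_def)
  qed
  have m3: "emeasure \<pi> (topspace X1 \<times> C) = emeasure \<mu>3 C" if C [measurable]: "C \<in> sets ?B3" for C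
  proof -
    have [measurable]: "topspace X1 \<in> sets ?B1" "topspace X2 \<in> sets ?B2"
      using sets.top[of ?B1] sets.top[of ?B2] by auto
    have "emeasure \<pi> (topspace X1 \<times> C) = (\<integral>\<^sup>+w. indicator (topspace X1 \<times> C) w \<partial>\<pi>)"
      by (subst nn_integral_indicator) (auto simp: \<pi>_def)
    also have "\<dots> = (\<integral>\<^sup>+(x, y, z). indicator (topspace X1 \<times> C) (x, z) \<partial>\<gamma>)"
      by (rule int13) auto
    also have "\<dots> = (\<integral>\<^sup>+(x, y, z). indicator (topspace X2 \<times> C) (y, z) \<partial>\<gamma>)"
      by (intro nn_integral_cong) (auto simp: space_\<gamma> split: split_indicator)
    also have "\<dots> = (\<integral>\<^sup>+w. indicator (topspace X2 \<times> C) w \<partial>\<beta>)"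
      by (rule int23[symmetric]) auto
    also have "\<dots> = emeasure \<beta> (topspace X2 \<times> C)"
      by (subst nn_integral_indicator) (auto simp: \<beta>_sets)
    finally show ?thesis using \<beta> C by (simp add: couplings_def)
  qed
  have "emeasure \<pi> (space \<pi>) = 1"
    using int12[of "\<lambda>_. 1"] int13[of "\<lambda>_. 1"] \<alpha>.emeasure_space_1 by simp
  then have "prob_space \<pi>" by (rule prob_spaceI)
  then have "\<pi> \<in> couplings X1 \<mu>1 X3 \<mu>3"
    using m1 m3 by (simp add: couplings_def borel_prob_measure_def sets_borel_of_prod_topology sc \<pi>_def)
  moreover have "(\<integral>\<^sup>+w. c13 w \<partial>\<pi>) \<le> A * (\<integral>\<^sup>+w. c12 w \<partial>\<alpha>) + B * (\<integral>\<^sup>+w. c23 w \<partial>\<beta>)"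
    if c [measurable]: "c12 \<in> borel_measurable (?B1 \<Otimes>\<^sub>M ?B2)" "c23 \<in> borel_measurable (?B2 \<Otimes>\<^sub>M ?B3)"
      "c13 \<in> borel_measurable (?B1 \<Otimes>\<^sub>M ?B3)"
      and le: "\<And>x y z. x \<in> topspace X1 \<Longrightarrow> y \<in> topspace X2 \<Longrightarrow> z \<in> topspace X3 \<Longrightarrow>
         c13 (x, z) \<le> A * c12 (x, y) + B * c23 (y, z)" for c12 c23 c13 A B
  proof -
    have "(\<integral>\<^sup>+w. c13 w \<partial>\<pi>) = (\<integral>\<^sup>+(x, y, z). c13 (x, z) \<partial>\<gamma>)"
      by (rule int13) fact
    also have "\<dots> \<le> (\<integral>\<^sup>+w. A * (case w of (x, y, z) \<Rightarrow> c12 (x, y)) + B * (case w of (x, y, z) \<Rightarrow> c23 (y, z)) \<partial>\<gamma>)"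
      by (intro nn_integral_mono) (auto simp: space_\<gamma> intro: le)
    also have "\<dots> = A * (\<integral>\<^sup>+(x, y, z). c12 (x, y) \<partial>\<gamma>) + B * (\<integral>\<^sup>+(x, y, z). c23 (y, z) \<partial>\<gamma>)"
      by (subst nn_integral_add; (subst nn_integral_cmult)?) (auto simp: nn_integral_cmult)
    finally show ?thesis by (simp add: int12[OF c(1)] int23[OF c(2)])
  qed
  ultimately show ?thesis by (rule that)
qed

lemma adm_couplings_sets:
  assumes "polish_topology Y" "polish_topology Y'" "\<pi> \<in> adm_couplings Y \<nu> Y' \<nu>'"
  shows "sets \<pi> = sets (borel_of (add_point Y) \<Otimes>\<^sub>M borel_of (add_point Y'))"
  using assms by (simp add: adm_couplings_def radon_measure_def sets_borel_of_prod_topology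
      second_countable_add_point polish_imp_second_countable)

lemma adm_couplings_sigma_finite:
  assumes "polish_topology Y" "polish_topology Y'" "locally_compact_space Y" "locally_compact_space Y'"
    and "\<pi> \<in> adm_couplings Y \<nu> Y' \<nu>'"
  shows "sigma_finite_measure \<pi>"
proof (rule radon_measure_sigma_finite)
  show "radon_measure (prod_topology (add_point Y) (add_point Y')) \<pi>"
    using assms(5) by (simp add: adm_couplings_def)
  show "Hausdorff_space (prod_topology (add_point Y) (add_point Y'))"
    using assms by (simp add: Hausdorff_space_prod_topology Hausdorff_space_add_point polish_imp_Hausdorff)
  show "countable_compact_network (prod_topology (add_point Y) (add_point Y'))"
    using assms by (intro countable_compact_network_prod countable_compact_network_add_point
        countable_compact_network_locally_compact polish_imp_second_countable polish_imp_Hausdorff)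
qed

lemma sigma_finite_distr_Some:
  assumes "sigma_finite_measure \<nu>" "sets \<nu> = sets (borel_of Y)"
  shows "sigma_finite_measure (distr \<nu> (borel_of (add_point Y)) Some)"
proof -
  obtain A where A: "countable A" "A \<subseteq> sets \<nu>" "\<Union>A = space \<nu>" "\<And>a. a \<in> A \<Longrightarrow> emeasure \<nu> a \<noteq> \<infinity>"
    using sigma_finite_measure.sigma_finite_countable[OF assms(1)] by metis
  have space: "space \<nu> = topspace Y" using sets_eq_imp_space_eq[OF assms(2)] by simp
  have S: "Some \<in> \<nu> \<rightarrow>\<^sub>M borel_of (add_point Y)"
    using measurable_Some by (simp only: measurable_cong_sets[OF assms(2) refl])
  have in_sets: "Some ` a \<in> sets (borel_of (add_point Y))" if "a \<in> A" for a
    using A(2) that assms(2) by (intro Some_image_in_sets) auto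
  have "emeasure (distr \<nu> (borel_of (add_point Y)) Some) (Some ` a) \<noteq> \<infinity>" if "a \<in> A" for a
  proof -
    have "Some -` Some ` a \<inter> space \<nu> = a" using A(3) that by auto
    then show ?thesis using A(4)[OF that] by (simp add: emeasure_distr[OF S in_sets[OF that]])
  qed
  moreover have "emeasure (distr \<nu> (borel_of (add_point Y)) Some) {None} \<noteq> \<infinity>"
  proof -
    have "Some -` {None} \<inter> space \<nu> = {}" by auto
    then show ?thesis by (simp add: emeasure_distr[OF S None_in_sets])
  qed
  ultimately show ?thesis
    by unfold_locales
       (intro exI[of _ "insert {None} ((`) Some ` A)"],
        use A in_sets None_in_sets in \<open>auto simp: space image_Union[symmetric]\<close>)
qed

text \<open>
  The composition for couplings that may use the extra points. The condition \<open>y \<noteq> None \<or> x = None \<or> z = None\<close> spares the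
  pointwise bound the triples that join two honest points through the extra point, since the measure \<open>G\<close> on triples
  constructed below does not charge them. The costs of the pair of extra points have to vanish because
  the marginals of \<open>G\<close> agree with \<open>\<alpha>\<close> and \<open>\<beta>\<close> only away from that pair.
\<close>
lemma adm_couplings_compose:
  assumes Y1: "polish_topology Y1" "locally_compact_space Y1" "radon_measure Y1 \<nu>1"
    and Y2: "polish_topology Y2" "locally_compact_space Y2" "radon_measure Y2 \<nu>2"
    and Y3: "polish_topology Y3" "locally_compact_space Y3" "radon_measure Y3 \<nu>3"
    and \<alpha>: "\<alpha> \<in> adm_couplings Y1 \<nu>1 Y2 \<nu>2" and \<beta>: "\<beta> \<in> adm_couplings Y2 \<nu>2 Y3 \<nu>3"
  obtains \<pi> where "\<pi> \<in> adm_couplings Y1 \<nu>1 Y3 \<nu>3"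
    and "\<And>c12 c23 c13 A B.
      c12 \<in> borel_measurable (borel_of (add_point Y1) \<Otimes>\<^sub>M borel_of (add_point Y2)) \<Longrightarrow>
      c23 \<in> borel_measurable (borel_of (add_point Y2) \<Otimes>\<^sub>M borel_of (add_point Y3)) \<Longrightarrow>
      c13 \<in> borel_measurable (borel_of (add_point Y1) \<Otimes>\<^sub>M borel_of (add_point Y3)) \<Longrightarrow>
      c12 (None, None) = 0 \<Longrightarrow> c23 (None, None) = 0 \<Longrightarrow>
      (\<And>x y z. x \<in> topspace (add_point Y1) \<Longrightarrow> y \<in> topspace (add_point Y2) \<Longrightarrow> z \<in> topspace (add_point Y3) \<Longrightarrow>
         y \<noteq> None \<or> x = None \<or> z = None \<Longrightarrow> c13 (x, z) \<le> A * c12 (x, y) + B * c23 (y, z)) \<Longrightarrow>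
      (\<integral>\<^sup>+w. c13 w \<partial>\<pi>) \<le> A * (\<integral>\<^sup>+w. c12 w \<partial>\<alpha>) + B * (\<integral>\<^sup>+w. c23 w \<partial>\<beta>)"
proof -
  let ?N1 = "borel_of (add_point Y1)" and ?N2 = "borel_of (add_point Y2)" and ?N3 = "borel_of (add_point Y3)"
  let ?S1 = "topspace (add_point Y1)" and ?S2 = "topspace (add_point Y2)" and ?S3 = "topspace (add_point Y3)"
  let ?T = "?N1 \<Otimes>\<^sub>M (?N2 \<Otimes>\<^sub>M ?N3)"
  have [measurable, simp]: "?S1 \<in> sets ?N1" "?S2 \<in> sets ?N2" "?S3 \<in> sets ?N3"
    using sets.top[of ?N1] sets.top[of ?N2] sets.top[of ?N3] by auto
  note [measurable] = None_in_sets
  have None_space [simp]: "None \<in> space ?N1" "None \<in> space ?N2" "None \<in> space ?N3" by simp_all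
  have someY2 [measurable]: "Some ` topspace Y2 \<in> sets ?N2"
    by (intro openin_sets_borel_of openin_Some_image) simp
  have sets_\<nu>2: "sets \<nu>2 = sets (borel_of Y2)" using Y2(3) by (simp add: radon_measure_def)
  have space_\<nu>2: "space \<nu>2 = topspace Y2" using sets_eq_imp_space_eq[OF sets_\<nu>2] by simp
  have sf2: "sigma_finite_measure \<nu>2"
    by (rule radon_measure_sigma_finite[OF _ _ Y2(3)])
       (use Y2 in \<open>auto intro!: countable_compact_network_locally_compact polish_imp_Hausdorff polish_imp_second_countable\<close>)
  have \<alpha>_sets [measurable_cong]: "sets \<alpha> = sets (?N1 \<Otimes>\<^sub>M ?N2)" by (rule adm_couplings_sets[OF Y1(1) Y2(1) \<alpha>])
  have \<beta>_sets [measurable_cong]: "sets \<beta> = sets (?N2 \<Otimes>\<^sub>M ?N3)" by (rule adm_couplings_sets[OF Y2(1) Y3(1) \<beta>])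
  have space_\<alpha>: "space \<alpha> = ?S1 \<times> ?S2" using sets_eq_imp_space_eq[OF \<alpha>_sets] by (simp add: space_pair_measure)
  have space_\<beta>: "space \<beta> = ?S2 \<times> ?S3" using sets_eq_imp_space_eq[OF \<beta>_sets] by (simp add: space_pair_measure)
  have \<alpha>_marg: "emeasure \<alpha> (?S1 \<times> Some ` B) = emeasure \<nu>2 B" if "B \<in> sets (borel_of Y2)" for B
    using \<alpha> that by (simp add: adm_couplings_def)
  have \<beta>_marg: "emeasure \<beta> (Some ` B \<times> ?S3) = emeasure \<nu>2 B" if "B \<in> sets (borel_of Y2)" for B
    using \<beta> that by (simp add: adm_couplings_def)

  define \<nu> where "\<nu> = distr \<nu>2 ?N2 Some"
  have \<nu>_sets: "sets \<nu> = sets ?N2" by (simp add: \<nu>_def)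
  have S: "Some \<in> \<nu>2 \<rightarrow>\<^sub>M ?N2"
    using measurable_Some by (simp only: measurable_cong_sets[OF sets_\<nu>2 refl])
  have \<nu>: "emeasure \<nu> B = emeasure \<nu>2 (Some -` B \<inter> topspace Y2)" if "B \<in> sets ?N2" for B
    using that by (simp add: \<nu>_def emeasure_distr[OF S] space_\<nu>2)
  have vimage_sets: "Some -` B \<inter> topspace Y2 \<in> sets (borel_of Y2)" if "B \<in> sets ?N2" for B
    using measurable_sets[OF measurable_Some that] by simp
  define \<alpha>1 where "\<alpha>1 = density \<alpha> (indicator (?S1 \<times> Some ` topspace Y2))"
  define \<beta>1 where "\<beta>1 = density \<beta> (indicator (Some ` topspace Y2 \<times> ?S3))"
  obtain \<gamma> where \<gamma>_sets [measurable_cong]: "sets \<gamma> = sets ?T"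
    and int_\<alpha>1: "\<And>c. c \<in> borel_measurable (?N1 \<Otimes>\<^sub>M ?N2) \<Longrightarrow> (\<integral>\<^sup>+w. c w \<partial>\<alpha>1) = (\<integral>\<^sup>+(x, y, z). c (x, y) \<partial>\<gamma>)"
    and int_\<beta>1: "\<And>c. c \<in> borel_measurable (?N2 \<Otimes>\<^sub>M ?N3) \<Longrightarrow> (\<integral>\<^sup>+w. c w \<partial>\<beta>1) = (\<integral>\<^sup>+(x, y, z). c (y, z) \<partial>\<gamma>)"
  proof (rule gluing_integrals[OF _ \<nu>_sets real_coded_add_point[OF Y3(1)], of ?N1 \<alpha>1 \<beta>1])
    show "sigma_finite_measure \<nu>" unfolding \<nu>_def by (rule sigma_finite_distr_Some[OF sf2 sets_\<nu>2])
    show "space ?N1 \<noteq> {}" "space ?N2 \<noteq> {}" by simp_all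
    show "sets \<alpha>1 = sets (?N1 \<Otimes>\<^sub>M ?N2)" "sets \<beta>1 = sets (?N2 \<Otimes>\<^sub>M ?N3)"
      by (simp_all add: \<alpha>_sets \<beta>_sets \<alpha>1_def \<beta>1_def)
    fix B assume B [measurable]: "B \<in> sets ?N2"
    have eq: "Some ` topspace Y2 \<inter> B = Some ` (Some -` B \<inter> topspace Y2)" by auto
    have "emeasure \<alpha>1 (space ?N1 \<times> B) = emeasure \<alpha> ((?S1 \<times> Some ` topspace Y2) \<inter> (?S1 \<times> B))"
      unfolding \<alpha>1_def by (subst emeasure_density) (auto simp: indicator_inter_arith[symmetric] simp del: topspace_add_point)
    also have "\<dots> = emeasure \<nu> B"
      unfolding Sigma_Int_distrib1[symmetric] Times_Int_Times Int_absorb eq \<alpha>_marg[OF vimage_sets[OF B]] \<nu>[OF B] by simp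
    finally show "emeasure \<alpha>1 (space ?N1 \<times> B) = emeasure \<nu> B" .
    have "emeasure \<beta>1 (B \<times> space ?N3) = emeasure \<beta> ((Some ` topspace Y2 \<times> ?S3) \<inter> (B \<times> ?S3))"
      unfolding \<beta>1_def by (subst emeasure_density) (auto simp: indicator_inter_arith[symmetric] simp del: topspace_add_point)
    also have "\<dots> = emeasure \<nu> B"
      unfolding Times_Int_Times Int_absorb eq \<beta>_marg[OF vimage_sets[OF B]] \<nu>[OF B] by simp
    finally show "emeasure \<beta>1 (B \<times> space ?N3) = emeasure \<nu> B" .
  qed blast
  have \<gamma>12: "(\<integral>\<^sup>+(x, y, z). c (x, y) \<partial>\<gamma>) = (\<integral>\<^sup>+w. indicator (?S1 \<times> Some ` topspace Y2) w * c w \<partial>\<alpha>)"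
    if [measurable]: "c \<in> borel_measurable (?N1 \<Otimes>\<^sub>M ?N2)" for c
    unfolding int_\<alpha>1[OF that, symmetric] \<alpha>1_def by (rule nn_integral_density) measurable
  have \<gamma>23: "(\<integral>\<^sup>+(x, y, z). c (y, z) \<partial>\<gamma>) = (\<integral>\<^sup>+w. indicator (Some ` topspace Y2 \<times> ?S3) w * c w \<partial>\<beta>)"
    if [measurable]: "c \<in> borel_measurable (?N2 \<Otimes>\<^sub>M ?N3)" for c
    unfolding int_\<beta>1[OF that, symmetric] \<beta>1_def by (rule nn_integral_density) measurable

  \<comment> \<open>Mass over the middle extra point is not glued: it is continued by, respectively preceded by, an extra point.\<close>
  define \<alpha>0 where "\<alpha>0 = distr (density \<alpha> (indicator (?S1 \<times> {None}))) ?T (\<lambda>(x, y). (x, None, None))"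
  define \<beta>0 where "\<beta>0 = distr (density \<beta> (indicator ({None} \<times> ?S3))) ?T (\<lambda>(y, z). (None, None, z))"
  define G where "G = add_measure \<gamma> (add_measure \<alpha>0 \<beta>0)"
  have G_sets [measurable_cong]: "sets G = sets ?T" by (simp add: G_def \<gamma>_sets)
  have space_G: "space G = ?S1 \<times> ?S2 \<times> ?S3"
    using sets_eq_imp_space_eq[OF G_sets] by (simp add: space_pair_measure)
  have int_\<alpha>0: "(\<integral>\<^sup>+w. H w \<partial>\<alpha>0) = (\<integral>\<^sup>+w. indicator (?S1 \<times> {None}) w * H (fst w, None, None) \<partial>\<alpha>)"
    if [measurable]: "H \<in> borel_measurable ?T" for H
  proof -
    have "(\<integral>\<^sup>+w. H w \<partial>\<alpha>0) = (\<integral>\<^sup>+w. H (fst w, None, None) \<partial>density \<alpha> (indicator (?S1 \<times> {None})))"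
      unfolding \<alpha>0_def by (subst nn_integral_distr, measurable) (simp add: split_beta')
    also have "\<dots> = (\<integral>\<^sup>+w. indicator (?S1 \<times> {None}) w * H (fst w, None, None) \<partial>\<alpha>)"
      by (rule nn_integral_density) measurable
    finally show ?thesis .
  qed
  have int_\<beta>0: "(\<integral>\<^sup>+w. H w \<partial>\<beta>0) = (\<integral>\<^sup>+w. indicator ({None} \<times> ?S3) w * H (None, None, snd w) \<partial>\<beta>)"
    if [measurable]: "H \<in> borel_measurable ?T" for H
  proof -
    have "(\<integral>\<^sup>+w. H w \<partial>\<beta>0) = (\<integral>\<^sup>+w. H (None, None, snd w) \<partial>density \<beta> (indicator ({None} \<times> ?S3)))"
      unfolding \<beta>0_def by (subst nn_integral_distr, measurable) (simp add: split_beta')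
    also have "\<dots> = (\<integral>\<^sup>+w. indicator ({None} \<times> ?S3) w * H (None, None, snd w) \<partial>\<beta>)"
      by (rule nn_integral_density) measurable
    finally show ?thesis .
  qed
  have int_G: "(\<integral>\<^sup>+w. H w \<partial>G) = (\<integral>\<^sup>+w. H w \<partial>\<gamma>) + ((\<integral>\<^sup>+w. H w \<partial>\<alpha>0) + (\<integral>\<^sup>+w. H w \<partial>\<beta>0))"
    if "H \<in> borel_measurable ?T" for H
  proof -
    have "sets (add_measure \<alpha>0 \<beta>0) = sets \<gamma>" by (simp add: \<gamma>_sets \<alpha>0_def)
    moreover have "sets \<beta>0 = sets \<alpha>0" by (simp add: \<alpha>0_def \<beta>0_def)
    moreover have "H \<in> borel_measurable \<gamma>" using that by (simp only: measurable_cong_sets[OF \<gamma>_sets refl])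
    moreover have "H \<in> borel_measurable \<alpha>0" using that by (simp add: \<alpha>0_def)
    ultimately show ?thesis by (simp add: G_def nn_integral_add_measure)
  qed
  have int12: "(\<integral>\<^sup>+(x, y, z). c (x, y) \<partial>G) = (\<integral>\<^sup>+w. c w \<partial>\<alpha>)"
    if [measurable]: "c \<in> borel_measurable (?N1 \<Otimes>\<^sub>M ?N2)" and 0: "c (None, None) = 0" for c
  proof -
    have zero: "(\<integral>\<^sup>+(x, y, z). c (x, y) \<partial>\<beta>0) = 0"
      by (subst int_\<beta>0; (measurable)?; (simp add: 0)?)
    have nonzero: "(\<integral>\<^sup>+(x, y, z). c (x, y) \<partial>\<alpha>0) = (\<integral>\<^sup>+w. indicator (?S1 \<times> {None}) w * c (fst w, None) \<partial>\<alpha>)"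
      by (subst int_\<alpha>0; (measurable)?; simp?)
    have "(\<integral>\<^sup>+(x, y, z). c (x, y) \<partial>G) = (\<integral>\<^sup>+w. indicator (?S1 \<times> Some ` topspace Y2) w * c w \<partial>\<alpha>)
        + (\<integral>\<^sup>+w. indicator (?S1 \<times> {None}) w * c (fst w, None) \<partial>\<alpha>)"
      by (subst int_G, measurable) (simp only: \<gamma>12[OF that(1)] zero nonzero add_0 add_0_right)
    also have "\<dots> = (\<integral>\<^sup>+w. indicator (?S1 \<times> Some ` topspace Y2) w * c w + indicator (?S1 \<times> {None}) w * c (fst w, None) \<partial>\<alpha>)"
      by (rule nn_integral_add[symmetric]) measurable
    also have "\<dots> = (\<integral>\<^sup>+w. c w \<partial>\<alpha>)"
      by (intro nn_integral_cong) (auto simp: space_\<alpha>)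
    finally show ?thesis .
  qed
  have int23: "(\<integral>\<^sup>+(x, y, z). c (y, z) \<partial>G) = (\<integral>\<^sup>+w. c w \<partial>\<beta>)"
    if [measurable]: "c \<in> borel_measurable (?N2 \<Otimes>\<^sub>M ?N3)" and 0: "c (None, None) = 0" for c
  proof -
    have zero: "(\<integral>\<^sup>+(x, y, z). c (y, z) \<partial>\<alpha>0) = 0"
      by (subst int_\<alpha>0; (measurable)?; (simp add: 0)?)
    have nonzero: "(\<integral>\<^sup>+(x, y, z). c (y, z) \<partial>\<beta>0) = (\<integral>\<^sup>+w. indicator ({None} \<times> ?S3) w * c (None, snd w) \<partial>\<beta>)"
      by (subst int_\<beta>0; (measurable)?; simp?)
    have "(\<integral>\<^sup>+(x, y, z). c (y, z) \<partial>G) = (\<integral>\<^sup>+w. indicator (Some ` topspace Y2 \<times> ?S3) w * c w \<partial>\<beta>)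
        + (\<integral>\<^sup>+w. indicator ({None} \<times> ?S3) w * c (None, snd w) \<partial>\<beta>)"
      by (subst int_G, measurable) (simp only: \<gamma>23[OF that(1)] zero nonzero add_0 add_0_right)
    also have "\<dots> = (\<integral>\<^sup>+w. indicator (Some ` topspace Y2 \<times> ?S3) w * c w + indicator ({None} \<times> ?S3) w * c (None, snd w) \<partial>\<beta>)"
      by (rule nn_integral_add[symmetric]) measurable
    also have "\<dots> = (\<integral>\<^sup>+w. c w \<partial>\<beta>)"
      by (intro nn_integral_cong) (auto simp: space_\<beta>)
    finally show ?thesis .
  qed
  \<comment> \<open>The glued part avoids the middle extra point, and the other two parts have an extra point at one end.\<close>
  have good: "AE w in G. fst (snd w) \<noteq> None \<or> fst w = None \<or> snd (snd w) = None"
  proof -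
    let ?bad = "(?S1 - {None}) \<times> ({None} \<times> (?S3 - {None}))"
    have bad [measurable]: "?bad \<in> sets ?T" by measurable
    have "emeasure G ?bad = (\<integral>\<^sup>+w. indicator ?bad w \<partial>G)"
      by (rule nn_integral_indicator[symmetric]) (simp only: G_sets bad)
    also have "\<dots> = (\<integral>\<^sup>+w. indicator ?bad w \<partial>\<gamma>)"
    proof -
      have "(\<integral>\<^sup>+w. indicator ?bad w \<partial>\<alpha>0) = 0"
        by (subst int_\<alpha>0[OF borel_measurable_indicator[OF bad]]) simp
      moreover have "(\<integral>\<^sup>+w. indicator ?bad w \<partial>\<beta>0) = 0"
        by (subst int_\<beta>0[OF borel_measurable_indicator[OF bad]]) simp
      ultimately show ?thesis
        by (simp only: int_G[OF borel_measurable_indicator[OF bad]] add_0_right)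
    qed
    also have "\<dots> \<le> (\<integral>\<^sup>+(x, y, z). indicator (?S1 \<times> {None}) (x, y) \<partial>\<gamma>)"
      by (intro nn_integral_mono) (auto split: split_indicator)
    also have "\<dots> = (\<integral>\<^sup>+w. 0 \<partial>\<alpha>)"
    proof -
      have "?S1 \<times> {None} \<in> sets (?N1 \<Otimes>\<^sub>M ?N2)" by measurable
      then show ?thesis
        unfolding \<gamma>12[OF borel_measurable_indicator[OF \<open>_ \<in> sets (?N1 \<Otimes>\<^sub>M ?N2)\<close>]]
        by (intro nn_integral_cong) (auto split: split_indicator)
    qed
    finally have "emeasure G ?bad = 0" by simp
    then have "?bad \<in> null_sets G"
      using bad unfolding null_sets_def G_sets by blast
    then show ?thesis
      by (rule AE_I') (auto simp: space_G)
  qed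
  \<comment> \<open>The projection of \<open>G\<close> may charge the pair of extra points, even infinitely.\<close>
  let ?off = "?S1 \<times> ?S3 - {None} \<times> {None}"
  define \<pi> where "\<pi> = density (distr G (?N1 \<Otimes>\<^sub>M ?N3) (\<lambda>(x, y, z). (x, z))) (indicator ?off)"
  have int13: "(\<integral>\<^sup>+w. c w \<partial>\<pi>) = (\<integral>\<^sup>+(x, y, z). indicator ?off (x, z) * c (x, z) \<partial>G)"
    if [measurable]: "c \<in> borel_measurable (?N1 \<Otimes>\<^sub>M ?N3)" for c
  proof -
    have "(\<integral>\<^sup>+w. c w \<partial>\<pi>) = (\<integral>\<^sup>+w. indicator ?off w * c w \<partial>distr G (?N1 \<Otimes>\<^sub>M ?N3) (\<lambda>(x, y, z). (x, z)))"
      unfolding \<pi>_def by (rule nn_integral_density) measurable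
    also have "\<dots> = (\<integral>\<^sup>+(x, y, z). indicator ?off (x, z) * c (x, z) \<partial>G)"
      by (subst nn_integral_distr, measurable) (simp add: split_beta')
    finally show ?thesis .
  qed
  have \<pi>_sets: "sets \<pi> = sets (?N1 \<Otimes>\<^sub>M ?N3)" by (simp add: \<pi>_def)
  have "\<pi> \<in> adm_couplings Y1 \<nu>1 Y3 \<nu>3"
  proof (rule adm_couplingsI[OF Y1 Y3 \<pi>_sets])
    fix A assume A: "A \<in> sets (borel_of Y1)"
    note [measurable] = Some_image_in_sets[OF A]
    have "emeasure \<pi> (Some ` A \<times> ?S3) = (\<integral>\<^sup>+w. indicator (Some ` A \<times> ?S3) w \<partial>\<pi>)"
      by (subst nn_integral_indicator) (auto simp: \<pi>_sets simp del: topspace_add_point)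
    also have "\<dots> = (\<integral>\<^sup>+(x, y, z). indicator (Some ` A \<times> ?S2) (x, y) \<partial>G)"
      by (subst int13, measurable)
         (use sets.sets_into_space[OF A] in \<open>auto intro!: nn_integral_cong simp: space_G split: split_indicator\<close>)
    also have "\<dots> = (\<integral>\<^sup>+w. indicator (Some ` A \<times> ?S2) w \<partial>\<alpha>)"
      by (rule int12[OF borel_measurable_indicator[OF pair_measureI]]) (use A in \<open>auto intro: Some_image_in_sets simp del: topspace_add_point\<close>)
    also have "\<dots> = emeasure \<alpha> (Some ` A \<times> ?S2)"
      by (subst nn_integral_indicator) (auto simp: \<alpha>_sets simp del: topspace_add_point)
    finally show "emeasure \<pi> (Some ` A \<times> ?S3) = emeasure \<nu>1 A" using \<alpha> A by (simp add: adm_couplings_def)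
  next
    fix C assume C: "C \<in> sets (borel_of Y3)"
    note [measurable] = Some_image_in_sets[OF C]
    have "emeasure \<pi> (?S1 \<times> Some ` C) = (\<integral>\<^sup>+w. indicator (?S1 \<times> Some ` C) w \<partial>\<pi>)"
      by (subst nn_integral_indicator) (auto simp: \<pi>_sets simp del: topspace_add_point)
    also have "\<dots> = (\<integral>\<^sup>+(x, y, z). indicator (?S2 \<times> Some ` C) (y, z) \<partial>G)"
      by (subst int13, measurable)
         (use sets.sets_into_space[OF C] in \<open>auto intro!: nn_integral_cong simp: space_G split: split_indicator\<close>)
    also have "\<dots> = (\<integral>\<^sup>+w. indicator (?S2 \<times> Some ` C) w \<partial>\<beta>)"
      by (rule int23[OF borel_measurable_indicator[OF pair_measureI]]) (use C in \<open>auto intro: Some_image_in_sets simp del: topspace_add_point\<close>)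
    also have "\<dots> = emeasure \<beta> (?S2 \<times> Some ` C)"
      by (subst nn_integral_indicator) (auto simp: \<beta>_sets simp del: topspace_add_point)
    finally show "emeasure \<pi> (?S1 \<times> Some ` C) = emeasure \<nu>3 C" using \<beta> C by (simp add: adm_couplings_def)
  next
    have diag: "{None} \<times> {None} \<in> sets (?N1 \<Otimes>\<^sub>M ?N3)" by measurable
    have "emeasure \<pi> ({None} \<times> {None}) = (\<integral>\<^sup>+w. indicator ({None} \<times> {None}) w \<partial>\<pi>)"
      by (rule nn_integral_indicator[symmetric]) (simp only: \<pi>_sets diag)
    also have "\<dots> = (\<integral>\<^sup>+w. 0 \<partial>G)"
      unfolding int13[OF borel_measurable_indicator[OF diag]]
      by (intro nn_integral_cong) (auto split: split_indicator)
    finally show "emeasure \<pi> {(None, None)} = 0" by simp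
  qed
  moreover have "(\<integral>\<^sup>+w. c13 w \<partial>\<pi>) \<le> A * (\<integral>\<^sup>+w. c12 w \<partial>\<alpha>) + B * (\<integral>\<^sup>+w. c23 w \<partial>\<beta>)"
    if c [measurable]: "c12 \<in> borel_measurable (?N1 \<Otimes>\<^sub>M ?N2)" "c23 \<in> borel_measurable (?N2 \<Otimes>\<^sub>M ?N3)"
      "c13 \<in> borel_measurable (?N1 \<Otimes>\<^sub>M ?N3)"
      and 0: "c12 (None, None) = 0" "c23 (None, None) = 0"
      and le: "\<And>x y z. x \<in> ?S1 \<Longrightarrow> y \<in> ?S2 \<Longrightarrow> z \<in> ?S3 \<Longrightarrow> y \<noteq> None \<or> x = None \<or> z = None \<Longrightarrow>
         c13 (x, z) \<le> A * c12 (x, y) + B * c23 (y, z)" for c12 c23 c13 A B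
  proof -
    have "(\<integral>\<^sup>+w. c13 w \<partial>\<pi>) = (\<integral>\<^sup>+(x, y, z). indicator ?off (x, z) * c13 (x, z) \<partial>G)"
      by (rule int13) fact
    also have "\<dots> \<le> (\<integral>\<^sup>+w. A * (case w of (x, y, z) \<Rightarrow> c12 (x, y)) + B * (case w of (x, y, z) \<Rightarrow> c23 (y, z)) \<partial>G)"
    proof (rule nn_integral_mono_AE)
      show "AE w in G. (case w of (x, y, z) \<Rightarrow> indicator ?off (x, z) * c13 (x, z))
          \<le> A * (case w of (x, y, z) \<Rightarrow> c12 (x, y)) + B * (case w of (x, y, z) \<Rightarrow> c23 (y, z))"
        using good
      proof (rule AE_mp, intro AE_I2 impI)
        fix w assume w: "w \<in> space G" "fst (snd w) \<noteq> None \<or> fst w = None \<or> snd (snd w) = None"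
        obtain x y z where xyz: "w = (x, y, z)" by (cases w) auto
        have "indicator ?off (x, z) * c13 (x, z) \<le> c13 (x, z)" by (simp split: split_indicator)
        also have "\<dots> \<le> A * c12 (x, y) + B * c23 (y, z)"
          using w unfolding xyz space_G by (intro le) auto
        finally show "(case w of (x, y, z) \<Rightarrow> indicator ?off (x, z) * c13 (x, z))
          \<le> A * (case w of (x, y, z) \<Rightarrow> c12 (x, y)) + B * (case w of (x, y, z) \<Rightarrow> c23 (y, z))"
          by (simp add: xyz)
      qed
    qed
    also have "\<dots> = A * (\<integral>\<^sup>+(x, y, z). c12 (x, y) \<partial>G) + B * (\<integral>\<^sup>+(x, y, z). c23 (y, z) \<partial>G)"
      by (subst nn_integral_add; (subst nn_integral_cmult)?) (auto simp: nn_integral_cmult)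
    finally show ?thesis by (simp only: int12[OF c(1) 0(1)] int23[OF c(2) 0(2)])
  qed
  ultimately show ?thesis by (rule that)
qed

section \<open>Minkowski's inequality through weights\<close>

text \<open>
  Writing \<open>g + h\<close> as the average of \<open>g (a + b) / a\<close> and \<open>h (a + b) / b\<close> with weights \<open>a / (a + b)\<close> and \<open>b / (a + b)\<close> and using
  convexity of the power, these are the factors in front of \<open>g powr p\<close> and of \<open>h powr p\<close>.
\<close>
definition split_weight :: "real \<Rightarrow> real \<Rightarrow> real \<Rightarrow> real" where
  "split_weight p a b = ((a + b) / a) powr (p - 1)"

lemma split_weight_ge_1: "1 \<le> p \<Longrightarrow> 0 < a \<Longrightarrow> 0 < b \<Longrightarrow> 1 \<le> split_weight p a b"
  unfolding split_weight_def by (rule ge_one_powr_ge_zero) auto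

lemma powr_add_le_split:
  fixes g h :: real
  assumes p: "1 \<le> p" and ab: "0 < a" "0 < b" and nn: "0 \<le> f" "0 \<le> g" "0 \<le> h" and le: "f \<le> g + h"
  shows "f powr p \<le> split_weight p a b * g powr p + split_weight p b a * h powr p"
proof -
  have "f powr p \<le> (g + h) powr p"
    using p nn le by (intro powr_mono2) auto
  also have "\<dots> \<le> split_weight p a b * g powr p + split_weight p b a * h powr p"
  proof (cases "g = 0 \<or> h = 0")
    case True
    have "g powr p \<le> split_weight p a b * g powr p" "h powr p \<le> split_weight p b a * h powr p"
      using split_weight_ge_1[OF p ab] split_weight_ge_1[OF p ab(2,1)] by (simp_all add: mult_le_cancel_right1)
    then show ?thesis using True p by (auto simp: add.commute)
  next
    case False
    define t s where "t = a / (a + b)" and "s = b / (a + b)"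
    have ts: "0 < t" "0 < s" "s + t = 1"
      using ab by (auto simp: t_def s_def add_divide_distrib[symmetric] add.commute)
    have "((1 - s) *\<^sub>R (g / t) + s *\<^sub>R (h / s)) powr p \<le> (1 - s) * (g / t) powr p + s * (h / s) powr p"
      by (rule convex_onD[OF powr_convex[OF p]]) (use ts False nn in auto)
    moreover have "1 - s = t" using ts by simp
    ultimately have "(g + h) powr p \<le> t * (g / t) powr p + s * (h / s) powr p"
      using ts by simp
    moreover have "x * (z / x) powr p = (1 / x) powr (p - 1) * z powr p" if "0 < x" "0 \<le> z" for x z
    proof -
      have "x powr p = x powr (p - 1) * x" using that by (simp add: powr_diff)
      then show ?thesis using that by (simp add: powr_divide)
    qed
    moreover have "(a + b) / a = 1 / t" "(b + a) / b = 1 / s" by (simp_all add: t_def s_def add.commute)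
    ultimately show ?thesis using ts nn by (simp add: split_weight_def)
  qed
  finally show ?thesis .
qed

text \<open>
  If \<open>a\<close> and \<open>b\<close> were the \<open>p\<close>-th roots of \<open>c1\<close> and \<open>c2\<close>, the bound would read \<open>C \<le> (a + b) powr p\<close>. Since these roots may be
  zero, they are first enlarged by a small amount.
\<close>
lemma root_add_le:
  fixes C c1 c2 :: real
  assumes p: "1 \<le> p" and nn: "0 \<le> C" "0 \<le> c1" "0 \<le> c2"
    and le: "\<And>a b. 0 < a \<Longrightarrow> 0 < b \<Longrightarrow> C \<le> split_weight p a b * c1 + split_weight p b a * c2"
  shows "C powr (1 / p) \<le> c1 powr (1 / p) + c2 powr (1 / p)"
proof (rule field_le_epsilon)
  fix e :: real assume e: "0 < e"
  define a b where "a = c1 powr (1 / p) + e / 2" and "b = c2 powr (1 / p) + e / 2"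
  have ab: "0 < a" "0 < b" using e by (auto simp: a_def b_def intro: add_nonneg_pos)
  have bound: "c \<le> (c powr (1 / p) + e / 2) powr p" if "0 \<le> c" for c
  proof -
    have "c = (c powr (1 / p)) powr p" using p that by (simp add: powr_powr)
    also have "\<dots> \<le> (c powr (1 / p) + e / 2) powr p" using p e by (intro powr_mono2) auto
    finally show ?thesis .
  qed
  have w: "split_weight p x y * x powr p = (x + y) powr (p - 1) * x" if "0 < x" "0 < y" for x y
  proof -
    have "x powr p = x powr (p - 1) * x" using that by (simp add: powr_diff)
    then show ?thesis using that by (simp add: split_weight_def powr_divide)
  qed
  have "C \<le> split_weight p a b * c1 + split_weight p b a * c2" by (rule le[OF ab])
  also have "\<dots> \<le> split_weight p a b * a powr p + split_weight p b a * b powr p"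
    using bound nn by (intro add_mono mult_left_mono) (auto simp: a_def b_def split_weight_def)
  also have "\<dots> = (a + b) powr (p - 1) * (a + b)"
    using w[OF ab] w[OF ab(2,1)] by (simp add: distrib_left add.commute)
  also have "\<dots> = (a + b) powr p" using ab by (simp add: powr_diff)
  finally have "C powr (1 / p) \<le> ((a + b) powr p) powr (1 / p)"
    using p nn by (intro powr_mono2) auto
  also have "\<dots> = a + b" using ab p by (simp add: powr_powr)
  finally show "C powr (1 / p) \<le> c1 powr (1 / p) + c2 powr (1 / p) + e"
    by (simp add: a_def b_def)
qed

lemma ennreal_root_add_le:
  assumes p: "1 \<le> p"
    and le: "\<And>a b. 0 < a \<Longrightarrow> 0 < b \<Longrightarrow>
      C \<le> ennreal (split_weight p a b) * c1 + ennreal (split_weight p b a) * c2"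
  shows "ennreal_root p C \<le> ennreal_root p c1 + ennreal_root p c2"
proof (cases "c1 = \<infinity> \<or> c2 = \<infinity>")
  case True
  then show ?thesis by (auto simp: ennreal_root_def)
next
  case False
  then obtain r1 r2 where r: "c1 = ennreal r1" "0 \<le> r1" "c2 = ennreal r2" "0 \<le> r2"
    by (cases c1; cases c2) auto
  have nn: "0 \<le> split_weight p a b" for a b by (simp add: split_weight_def)
  have le': "C \<le> ennreal (split_weight p a b * r1 + split_weight p b a * r2)" if "0 < a" "0 < b" for a b
    using le[OF that] r nn by (simp add: ennreal_mult ennreal_plus)
  have "C \<noteq> \<infinity>" using le'[of 1 1] by (auto simp: top_unique)
  then obtain c where c: "C = ennreal c" "0 \<le> c" by (cases C) auto
  have "c powr (1 / p) \<le> r1 powr (1 / p) + r2 powr (1 / p)"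
  proof (rule root_add_le[OF p c(2) r(2,4)])
    fix a b :: real assume "0 < a" "0 < b"
    from le'[OF this] have "ennreal c \<le> ennreal (split_weight p a b * r1 + split_weight p b a * r2)"
      by (simp only: c(1))
    then show "c \<le> split_weight p a b * r1 + split_weight p b a * r2"
      using nn r by (subst (asm) ennreal_le_iff) auto
  qed
  then show ?thesis
    using r c by (simp add: ennreal_root_def ennreal_plus[symmetric] del: ennreal_plus)
qed

lemma ennreal_powr_add_le_split:
  assumes "1 \<le> p" "0 < a" "0 < b" "0 \<le> f" "0 \<le> g" "0 \<le> h" "f \<le> g + h"
  shows "ennreal (f powr p) \<le> ennreal (split_weight p a b) * ennreal (g powr p)
    + ennreal (split_weight p b a) * ennreal (h powr p)"
  using powr_add_le_split[OF assms]
  by (simp add: ennreal_mult[symmetric] ennreal_plus[symmetric] split_weight_def del: ennreal_plus)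

section \<open>The distance to the diagonal\<close>

lemma lp_norm_nonneg: "0 \<le> lp_norm p v"
  by (simp add: lp_norm_def)

lemma lp_norm_0: "lp_norm p 0 = 0"
  by (simp add: lp_norm_def)

lemma lp_norm_minus_commute: "lp_norm p (v - w) = lp_norm p (w - v)"
  by (simp add: lp_norm_def abs_minus_commute)

lemma lp_norm_triangle:
  assumes p: "1 \<le> p"
  shows "lp_norm p (v + w) \<le> lp_norm p v + lp_norm p w"
  unfolding lp_norm_def
proof (rule root_add_le[OF p])
  fix a b :: real assume ab: "0 < a" "0 < b"
  have "\<bar>fst (v + w)\<bar> powr p \<le> split_weight p a b * \<bar>fst v\<bar> powr p + split_weight p b a * \<bar>fst w\<bar> powr p"
    "\<bar>snd (v + w)\<bar> powr p \<le> split_weight p a b * \<bar>snd v\<bar> powr p + split_weight p b a * \<bar>snd w\<bar> powr p"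
    by (auto intro!: powr_add_le_split p ab abs_triangle_ineq)
  then show "\<bar>fst (v + w)\<bar> powr p + \<bar>snd (v + w)\<bar> powr p
     \<le> split_weight p a b * (\<bar>fst v\<bar> powr p + \<bar>snd v\<bar> powr p) + split_weight p b a * (\<bar>fst w\<bar> powr p + \<bar>snd w\<bar> powr p)"
    by (simp add: distrib_left)
qed auto

text \<open>
  The projection \<open>diag_proj v\<close> is a nearest point of the diagonal line for every \<open>p \<ge> 1\<close>. Both coordinates of
  \<open>v - diag_proj v\<close> have the same size \<open>h\<close>, and \<open>2 h\<close> is at most the sum of the distances of the coordinates of \<open>v\<close> from
  any \<open>t\<close>, so convexity of the power applies.
\<close>
lemma lp_norm_diag_proj_le:
  assumes p: "1 \<le> p"
  shows "lp_norm p (v - diag_proj v) \<le> lp_norm p (v - (t, t))"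
proof -
  obtain a b where v: "v = (a, b)" by (cases v)
  define h where "h = \<bar>a - b\<bar> / 2"
  have h: "\<bar>a - (a + b) / 2\<bar> = h" "\<bar>b - (a + b) / 2\<bar> = h" by (simp_all add: h_def field_simps abs_if)
  have "2 * h \<le> \<bar>a - t\<bar> + \<bar>b - t\<bar>" by (simp add: h_def)
  then have "(2 * h) powr p \<le> split_weight p 1 1 * \<bar>a - t\<bar> powr p + split_weight p 1 1 * \<bar>b - t\<bar> powr p"
    by (intro powr_add_le_split p) (auto simp: h_def)
  moreover have "(2 * h) powr p = 2 powr (p - 1) * (2 * h powr p)"
    using powr_mult[of 2 h p] by (simp add: powr_diff h_def)
  ultimately have "2 powr (p - 1) * (2 * h powr p) \<le> 2 powr (p - 1) * (\<bar>a - t\<bar> powr p + \<bar>b - t\<bar> powr p)"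
    by (simp add: split_weight_def distrib_left)
  then have "2 * h powr p \<le> \<bar>a - t\<bar> powr p + \<bar>b - t\<bar> powr p"
    by (subst (asm) mult_le_cancel_left_pos) auto
  then show ?thesis
    unfolding lp_norm_def v diag_proj_def using p by (intro powr_mono2) (auto simp: h)
qed

lemma lp_diff_nonneg: "0 \<le> lp_diff p u w"
  by (cases u; cases w) (simp_all add: lp_norm_nonneg)

lemma lp_diff_same: "lp_diff p u u = 0"
  by (cases u) (simp_all add: lp_norm_0)

lemma lp_diff_commute: "lp_diff p u w = lp_diff p w u"
  by (cases u; cases w) (simp_all add: lp_norm_minus_commute)

text \<open>
  The excluded case joins two points through the diagonal, which may be shorter than their distance. In the other cases the claim is
  Minkowski's inequality, or that the distance to the diagonal is 1-Lipschitz.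
\<close>
lemma lp_diff_triangle:
  assumes p: "1 \<le> p" and "v \<noteq> None \<or> u = None \<or> w = None"
  shows "lp_diff p u w \<le> lp_diff p u v + lp_diff p v w"
proof -
  have diag: "lp_norm p (x - diag_proj x) \<le> lp_norm p (x - y) + lp_norm p (y - diag_proj y)" for x y
  proof -
    have "lp_norm p (x - diag_proj x) \<le> lp_norm p (x - diag_proj y)"
      using lp_norm_diag_proj_le[OF p] unfolding diag_proj_def[of y] by blast
    also have "\<dots> \<le> lp_norm p (x - y) + lp_norm p (y - diag_proj y)"
      using lp_norm_triangle[OF p, of "x - y" "y - diag_proj y"] by simp
    finally show ?thesis .
  qed
  have diag'': "lp_norm p (x - diag_proj x) \<le> lp_norm p (y - diag_proj y) + lp_norm p (y - x)" for x y
    using diag[of x y] by (simp add: lp_norm_minus_commute[of p y x])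
  have three: "lp_norm p (x - z) \<le> lp_norm p (x - y) + lp_norm p (y - z)" for x y z
    using lp_norm_triangle[OF p, of "x - y" "y - z"] by simp
  show ?thesis
    using assms(2) diag three
    by (cases u; cases v; cases w) (simp_all add: lp_norm_nonneg diag'')
qed

section \<open>The three cost functions of a pair of networks\<close>

text \<open>
  These facts are in the form needed below: measurability refers to product sigma-algebras, and the node space is
  nonempty because it carries a probability measure.
\<close>
lemma measure_topological_networksD:
  assumes "P \<in> measure_topological_networks"
  shows "polish_topology (node_space P)" "borel_prob_measure (node_space P) (node_measure P)"
    "case_prod (node_kernel P) \<in> borel_measurable (borel_of (node_space P) \<Otimes>\<^sub>M borel_of (node_space P))"
    "polish_topology (cycle_space P)" "locally_compact_space (cycle_space P)"
    "radon_measure (cycle_space P) (cycle_measure P)"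
    "cycle_map P \<in> borel_measurable (borel_of (cycle_space P))"
    "case_prod (incidence P) \<in> borel_measurable (borel_of (node_space P) \<Otimes>\<^sub>M borel_of (cycle_space P))"
    "topspace (node_space P) \<noteq> {}"
proof -
  note P = assms[unfolded measure_topological_networks_def Let_def, simplified]
  show X: "polish_topology (node_space P)" and \<mu>: "borel_prob_measure (node_space P) (node_measure P)"
    and Y: "polish_topology (cycle_space P)" and "locally_compact_space (cycle_space P)"
    and "radon_measure (cycle_space P) (cycle_measure P)"
    using P by blast+
  have "case_prod (node_kernel P) \<in> borel_measurable (borel_of (prod_topology (node_space P) (node_space P)))"
    "case_prod (incidence P) \<in> borel_measurable (borel_of (prod_topology (node_space P) (cycle_space P)))"
    using P by blast+
  then show "case_prod (node_kernel P) \<in> borel_measurable (borel_of (node_space P) \<Otimes>\<^sub>M borel_of (node_space P))"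
    "case_prod (incidence P) \<in> borel_measurable (borel_of (node_space P) \<Otimes>\<^sub>M borel_of (cycle_space P))"
    using X Y by (simp_all add: measurable_cong_sets[OF sets_borel_of_prod_topology refl] polish_imp_second_countable)
  have "continuous_map (cycle_space P) (top_of_set Lambda) (cycle_map P)" using P by blast
  then have "continuous_map (cycle_space P) euclidean (cycle_map P)"
    by (rule continuous_map_into_fulltopology)
  then have "cycle_map P \<in> borel_of (cycle_space P) \<rightarrow>\<^sub>M borel_of euclidean"
    by (rule continuous_map_measurable)
  also have "borel_of euclidean = (borel :: (real \<times> real) measure)"
    by (simp add: borel_of_def borel_def)
  finally show "cycle_map P \<in> borel_measurable (borel_of (cycle_space P))" .
  have "space (node_measure P) = topspace (node_space P)" "prob_space (node_measure P)"
    using \<mu> by (auto simp: borel_prob_measure_def dest: sets_eq_imp_space_eq)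
  then show "topspace (node_space P) \<noteq> {}"
    using prob_space.not_empty by metis
qed

abbreviation node_algebra :: "('x, 'y) network \<Rightarrow> 'x measure" where
  "node_algebra P \<equiv> borel_of (node_space P)"

abbreviation cycle_algebra :: "('x, 'y) network \<Rightarrow> 'y option measure" where
  "cycle_algebra P \<equiv> borel_of (add_point (cycle_space P))"

definition cycle_cost ::
  "real \<Rightarrow> ('x, 'y) network \<Rightarrow> ('x2, 'y2) network \<Rightarrow> 'y option \<times> 'y2 option \<Rightarrow> ennreal" where
  "cycle_cost p P P' = (\<lambda>v. ennreal (lp_diff p (map_option (cycle_map P) (fst v))
     (map_option (cycle_map P') (snd v)) powr p))"

definition node_cost ::
  "real \<Rightarrow> ('x, 'y) network \<Rightarrow> ('x2, 'y2) network \<Rightarrow> ('x \<times> 'x2) \<times> ('x \<times> 'x2) \<Rightarrow> ennreal" where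
  "node_cost p P P' = (\<lambda>z. ennreal (\<bar>node_kernel P (fst (fst z)) (fst (snd z))
     - node_kernel P' (snd (fst z)) (snd (snd z))\<bar> powr p))"

definition incidence_cost ::
  "real \<Rightarrow> ('x, 'y) network \<Rightarrow> ('x2, 'y2) network \<Rightarrow> ('x \<times> 'x2) \<times> ('y option \<times> 'y2 option) \<Rightarrow> ennreal" where
  "incidence_cost p P P' = (\<lambda>z. ennreal (\<bar>extend_incidence (incidence P) (fst (fst z)) (fst (snd z))
     - extend_incidence (incidence P') (snd (fst z)) (snd (snd z))\<bar> powr p))"

lemma measurable_lp_norm [measurable]: "lp_norm p \<in> borel_measurable borel"
proof -
  have [measurable]: "(fst :: real \<times> real \<Rightarrow> real) \<in> borel_measurable borel"
    "(snd :: real \<times> real \<Rightarrow> real) \<in> borel_measurable borel"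
    by (simp_all add: borel_measurable_continuous_onI continuous_on_fst continuous_on_snd)
  show ?thesis unfolding lp_norm_def by measurable
qed

lemma measurable_diag_proj [measurable]: "diag_proj \<in> borel_measurable borel"
  unfolding diag_proj_def by (intro borel_measurable_continuous_onI continuous_intros) auto

lemma measurable_cycle_cost:
  assumes "P \<in> measure_topological_networks" "P' \<in> measure_topological_networks"
  shows "cycle_cost p P P' \<in> borel_measurable (cycle_algebra P \<Otimes>\<^sub>M cycle_algebra P')"
proof -
  note [measurable] = measure_topological_networksD(7)[OF assms(1)] measure_topological_networksD(7)[OF assms(2)]
  show ?thesis
  proof (rule measurable_pair_add_pointI)
    have "(\<lambda>(y', y). cycle_cost p P P' (y, Some y'))
        \<in> borel_measurable (borel_of (cycle_space P') \<Otimes>\<^sub>M cycle_algebra P)"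
      by (rule measurable_pair_add_pointI) (simp_all add: cycle_cost_def split_beta')
    from measurable_pair_swap[OF this]
    show "(\<lambda>(y, y'). cycle_cost p P P' (y, Some y'))
        \<in> borel_measurable (cycle_algebra P \<Otimes>\<^sub>M borel_of (cycle_space P'))"
      by simp
    show "(\<lambda>y. cycle_cost p P P' (y, None)) \<in> borel_measurable (cycle_algebra P)"
      by (rule measurable_add_pointI) (simp_all add: cycle_cost_def)
  qed
qed

lemma measurable_node_cost:
  assumes "P \<in> measure_topological_networks" "P' \<in> measure_topological_networks"
  shows "node_cost p P P' \<in> borel_measurable
    ((node_algebra P \<Otimes>\<^sub>M node_algebra P') \<Otimes>\<^sub>M (node_algebra P \<Otimes>\<^sub>M node_algebra P'))"
proof -
  note [measurable] = measure_topological_networksD(3)[OF assms(1)] measure_topological_networksD(3)[OF assms(2)]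
  show ?thesis unfolding node_cost_def by measurable
qed

lemma measurable_extend_incidence:
  assumes "P \<in> measure_topological_networks"
  shows "case_prod (extend_incidence (incidence P)) \<in> borel_measurable (node_algebra P \<Otimes>\<^sub>M cycle_algebra P)"
  by (rule measurable_pair_add_pointI) (use measure_topological_networksD(8)[OF assms] in simp_all)

lemma measurable_incidence_cost:
  assumes "P \<in> measure_topological_networks" "P' \<in> measure_topological_networks"
  shows "incidence_cost p P P' \<in> borel_measurable
    ((node_algebra P \<Otimes>\<^sub>M node_algebra P') \<Otimes>\<^sub>M (cycle_algebra P \<Otimes>\<^sub>M cycle_algebra P'))"
proof -
  note [measurable] = measurable_extend_incidence[OF assms(1)] measurable_extend_incidence[OF assms(2)]
  show ?thesis unfolding incidence_cost_def by measurable
qed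

abbreviation node_couplings where
  "node_couplings P P' \<equiv> couplings (node_space P) (node_measure P) (node_space P') (node_measure P')"

abbreviation cycle_couplings where
  "cycle_couplings P P' \<equiv> adm_couplings (cycle_space P) (cycle_measure P) (cycle_space P') (cycle_measure P')"

lemma node_couplingsD:
  assumes "P \<in> measure_topological_networks" "P' \<in> measure_topological_networks" "\<pi> \<in> node_couplings P P'"
  shows "sets \<pi> = sets (node_algebra P \<Otimes>\<^sub>M node_algebra P')" "prob_space \<pi>"
  using assms by (auto simp: couplings_def borel_prob_measure_def sets_borel_of_prod_topology
      polish_imp_second_countable measure_topological_networksD)

lemma cycle_couplingsD:
  assumes "P \<in> measure_topological_networks" "P' \<in> measure_topological_networks" "\<pi> \<in> cycle_couplings P P'"
  shows "sets \<pi> = sets (cycle_algebra P \<Otimes>\<^sub>M cycle_algebra P')" "sigma_finite_measure \<pi>"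
  by (rule adm_couplings_sets[OF _ _ assms(3)], (intro measure_topological_networksD assms)+)
     (rule adm_couplings_sigma_finite[OF _ _ _ _ assms(3)], (intro measure_topological_networksD assms)+)

text \<open>
  In iterated form the two composition lemmas can be applied to one integral at a time. The admissible coupling
  is integrated first, which only requires it to be sigma-finite.
\<close>
lemma tpot_cost_iterated:
  assumes P: "P \<in> measure_topological_networks" "P' \<in> measure_topological_networks"
    and \<pi>v: "\<pi>v \<in> node_couplings P P'" and \<pi>e: "\<pi>e \<in> cycle_couplings P P'"
  shows "tpot_cost p P P' \<pi>v \<pi>e = (\<integral>\<^sup>+v. cycle_cost p P P' v \<partial>\<pi>e)
    + (\<integral>\<^sup>+w. \<integral>\<^sup>+w'. node_cost p P P' (w, w') \<partial>\<pi>v \<partial>\<pi>v)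
    + (\<integral>\<^sup>+w. \<integral>\<^sup>+v. incidence_cost p P P' (w, v) \<partial>\<pi>e \<partial>\<pi>v)"
proof -
  note v = node_couplingsD[OF P \<pi>v] and e = cycle_couplingsD[OF P \<pi>e]
  interpret v: prob_space \<pi>v by (rule v)
  interpret e: sigma_finite_measure \<pi>e by (rule e)
  have "node_cost p P P' \<in> borel_measurable (\<pi>v \<Otimes>\<^sub>M \<pi>v)"
    using measurable_node_cost[OF P]
    by (simp only: measurable_cong_sets[OF sets_pair_measure_cong[OF v(1) v(1)] refl])
  moreover have "incidence_cost p P P' \<in> borel_measurable (\<pi>v \<Otimes>\<^sub>M \<pi>e)"
    using measurable_incidence_cost[OF P]
    by (simp only: measurable_cong_sets[OF sets_pair_measure_cong[OF v(1) e(1)] refl])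
  ultimately show ?thesis
    unfolding tpot_cost_def
    by (simp only: v.nn_integral_fst e.nn_integral_fst)
       (simp add: cycle_cost_def node_cost_def incidence_cost_def split_beta')
qed

section \<open>The pseudometric axioms\<close>

lemma d_TpOT_eq:
  "d_TpOT p P P' = (INF (\<pi>v, \<pi>e) \<in> node_couplings P P' \<times> cycle_couplings P P'.
     ennreal_root p (tpot_cost p P P' \<pi>v \<pi>e))"
  by (simp add: d_TpOT_def)

lemma d_TpOT_le:
  assumes "\<pi>v \<in> node_couplings P P'" "\<pi>e \<in> cycle_couplings P P'"
  shows "d_TpOT p P P' \<le> ennreal_root p (tpot_cost p P P' \<pi>v \<pi>e)"
  unfolding d_TpOT_eq by (rule INF_lower2[of "(\<pi>v, \<pi>e)"]) (use assms in auto)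

text \<open>
  The diagonal couplings have cost zero.
\<close>
lemma d_TpOT_self:
  assumes P: "P \<in> measure_topological_networks"
  shows "d_TpOT p P P = 0"
proof -
  note PD = measure_topological_networksD[OF P]
  let ?B = "node_algebra P" and ?N = "cycle_algebra P"
  have \<mu>_sets: "sets (node_measure P) = sets ?B" and \<mu>_prob: "prob_space (node_measure P)"
    using PD(2) by (auto simp: borel_prob_measure_def)
  have \<nu>_sets: "sets (cycle_measure P) = sets (borel_of (cycle_space P))"
    using PD(6) by (simp add: radon_measure_def)
  have \<mu>_space: "space (node_measure P) = topspace (node_space P)"
    using sets_eq_imp_space_eq[OF \<mu>_sets] by simp
  have \<nu>_space: "space (cycle_measure P) = topspace (cycle_space P)"
    using sets_eq_imp_space_eq[OF \<nu>_sets] by simp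
  have dv: "(\<lambda>x. (x, x)) \<in> node_measure P \<rightarrow>\<^sub>M ?B \<Otimes>\<^sub>M ?B"
    unfolding measurable_cong_sets[OF \<mu>_sets refl] by measurable
  have de: "(\<lambda>y. (Some y, Some y)) \<in> cycle_measure P \<rightarrow>\<^sub>M ?N \<Otimes>\<^sub>M ?N"
    unfolding measurable_cong_sets[OF \<nu>_sets refl] using measurable_Some by (intro measurable_Pair) auto
  define \<pi>v where "\<pi>v = distr (node_measure P) (?B \<Otimes>\<^sub>M ?B) (\<lambda>x. (x, x))"
  define \<pi>e where "\<pi>e = distr (cycle_measure P) (?N \<Otimes>\<^sub>M ?N) (\<lambda>y. (Some y, Some y))"
  have v: "\<pi>v \<in> node_couplings P P"
  proof -
    have "prob_space \<pi>v" unfolding \<pi>v_def by (rule prob_space.prob_space_distr[OF \<mu>_prob dv])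
    moreover have "emeasure \<pi>v (A \<times> topspace (node_space P)) = emeasure (node_measure P) A"
      "emeasure \<pi>v (topspace (node_space P) \<times> A) = emeasure (node_measure P) A" if A: "A \<in> sets ?B" for A
    proof -
      have "topspace (node_space P) \<in> sets ?B" using sets.top[of ?B] by simp
      then have "A \<times> topspace (node_space P) \<in> sets (?B \<Otimes>\<^sub>M ?B)" "topspace (node_space P) \<times> A \<in> sets (?B \<Otimes>\<^sub>M ?B)"
        using A by auto
      moreover have "(\<lambda>x. (x, x)) -` (A \<times> topspace (node_space P)) \<inter> space (node_measure P) = A"
        "(\<lambda>x. (x, x)) -` (topspace (node_space P) \<times> A) \<inter> space (node_measure P) = A"
        using sets.sets_into_space[OF A] by (auto simp: \<mu>_space)
      ultimately show "emeasure \<pi>v (A \<times> topspace (node_space P)) = emeasure (node_measure P) A"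
        "emeasure \<pi>v (topspace (node_space P) \<times> A) = emeasure (node_measure P) A"
        unfolding \<pi>v_def by (simp_all add: emeasure_distr[OF dv])
    qed
    ultimately show ?thesis
      by (simp add: couplings_def borel_prob_measure_def sets_borel_of_prod_topology
          polish_imp_second_countable PD \<pi>v_def)
  qed
  have e: "\<pi>e \<in> cycle_couplings P P"
  proof (rule adm_couplingsI[OF PD(4-6) PD(4-6)])
    have top: "topspace (add_point (cycle_space P)) \<in> sets ?N" using sets.top[of ?N] by simp
    fix A assume A: "A \<in> sets (borel_of (cycle_space P))"
    have "(\<lambda>y. (Some y, Some y)) -` (Some ` A \<times> topspace (add_point (cycle_space P))) \<inter> space (cycle_measure P) = A"
      "(\<lambda>y. (Some y, Some y)) -` (topspace (add_point (cycle_space P)) \<times> Some ` A) \<inter> space (cycle_measure P) = A"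
      using sets.sets_into_space[OF A] by (auto simp: \<nu>_space)
    then show "emeasure \<pi>e (Some ` A \<times> topspace (add_point (cycle_space P))) = emeasure (cycle_measure P) A"
      "emeasure \<pi>e (topspace (add_point (cycle_space P)) \<times> Some ` A) = emeasure (cycle_measure P) A"
      unfolding \<pi>e_def
      using pair_measureI[OF Some_image_in_sets[OF A] top] pair_measureI[OF top Some_image_in_sets[OF A]]
      by (simp_all add: emeasure_distr[OF de] del: topspace_add_point)
  next
    have "(\<lambda>y. (Some y, Some y)) -` ({None} \<times> {None}) \<inter> space (cycle_measure P) = {}" by auto
    then have "emeasure \<pi>e ({None} \<times> {None}) = 0"
      unfolding \<pi>e_def emeasure_distr[OF de pair_measureI[OF None_in_sets None_in_sets]] by simp
    then show "emeasure \<pi>e {(None, None)} = 0" by simp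
  qed (simp add: \<pi>e_def)
  have int_v: "(\<integral>\<^sup>+w. f w \<partial>\<pi>v) = (\<integral>\<^sup>+x. f (x, x) \<partial>node_measure P)" if "f \<in> borel_measurable (?B \<Otimes>\<^sub>M ?B)" for f
    unfolding \<pi>v_def by (rule nn_integral_distr[OF dv]) (use that in simp)
  have int_e: "(\<integral>\<^sup>+w. f w \<partial>\<pi>e) = (\<integral>\<^sup>+y. f (Some y, Some y) \<partial>cycle_measure P)" if "f \<in> borel_measurable (?N \<Otimes>\<^sub>M ?N)" for f
    unfolding \<pi>e_def by (rule nn_integral_distr[OF de]) (use that in simp)
  note vD = node_couplingsD[OF P P v] and eD = cycle_couplingsD[OF P P e]
  interpret v: prob_space \<pi>v by (rule vD)
  interpret e: sigma_finite_measure \<pi>e by (rule eD)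
  have node_m: "node_cost p P P \<in> borel_measurable ((?B \<Otimes>\<^sub>M ?B) \<Otimes>\<^sub>M \<pi>v)"
    using measurable_node_cost[OF P P]
    by (simp only: measurable_cong_sets[OF sets_pair_measure_cong[OF refl vD(1)] refl])
  have inc_m: "incidence_cost p P P \<in> borel_measurable ((?B \<Otimes>\<^sub>M ?B) \<Otimes>\<^sub>M \<pi>e)"
    using measurable_incidence_cost[OF P P]
    by (simp only: measurable_cong_sets[OF sets_pair_measure_cong[OF refl eD(1)] refl])
  have "(\<integral>\<^sup>+v. cycle_cost p P P v \<partial>\<pi>e) = 0"
    by (subst int_e[OF measurable_cycle_cost[OF P P]]) (simp add: cycle_cost_def lp_diff_same)
  moreover have "(\<integral>\<^sup>+w. \<integral>\<^sup>+w'. node_cost p P P (w, w') \<partial>\<pi>v \<partial>\<pi>v) = 0"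
  proof -
    have "(\<integral>\<^sup>+w'. node_cost p P P ((x, x), w') \<partial>\<pi>v) = 0" if "x \<in> topspace (node_space P)" for x
    proof -
      have "(\<lambda>w'. node_cost p P P ((x, x), w')) \<in> borel_measurable (?B \<Otimes>\<^sub>M ?B)"
        by (rule measurable_compose_Pair1[OF _ measurable_node_cost[OF P P]]) (simp add: that space_pair_measure)
      from int_v[OF this] show ?thesis by (simp add: node_cost_def)
    qed
    moreover have "(\<integral>\<^sup>+w. \<integral>\<^sup>+w'. node_cost p P P (w, w') \<partial>\<pi>v \<partial>\<pi>v)
        = (\<integral>\<^sup>+x. \<integral>\<^sup>+w'. node_cost p P P ((x, x), w') \<partial>\<pi>v \<partial>node_measure P)"
      by (rule int_v[OF v.borel_measurable_nn_integral_fst[OF node_m]])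
    moreover have "\<dots> = (\<integral>\<^sup>+x. 0 \<partial>node_measure P)"
      by (intro nn_integral_cong) (simp add: \<mu>_space calculation(1))
    ultimately show ?thesis by simp
  qed
  moreover have "(\<integral>\<^sup>+w. \<integral>\<^sup>+v. incidence_cost p P P (w, v) \<partial>\<pi>e \<partial>\<pi>v) = 0"
  proof -
    have "(\<integral>\<^sup>+v. incidence_cost p P P ((x, x), v) \<partial>\<pi>e) = 0" if "x \<in> topspace (node_space P)" for x
    proof -
      have "(\<lambda>v. incidence_cost p P P ((x, x), v)) \<in> borel_measurable (?N \<Otimes>\<^sub>M ?N)"
        by (rule measurable_compose_Pair1[OF _ measurable_incidence_cost[OF P P]]) (simp add: that space_pair_measure)
      from int_e[OF this] show ?thesis by (simp add: incidence_cost_def)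
    qed
    moreover have "(\<integral>\<^sup>+w. \<integral>\<^sup>+v. incidence_cost p P P (w, v) \<partial>\<pi>e \<partial>\<pi>v)
        = (\<integral>\<^sup>+x. \<integral>\<^sup>+v. incidence_cost p P P ((x, x), v) \<partial>\<pi>e \<partial>node_measure P)"
      by (rule int_v[OF e.borel_measurable_nn_integral_fst[OF inc_m]])
    moreover have "\<dots> = (\<integral>\<^sup>+x. 0 \<partial>node_measure P)"
      by (intro nn_integral_cong) (simp add: \<mu>_space calculation(1))
    ultimately show ?thesis by simp
  qed
  ultimately have "tpot_cost p P P \<pi>v \<pi>e = 0" by (simp add: tpot_cost_iterated[OF P P v e])
  then have "ennreal_root p (tpot_cost p P P \<pi>v \<pi>e) = 0" by (simp add: ennreal_root_def)
  with d_TpOT_le[OF v e, of p] show ?thesis by simp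
qed

text \<open>
  Swapping coordinates turns couplings into couplings of the same cost.
\<close>
lemma d_TpOT_commute_le:
  assumes P: "P \<in> measure_topological_networks" and P': "P' \<in> measure_topological_networks"
  shows "d_TpOT p P' P \<le> d_TpOT p P P'"
  unfolding d_TpOT_eq[of p P P']
proof (rule INF_greatest, clarify)
  fix \<pi>v \<pi>e assume v: "\<pi>v \<in> node_couplings P P'" and e: "\<pi>e \<in> cycle_couplings P P'"
  let ?B = "node_algebra P" and ?N = "cycle_algebra P" and ?B' = "node_algebra P'" and ?N' = "cycle_algebra P'"
  note PD = measure_topological_networksD[OF P] and PD' = measure_topological_networksD[OF P']
  note vD = node_couplingsD[OF P P' v] and eD = cycle_couplingsD[OF P P' e]
  let ?sw = "\<lambda>(x, y). (y, x)"
  have swv: "?sw \<in> \<pi>v \<rightarrow>\<^sub>M ?B' \<Otimes>\<^sub>M ?B"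
    unfolding measurable_cong_sets[OF vD(1) refl] by (rule measurable_pair_swap')
  have swe: "?sw \<in> \<pi>e \<rightarrow>\<^sub>M ?N' \<Otimes>\<^sub>M ?N"
    unfolding measurable_cong_sets[OF eD(1) refl] by (rule measurable_pair_swap')
  have space_v: "space \<pi>v = topspace (node_space P) \<times> topspace (node_space P')"
    using sets_eq_imp_space_eq[OF vD(1)] by (simp add: space_pair_measure)
  have space_e: "space \<pi>e = topspace (add_point (cycle_space P)) \<times> topspace (add_point (cycle_space P'))"
    using sets_eq_imp_space_eq[OF eD(1)] by (simp add: space_pair_measure)
  define \<rho>v where "\<rho>v = distr \<pi>v (?B' \<Otimes>\<^sub>M ?B) ?sw"
  define \<rho>e where "\<rho>e = distr \<pi>e (?N' \<Otimes>\<^sub>M ?N) ?sw"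
  have v_rect: "emeasure \<rho>v (A \<times> B) = emeasure \<pi>v (B \<times> A)" if "A \<in> sets ?B'" "B \<in> sets ?B" for A B
  proof -
    have "?sw -` (A \<times> B) \<inter> space \<pi>v = B \<times> A"
      using sets.sets_into_space[OF that(1)] sets.sets_into_space[OF that(2)] by (auto simp: space_v)
    then show ?thesis unfolding \<rho>v_def using that by (simp add: emeasure_distr[OF swv])
  qed
  have e_rect: "emeasure \<rho>e (A \<times> B) = emeasure \<pi>e (B \<times> A)" if "A \<in> sets ?N'" "B \<in> sets ?N" for A B
  proof -
    have "?sw -` (A \<times> B) \<inter> space \<pi>e = B \<times> A"
      using sets.sets_into_space[OF that(1)] sets.sets_into_space[OF that(2)] by (auto simp: space_e)
    then show ?thesis unfolding \<rho>e_def using that by (simp add: emeasure_distr[OF swe])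
  qed
  have \<rho>v: "\<rho>v \<in> node_couplings P' P"
  proof -
    have "prob_space \<rho>v" unfolding \<rho>v_def by (rule prob_space.prob_space_distr[OF vD(2) swv])
    moreover have "topspace (node_space P) \<in> sets ?B" "topspace (node_space P') \<in> sets ?B'"
      using sets.top[of ?B] sets.top[of ?B'] by auto
    ultimately show ?thesis
      using v by (simp add: couplings_def borel_prob_measure_def sets_borel_of_prod_topology
          polish_imp_second_countable PD PD' v_rect) (simp add: \<rho>v_def)
  qed
  have \<rho>e: "\<rho>e \<in> cycle_couplings P' P"
  proof (rule adm_couplingsI[OF PD'(4-6) PD(4-6)])
    have top: "topspace (add_point (cycle_space P)) \<in> sets ?N" "topspace (add_point (cycle_space P')) \<in> sets ?N'"
      using sets.top[of ?N] sets.top[of ?N'] by auto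
    show "emeasure \<rho>e (Some ` A \<times> topspace (add_point (cycle_space P))) = emeasure (cycle_measure P') A"
      if "A \<in> sets (borel_of (cycle_space P'))" for A
      using e that e_rect[OF Some_image_in_sets[OF that] top(1)] by (simp add: adm_couplings_def)
    show "emeasure \<rho>e (topspace (add_point (cycle_space P')) \<times> Some ` A) = emeasure (cycle_measure P) A"
      if "A \<in> sets (borel_of (cycle_space P))" for A
      using e that e_rect[OF top(2) Some_image_in_sets[OF that]] by (simp add: adm_couplings_def)
    show "emeasure \<rho>e {(None, None)} = 0"
      using e e_rect[OF None_in_sets None_in_sets] by (simp add: adm_couplings_def)
  qed (simp add: \<rho>e_def)
  have int_v: "(\<integral>\<^sup>+w. f w \<partial>\<rho>v) = (\<integral>\<^sup>+w. f (?sw w) \<partial>\<pi>v)" if "f \<in> borel_measurable (?B' \<Otimes>\<^sub>M ?B)" for f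
    unfolding \<rho>v_def by (rule nn_integral_distr[OF swv]) (use that in simp)
  have int_e: "(\<integral>\<^sup>+w. f w \<partial>\<rho>e) = (\<integral>\<^sup>+w. f (?sw w) \<partial>\<pi>e)" if "f \<in> borel_measurable (?N' \<Otimes>\<^sub>M ?N)" for f
    unfolding \<rho>e_def by (rule nn_integral_distr[OF swe]) (use that in simp)
  note \<rho>vD = node_couplingsD[OF P' P \<rho>v] and \<rho>eD = cycle_couplingsD[OF P' P \<rho>e]
  interpret v: prob_space \<rho>v by (rule \<rho>vD)
  interpret e: sigma_finite_measure \<rho>e by (rule \<rho>eD)
  have node_m: "node_cost p P' P \<in> borel_measurable ((?B' \<Otimes>\<^sub>M ?B) \<Otimes>\<^sub>M \<rho>v)"
    using measurable_node_cost[OF P' P]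
    by (simp only: measurable_cong_sets[OF sets_pair_measure_cong[OF refl \<rho>vD(1)] refl])
  have inc_m: "incidence_cost p P' P \<in> borel_measurable ((?B' \<Otimes>\<^sub>M ?B) \<Otimes>\<^sub>M \<rho>e)"
    using measurable_incidence_cost[OF P' P]
    by (simp only: measurable_cong_sets[OF sets_pair_measure_cong[OF refl \<rho>eD(1)] refl])
  have "(\<integral>\<^sup>+v. cycle_cost p P' P v \<partial>\<rho>e) = (\<integral>\<^sup>+v. cycle_cost p P P' v \<partial>\<pi>e)"
    by (subst int_e[OF measurable_cycle_cost[OF P' P]])
       (simp add: cycle_cost_def split_beta' lp_diff_commute[of p "map_option (cycle_map P') _"])
  moreover have "(\<integral>\<^sup>+w. \<integral>\<^sup>+w'. node_cost p P' P (w, w') \<partial>\<rho>v \<partial>\<rho>v) = (\<integral>\<^sup>+w. \<integral>\<^sup>+w'. node_cost p P P' (w, w') \<partial>\<pi>v \<partial>\<pi>v)"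
    unfolding int_v[OF v.borel_measurable_nn_integral_fst[OF node_m]]
  proof (rule nn_integral_cong)
    fix w assume w: "w \<in> space \<pi>v"
    have "(\<lambda>w'. node_cost p P' P (?sw w, w')) \<in> borel_measurable (?B' \<Otimes>\<^sub>M ?B)"
      by (rule measurable_compose_Pair1[OF _ measurable_node_cost[OF P' P]])
         (use w in \<open>auto simp: space_pair_measure space_v\<close>)
    from int_v[OF this]
    show "(\<integral>\<^sup>+w'. node_cost p P' P (?sw w, w') \<partial>\<rho>v) = (\<integral>\<^sup>+w'. node_cost p P P' (w, w') \<partial>\<pi>v)"
      by (simp add: node_cost_def split_beta' abs_minus_commute)
  qed
  moreover have "(\<integral>\<^sup>+w. \<integral>\<^sup>+v. incidence_cost p P' P (w, v) \<partial>\<rho>e \<partial>\<rho>v) = (\<integral>\<^sup>+w. \<integral>\<^sup>+v. incidence_cost p P P' (w, v) \<partial>\<pi>e \<partial>\<pi>v)"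
    unfolding int_v[OF e.borel_measurable_nn_integral_fst[OF inc_m]]
  proof (rule nn_integral_cong)
    fix w assume w: "w \<in> space \<pi>v"
    have "(\<lambda>v. incidence_cost p P' P (?sw w, v)) \<in> borel_measurable (?N' \<Otimes>\<^sub>M ?N)"
      by (rule measurable_compose_Pair1[OF _ measurable_incidence_cost[OF P' P]])
         (use w in \<open>auto simp: space_pair_measure space_v\<close>)
    from int_e[OF this]
    show "(\<integral>\<^sup>+v. incidence_cost p P' P (?sw w, v) \<partial>\<rho>e) = (\<integral>\<^sup>+v. incidence_cost p P P' (w, v) \<partial>\<pi>e)"
      by (simp add: incidence_cost_def split_beta' abs_minus_commute)
  qed
  ultimately have "tpot_cost p P' P \<rho>v \<rho>e = tpot_cost p P P' \<pi>v \<pi>e"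
    by (simp only: tpot_cost_iterated[OF P' P \<rho>v \<rho>e] tpot_cost_iterated[OF P P' v e])
  then show "d_TpOT p P' P \<le> ennreal_root p (tpot_cost p P P' \<pi>v \<pi>e)"
    using d_TpOT_le[OF \<rho>v \<rho>e, of p] by simp
qed

text \<open>
  Each of the three cost functions satisfies a pointwise triangle inequality, so
  \<open>ennreal_powr_add_le_split\<close> gives a bound with the same two weights for all three terms, and the bounds can be added.
\<close>
lemma tpot_cost_compose:
  assumes P1: "P1 \<in> measure_topological_networks" and P2: "P2 \<in> measure_topological_networks"
    and P3: "P3 \<in> measure_topological_networks" and p: "1 \<le> p"
    and v12: "v12 \<in> node_couplings P1 P2" and e12: "e12 \<in> cycle_couplings P1 P2"
    and v23: "v23 \<in> node_couplings P2 P3" and e23: "e23 \<in> cycle_couplings P2 P3"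
  obtains v13 e13 where "v13 \<in> node_couplings P1 P3" "e13 \<in> cycle_couplings P1 P3"
    "\<And>a b. 0 < a \<Longrightarrow> 0 < b \<Longrightarrow> tpot_cost p P1 P3 v13 e13 \<le>
       ennreal (split_weight p a b) * tpot_cost p P1 P2 v12 e12
       + ennreal (split_weight p b a) * tpot_cost p P2 P3 v23 e23"
proof -
  note D1 = measure_topological_networksD[OF P1] and D2 = measure_topological_networksD[OF P2]
    and D3 = measure_topological_networksD[OF P3]
  obtain v13 where v13: "v13 \<in> node_couplings P1 P3"
    and v_le: "\<And>c12 c23 c13 A B. c12 \<in> borel_measurable (node_algebra P1 \<Otimes>\<^sub>M node_algebra P2) \<Longrightarrow>
      c23 \<in> borel_measurable (node_algebra P2 \<Otimes>\<^sub>M node_algebra P3) \<Longrightarrow>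
      c13 \<in> borel_measurable (node_algebra P1 \<Otimes>\<^sub>M node_algebra P3) \<Longrightarrow>
      (\<And>x y z. x \<in> topspace (node_space P1) \<Longrightarrow> y \<in> topspace (node_space P2) \<Longrightarrow> z \<in> topspace (node_space P3) \<Longrightarrow>
         c13 (x, z) \<le> A * c12 (x, y) + B * c23 (y, z)) \<Longrightarrow>
      (\<integral>\<^sup>+w. c13 w \<partial>v13) \<le> A * (\<integral>\<^sup>+w. c12 w \<partial>v12) + B * (\<integral>\<^sup>+w. c23 w \<partial>v23)"
    using couplings_compose[OF D1(1) D2(1) D3(1) D2(2) D1(9) D3(9) v12 v23] by blast
  obtain e13 where e13: "e13 \<in> cycle_couplings P1 P3"
    and e_le: "\<And>c12 c23 c13 A B. c12 \<in> borel_measurable (cycle_algebra P1 \<Otimes>\<^sub>M cycle_algebra P2) \<Longrightarrow>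
      c23 \<in> borel_measurable (cycle_algebra P2 \<Otimes>\<^sub>M cycle_algebra P3) \<Longrightarrow>
      c13 \<in> borel_measurable (cycle_algebra P1 \<Otimes>\<^sub>M cycle_algebra P3) \<Longrightarrow>
      c12 (None, None) = 0 \<Longrightarrow> c23 (None, None) = 0 \<Longrightarrow>
      (\<And>x y z. x \<in> topspace (add_point (cycle_space P1)) \<Longrightarrow> y \<in> topspace (add_point (cycle_space P2)) \<Longrightarrow>
         z \<in> topspace (add_point (cycle_space P3)) \<Longrightarrow> y \<noteq> None \<or> x = None \<or> z = None \<Longrightarrow>
         c13 (x, z) \<le> A * c12 (x, y) + B * c23 (y, z)) \<Longrightarrow>
      (\<integral>\<^sup>+w. c13 w \<partial>e13) \<le> A * (\<integral>\<^sup>+w. c12 w \<partial>e12) + B * (\<integral>\<^sup>+w. c23 w \<partial>e23)"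
    using adm_couplings_compose[OF D1(4-6) D2(4-6) D3(4-6) e12 e23] by blast
  have slice: "(\<lambda>w'. f (w, w')) \<in> borel_measurable N" if "f \<in> borel_measurable (M \<Otimes>\<^sub>M N)" "w \<in> space M"
    for f :: "_ \<Rightarrow> ennreal" and M N w
    by (rule measurable_compose_Pair1[OF that(2,1)])
  have integral: "(\<lambda>w. \<integral>\<^sup>+w'. f (w, w') \<partial>K) \<in> borel_measurable M"
    if "f \<in> borel_measurable (M \<Otimes>\<^sub>M N)" "sets K = sets N" "sigma_finite_measure K"
    for f :: "_ \<Rightarrow> ennreal" and M N K
    by (rule sigma_finite_measure.borel_measurable_nn_integral_fst[OF that(3)])
       (use that(1) in \<open>simp only: measurable_cong_sets[OF sets_pair_measure_cong[OF refl that(2)] refl]\<close>)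
  note v12D = node_couplingsD[OF P1 P2 v12] and v23D = node_couplingsD[OF P2 P3 v23] and v13D = node_couplingsD[OF P1 P3 v13]
  note e12D = cycle_couplingsD[OF P1 P2 e12] and e23D = cycle_couplingsD[OF P2 P3 e23] and e13D = cycle_couplingsD[OF P1 P3 e13]
  have sf: "sigma_finite_measure v12" "sigma_finite_measure v23" "sigma_finite_measure v13"
    using v12D(2) v23D(2) v13D(2) prob_space_imp_sigma_finite by auto
  have "tpot_cost p P1 P3 v13 e13 \<le> ennreal (split_weight p a b) * tpot_cost p P1 P2 v12 e12
       + ennreal (split_weight p b a) * tpot_cost p P2 P3 v23 e23" if ab: "0 < a" "0 < b" for a b
  proof -
    let ?A = "ennreal (split_weight p a b)" and ?B = "ennreal (split_weight p b a)"
    note split = ennreal_powr_add_le_split[OF p ab]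
    have cycle: "(\<integral>\<^sup>+v. cycle_cost p P1 P3 v \<partial>e13) \<le> ?A * (\<integral>\<^sup>+v. cycle_cost p P1 P2 v \<partial>e12) + ?B * (\<integral>\<^sup>+v. cycle_cost p P2 P3 v \<partial>e23)"
    proof (rule e_le)
      fix x :: "'b option" and y :: "'d option" and z :: "'f option"
      assume "y \<noteq> None \<or> x = None \<or> z = None"
      then show "cycle_cost p P1 P3 (x, z) \<le> ?A * cycle_cost p P1 P2 (x, y) + ?B * cycle_cost p P2 P3 (y, z)"
        unfolding cycle_cost_def fst_conv snd_conv
        by (intro split lp_diff_nonneg lp_diff_triangle[OF p]) auto
    qed (simp_all add: measurable_cycle_cost P1 P2 P3, simp_all add: cycle_cost_def)
    have node: "(\<integral>\<^sup>+w. \<integral>\<^sup>+w'. node_cost p P1 P3 (w, w') \<partial>v13 \<partial>v13) \<le>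
        ?A * (\<integral>\<^sup>+w. \<integral>\<^sup>+w'. node_cost p P1 P2 (w, w') \<partial>v12 \<partial>v12) + ?B * (\<integral>\<^sup>+w. \<integral>\<^sup>+w'. node_cost p P2 P3 (w, w') \<partial>v23 \<partial>v23)"
    proof (rule v_le)
      fix x y z assume xyz: "x \<in> topspace (node_space P1)" "y \<in> topspace (node_space P2)" "z \<in> topspace (node_space P3)"
      show "(\<integral>\<^sup>+w'. node_cost p P1 P3 ((x, z), w') \<partial>v13) \<le>
        ?A * (\<integral>\<^sup>+w'. node_cost p P1 P2 ((x, y), w') \<partial>v12) + ?B * (\<integral>\<^sup>+w'. node_cost p P2 P3 ((y, z), w') \<partial>v23)"
      proof (rule v_le)
        fix x' y' z'
        show "node_cost p P1 P3 ((x, z), (x', z')) \<le> ?A * node_cost p P1 P2 ((x, y), (x', y')) + ?B * node_cost p P2 P3 ((y, z), (y', z'))"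
          unfolding node_cost_def fst_conv snd_conv by (intro split) auto
      qed (use xyz in \<open>auto intro!: slice[OF measurable_node_cost] P1 P2 P3 simp: space_pair_measure\<close>)
    qed (intro integral[OF measurable_node_cost] P1 P2 P3 v12D(1) v23D(1) v13D(1) sf)+
    have inc: "(\<integral>\<^sup>+w. \<integral>\<^sup>+v. incidence_cost p P1 P3 (w, v) \<partial>e13 \<partial>v13) \<le>
        ?A * (\<integral>\<^sup>+w. \<integral>\<^sup>+v. incidence_cost p P1 P2 (w, v) \<partial>e12 \<partial>v12) + ?B * (\<integral>\<^sup>+w. \<integral>\<^sup>+v. incidence_cost p P2 P3 (w, v) \<partial>e23 \<partial>v23)"
    proof (rule v_le)
      fix x y z assume xyz: "x \<in> topspace (node_space P1)" "y \<in> topspace (node_space P2)" "z \<in> topspace (node_space P3)"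
      show "(\<integral>\<^sup>+v. incidence_cost p P1 P3 ((x, z), v) \<partial>e13) \<le>
        ?A * (\<integral>\<^sup>+v. incidence_cost p P1 P2 ((x, y), v) \<partial>e12) + ?B * (\<integral>\<^sup>+v. incidence_cost p P2 P3 ((y, z), v) \<partial>e23)"
      proof (rule e_le)
        fix x' :: "'b option" and y' :: "'d option" and z' :: "'f option"
        show "incidence_cost p P1 P3 ((x, z), (x', z')) \<le> ?A * incidence_cost p P1 P2 ((x, y), (x', y')) + ?B * incidence_cost p P2 P3 ((y, z), (y', z'))"
          unfolding incidence_cost_def fst_conv snd_conv by (intro split) auto
        show "incidence_cost p P1 P2 ((x, y), (None, None)) = 0" "incidence_cost p P2 P3 ((y, z), (None, None)) = 0"
          by (simp_all add: incidence_cost_def)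
      qed (use xyz in \<open>auto intro!: slice[OF measurable_incidence_cost] P1 P2 P3 simp: space_pair_measure\<close>)
    qed (intro integral[OF measurable_incidence_cost] P1 P2 P3 e12D e23D e13D)+
    show ?thesis
      unfolding tpot_cost_iterated[OF P1 P3 v13 e13] tpot_cost_iterated[OF P1 P2 v12 e12] tpot_cost_iterated[OF P2 P3 v23 e23]
      using add_mono[OF add_mono[OF cycle node] inc] by (simp add: distrib_left ac_simps)
  qed
  then show ?thesis using that v13 e13 by blast
qed

lemma le_INF_add_INF:
  fixes d :: ennreal
  assumes "\<And>x y. x \<in> S \<Longrightarrow> y \<in> T \<Longrightarrow> d \<le> f x + g y"
  shows "d \<le> (INF x\<in>S. f x) + (INF y\<in>T. g y)"
proof (rule ennreal_le_epsilon)
  fix e :: real assume e: "0 < e" and fin: "(INF x\<in>S. f x) + (INF y\<in>T. g y) < top"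
  have e2: "0 < ennreal (e / 2)" using e by simp
  have less: "I < I + ennreal (e / 2)" if "I < top" for I
    using ennreal_add_left_cancel_less[of I 0 "ennreal (e / 2)"] that e2 by auto
  have "(INF x\<in>S. f x) < (INF x\<in>S. f x) + ennreal (e / 2)" "(INF y\<in>T. g y) < (INF y\<in>T. g y) + ennreal (e / 2)"
    using fin unfolding ennreal_add_less_top by (blast intro: less)+
  then obtain x y where xy: "x \<in> S" "f x < (INF x\<in>S. f x) + ennreal (e / 2)"
    "y \<in> T" "g y < (INF y\<in>T. g y) + ennreal (e / 2)"
    unfolding INF_less_iff by blast
  have "d \<le> f x + g y" by (rule assms[OF xy(1,3)])
  also have "\<dots> \<le> ((INF x\<in>S. f x) + ennreal (e / 2)) + ((INF y\<in>T. g y) + ennreal (e / 2))"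
    using xy by (intro add_mono) auto
  also have "\<dots> = (INF x\<in>S. f x) + (INF y\<in>T. g y) + (ennreal (e / 2) + ennreal (e / 2))"
    by (simp only: ac_simps)
  also have "ennreal (e / 2) + ennreal (e / 2) = ennreal e"
    using e by (simp add: ennreal_plus[symmetric] del: ennreal_plus)
  finally show "d \<le> (INF x\<in>S. f x) + (INF y\<in>T. g y) + ennreal e" .
qed

lemma d_TpOT_triangle:
  assumes p: "1 \<le> p" and P: "P1 \<in> measure_topological_networks"
    "P2 \<in> measure_topological_networks" "P3 \<in> measure_topological_networks"
  shows "d_TpOT p P1 P3 \<le> d_TpOT p P1 P2 + d_TpOT p P2 P3"
  unfolding d_TpOT_eq[of p P1 P2] d_TpOT_eq[of p P2 P3]
proof (rule le_INF_add_INF, clarify)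
  fix v12 e12 v23 e23
  assume *: "v12 \<in> node_couplings P1 P2" "e12 \<in> cycle_couplings P1 P2"
    "v23 \<in> node_couplings P2 P3" "e23 \<in> cycle_couplings P2 P3"
  obtain v13 e13 where "v13 \<in> node_couplings P1 P3" "e13 \<in> cycle_couplings P1 P3"
    and le: "\<And>a b. 0 < a \<Longrightarrow> 0 < b \<Longrightarrow> tpot_cost p P1 P3 v13 e13 \<le>
       ennreal (split_weight p a b) * tpot_cost p P1 P2 v12 e12
       + ennreal (split_weight p b a) * tpot_cost p P2 P3 v23 e23"
    using tpot_cost_compose[OF P p *] by blast
  then have "d_TpOT p P1 P3 \<le> ennreal_root p (tpot_cost p P1 P3 v13 e13)"
    by (intro d_TpOT_le)
  also have "\<dots> \<le> ennreal_root p (tpot_cost p P1 P2 v12 e12) + ennreal_root p (tpot_cost p P2 P3 v23 e23)"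
    by (rule ennreal_root_add_le[OF p le])
  finally show "d_TpOT p P1 P3 \<le> ennreal_root p (tpot_cost p P1 P2 v12 e12) + ennreal_root p (tpot_cost p P2 P3 v23 e23)" .
qed

theorem proposition2:
  fixes p :: real
    and P1 :: "('x1, 'y1) network"
    and P2 :: "('x2, 'y2) network"
    and P3 :: "('x3, 'y3) network"
  assumes "1 \<le> p"
    and "P1 \<in> measure_topological_networks"
    and "P2 \<in> measure_topological_networks"
    and "P3 \<in> measure_topological_networks"
  shows "d_TpOT p P1 P1 = 0 \<and>
         d_TpOT p P1 P2 = d_TpOT p P2 P1 \<and>
         d_TpOT p P1 P3 \<le> d_TpOT p P1 P2 + d_TpOT p P2 P3"
  using d_TpOT_self[OF assms(2)] d_TpOT_triangle[OF assms]
    antisym[OF d_TpOT_commute_le[OF assms(3,2)] d_TpOT_commute_le[OF assms(2,3)]]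
  by blast

end
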